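(* Let $d=2$ and consider a constant magnetic field with field strength $B>0$, with magnetic potential $\mathbf A(x)=\frac B2(x_2,-x_1)$, $x=(x_1,x_2)\in\mathbb R^2$. Given any $p\in(1,2)$ and any $\beta>0$, let $\nu_{\mathbf B}(\beta)$ be the largest constant such that $$\|\nabla_{\mathbf A}\psi\|_2^2+\beta\|\psi\|_p^2\ge\nu_{\mathbf B}(\beta)\,\|\psi\|_2^2\quad\forall\,\psi\in\mathrm H^1_{\mathbf A}(\mathbb R^2).$$ Then $$\nu_{\mathbf B}(\beta)\ge c_\ast\,B+\mathsf C_p\,\beta^{\frac p2}\,(1-c_\ast^2)^{1-\frac p2}=:\nu_{\mathrm{LT}}(\beta),$$ where $c_\ast$ is the unique point in $(0,1)$ such that $$\frac{c_\ast}{(1-c_\ast^2)^{p/2}}=\frac B{(2-p)\,\mathsf C_p\,\beta^{p/2}}.$$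
   Context: $\|\cdot\|_q$ is the norm of $\mathrm L^q(\mathbb R^2)$, with $\|\psi\|_q=+\infty$ if $\psi\notin\mathrm L^q(\mathbb R^2)$. $\nabla_{\mathbf A}:=\nabla+i\mathbf A$ and $\mathrm H^1_{\mathbf A}(\mathbb R^2):=\{\psi\in\mathrm L^2(\mathbb R^2;\mathbb C):\nabla_{\mathbf A}\psi\in\mathrm L^2(\mathbb R^2)\}$. For $p\in(1,2)$, $\mathsf C_p:=\min_{u\in\mathrm H^1(\mathbb R^2)\setminus\{0\}}\frac{\|\nabla u\|_2^2+\|u\|_p^2}{\|u\|_2^2}$. *)

theory Defs
  imports "HOL-Analysis.Analysis"
begin

section \<open>Lebesgue spaces on the plane\<close>

definition Lspace :: "real \<Rightarrow> (real^2 \<Rightarrow> 'b::euclidean_space) set" where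
  "Lspace q = {f \<in> borel_measurable lebesgue. integrable lebesgue (\<lambda>x. norm (f x) powr q)}"

definition Lnorm :: "real \<Rightarrow> (real^2 \<Rightarrow> 'b::euclidean_space) \<Rightarrow> ereal" where
  "Lnorm q f =
     (if f \<in> Lspace q then ereal ((LINT x|lebesgue. norm (f x) powr q) powr (1 / q)) else \<infinity>)"

definition locally_integrable :: "(real^2 \<Rightarrow> 'b::euclidean_space) \<Rightarrow> bool" where
  "locally_integrable f \<longleftrightarrow> (\<forall>K. compact K \<longrightarrow> f absolutely_integrable_on K)"

section \<open>Test functions\<close>

definition partial :: "2 \<Rightarrow> (real^2 \<Rightarrow> real) \<Rightarrow> real^2 \<Rightarrow> real" where
  "partial j f x = frechet_derivative f (at x) (axis j 1)"

primrec C_k :: "nat \<Rightarrow> (real^2 \<Rightarrow> real) \<Rightarrow> bool" where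
  "C_k 0 f \<longleftrightarrow> continuous_on UNIV f"
| "C_k (Suc k) f \<longleftrightarrow> f differentiable_on UNIV \<and> (\<forall>j. C_k k (partial j f))"

definition test_function :: "(real^2 \<Rightarrow> real) \<Rightarrow> bool" where
  "test_function \<phi> \<longleftrightarrow> (\<forall>k. C_k k \<phi>) \<and> compact (closure {x. \<phi> x \<noteq> 0})"

section \<open>Magnetic gradient and Sobolev spaces\<close>

text \<open>
  \<open>G\<close> represents the distribution \<open>\<nabla>\<psi> + i A \<psi>\<close>. The potential \<open>A\<close> is meant to be
  continuous, so that \<open>A \<psi>\<close> is locally integrable. Real test functions suffice, because
  both sides are linear in \<open>\<phi>\<close>.
\<close>
definition has_mag_gradient ::
    "(real^2 \<Rightarrow> real^2) \<Rightarrow> (real^2 \<Rightarrow> complex) \<Rightarrow> (real^2 \<Rightarrow> complex^2) \<Rightarrow> bool" where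
  "has_mag_gradient A \<psi> G \<longleftrightarrow>
     locally_integrable \<psi> \<and> locally_integrable G \<and>
     (\<forall>\<phi> j. test_function \<phi> \<longrightarrow>
        (LINT x|lebesgue. G x $ j * of_real (\<phi> x)) =
        (LINT x|lebesgue. - \<psi> x * of_real (partial j \<phi> x)
                          + \<i> * of_real (A x $ j) * \<psi> x * of_real (\<phi> x)))"

text \<open>
  The gradient is determined only almost everywhere; \<open>mag_gradient\<close> picks a representative,
  and its Lebesgue norms do not depend on the choice.
\<close>
definition mag_gradient ::
    "(real^2 \<Rightarrow> real^2) \<Rightarrow> (real^2 \<Rightarrow> complex) \<Rightarrow> real^2 \<Rightarrow> complex^2" where
  "mag_gradient A \<psi> = (SOME G. has_mag_gradient A \<psi> G)"

definition H1_mag :: "(real^2 \<Rightarrow> real^2) \<Rightarrow> (real^2 \<Rightarrow> complex) set" where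
  "H1_mag A = {\<psi> \<in> Lspace 2. \<exists>G. has_mag_gradient A \<psi> G \<and> G \<in> Lspace 2}"

abbreviation gradient :: "(real^2 \<Rightarrow> complex) \<Rightarrow> real^2 \<Rightarrow> complex^2" where
  "gradient \<equiv> mag_gradient (\<lambda>x. 0)"

abbreviation H1 :: "(real^2 \<Rightarrow> complex) set" where
  "H1 \<equiv> H1_mag (\<lambda>x. 0)"

section \<open>The constants\<close>

text \<open>
  The minimum is written as an infimum, so that its attainment is not presupposed.
  Functions are identified almost everywhere, so \<open>u \<noteq> 0\<close> means: not almost everywhere zero.
\<close>
definition C_opt :: "real \<Rightarrow> real" where
  "C_opt p = real_of_ereal
     (INF u\<in>{u \<in> H1. \<not> (AE x in lebesgue. u x = 0)}.
        ((Lnorm 2 (gradient u))\<^sup>2 + (Lnorm p u)\<^sup>2) / (Lnorm 2 u)\<^sup>2)"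

definition mag_potential :: "real \<Rightarrow> real^2 \<Rightarrow> real^2" where
  "mag_potential B x = (B / 2) *\<^sub>R vector [x $ 2, - x $ 1]"

definition nu_mag :: "real \<Rightarrow> real \<Rightarrow> real \<Rightarrow> real" where
  "nu_mag B p \<beta> = (GREATEST \<nu>. \<forall>\<psi>\<in>H1_mag (mag_potential B).
     (Lnorm 2 (mag_gradient (mag_potential B) \<psi>))\<^sup>2 + ereal \<beta> * (Lnorm p \<psi>)\<^sup>2
       \<ge> ereal \<nu> * (Lnorm 2 \<psi>)\<^sup>2)"

definition is_c_star :: "real \<Rightarrow> real \<Rightarrow> real \<Rightarrow> real \<Rightarrow> bool" where
  "is_c_star B p \<beta> c \<longleftrightarrow>
     0 < c \<and> c < 1 \<and>
     c / (1 - c\<^sup>2) powr (p / 2) = B / ((2 - p) * C_opt p * \<beta> powr (p / 2))"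

definition c_star :: "real \<Rightarrow> real \<Rightarrow> real \<Rightarrow> real" where
  "c_star B p \<beta> = (THE c. is_c_star B p \<beta> c)"

definition nu_LT :: "real \<Rightarrow> real \<Rightarrow> real \<Rightarrow> real" where
  "nu_LT B p \<beta> =
     c_star B p \<beta> * B
     + C_opt p * \<beta> powr (p / 2) * (1 - (c_star B p \<beta>)\<^sup>2) powr (1 - p / 2)"

end

theory Submission
  imports
    Defs
    "HOL-Computational_Algebra.Polynomial"
    "HOL-Probability.Probability_Measure"
begin

text \<open>
  For \<open>\<psi> \<in> H\<^sup>1\<^sub>A\<close> with magnetic gradient \<open>G\<close> put \<open>g = Re (cnj \<psi> G) / |\<psi>|\<close>, which is the weak
  gradient of \<open>|\<psi>|\<close>. Completing a square gives, pointwise and for every \<open>c \<in> [0, 1]\<close>,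
  \<open>|G|\<^sup>2 \<ge> (1 - c\<^sup>2) |g|\<^sup>2 + 2 c Im (cnj G\<^sub>1 G\<^sub>2)\<close>, and the commutator of the two components of the
  magnetic gradient yields \<open>2 \<integral> Im (cnj G\<^sub>1 G\<^sub>2) = B \<integral> |\<psi>|\<^sup>2\<close>. Together this is the Loss-Thaller
  inequality \<open>\<integral> |G|\<^sup>2 \<ge> c B \<integral> |\<psi>|\<^sup>2 + (1 - c\<^sup>2) \<integral> |\<nabla>|\<psi>||\<^sup>2\<close>. Applying the interpolation inequality
  that defines \<open>C\<^sub>p\<close>, rescaled, to \<open>|\<psi>|\<close> gives the lower bound for every \<open>c \<in> (0, 1)\<close>,
  in particular for \<open>c\<^sub>*\<close>.

  Weak derivatives are handled by difference quotients: \<open>\<psi> (x + v) - \<psi> x\<close> is almost everywhere the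
  mean of the weak directional derivative over the segment, so difference quotients converge in
  \<open>L\<^sup>2\<close> by continuity of translations, and no mollification is needed.
\<close>

section \<open>Smooth functions and cutoffs\<close>

text \<open>The number \<open>c_star\<close> is the critical point of the concave function \<open>c
  * B + C * \<beta> powr (p / 2) * (1 - c\<^sup>2) powr (1 - p / 2)\<close> of \<open>c\<close>: its
  defining equation says that the derivative vanishes, so it is the best choice of \<open>c\<close>.
  The rescaling parameter is \<open>\<beta> / (1 - c\<^sup>2)\<close>, which makes the coefficient
  of the \<open>L^p\<close> term exactly \<open>\<beta>\<close>. The obstacle is that the potential
  grows at infinity. The plain weak derivatives of \<psi> are only known to be locally integrable,
  while integration by parts through difference quotients wants them square integrable. Hence the
  commutator identity and the gradient of the modulus are established for truncations, in a form
  whose limit contains only \<psi> and \<open>G\<close>. The constants also need care: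
  \<open>C_opt\<close> is an extended-real infimum read as a real number, and \<open>nu_mag\<close>
  is a \<open>GREATEST\<close>. That the former is positive rests on averaging over unit squares;
  that the latter is an actual maximum means that the set of admissible values is bounded above and
  contains its supremum.\<close>

lemma partial_eqI: "(f has_derivative D) (at x) \<Longrightarrow> partial j f x = D (axis j 1)"
  unfolding partial_def using frechet_derivative_at by metis

lemma has_derivative_partial:
  assumes "f differentiable_on UNIV"
  shows "(f has_derivative (\<lambda>v. \<Sum>j\<in>UNIV. v $ j * partial j f x)) (at x)"
proof -
  have d: "(f has_derivative frechet_derivative f (at x)) (at x)"
    using assms by (simp add: differentiable_on_def frechet_derivative_works)
  then interpret bounded_linear "frechet_derivative f (at x)"
    by (rule has_derivative_bounded_linear)
  have "frechet_derivative f (at x) v = (\<Sum>j\<in>UNIV. v $ j * partial j f x)" for v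
  proof -
    have "v = (\<Sum>j\<in>UNIV. v $ j *\<^sub>R axis j 1)"
      using basis_expansion[of v] by (simp add: scalar_mult_eq_scaleR)
    then have "frechet_derivative f (at x) v = frechet_derivative f (at x) (\<Sum>j\<in>UNIV. v $ j *\<^sub>R axis j 1)"
      by simp
    also have "\<dots> = (\<Sum>j\<in>UNIV. v $ j * partial j f x)"
      by (simp only: sum scaleR partial_def real_scaleR_def)
    finally show ?thesis .
  qed
  then have "frechet_derivative f (at x) = (\<lambda>v. \<Sum>j\<in>UNIV. v $ j * partial j f x)" by auto
  with d show ?thesis by simp
qed

lemma C_k_SucD: "C_k (Suc k) f \<Longrightarrow> C_k k f"
proof (induction k arbitrary: f)
  case 0
  then show ?case by (auto intro: differentiable_imp_continuous_on)
next
  case (Suc k)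
  from Suc.prems have "f differentiable_on UNIV" "\<forall>j. C_k (Suc k) (partial j f)" by auto
  with Suc.IH show ?case by auto
qed

lemma C_k_add: "C_k k f \<Longrightarrow> C_k k g \<Longrightarrow> C_k k (\<lambda>x. f x + g x)"
proof (induction k arbitrary: f g)
  case 0
  then show ?case by (auto intro: continuous_intros)
next
  case (Suc k)
  then have d: "f differentiable_on UNIV" "g differentiable_on UNIV" by auto
  have "partial j (\<lambda>x. f x + g x) = (\<lambda>x. partial j f x + partial j g x)" for j
  proof
    show "partial j (\<lambda>x. f x + g x) x = partial j f x + partial j g x" for x
      using partial_eqI[OF has_derivative_add[OF has_derivative_partial[OF d(1), of x] has_derivative_partial[OF d(2), of x]], of j]
        partial_eqI[OF has_derivative_partial[OF d(1), of x], of j] partial_eqI[OF has_derivative_partial[OF d(2), of x], of j]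
      by simp
  qed
  with Suc d show ?case by (auto intro: differentiable_on_add)
qed

lemma partial_mult:
  assumes d: "f differentiable_on UNIV" "g differentiable_on UNIV"
  shows "partial j (\<lambda>x. f x * g x) = (\<lambda>x. partial j f x * g x + f x * partial j g x)"
proof
  show "partial j (\<lambda>x. f x * g x) x = partial j f x * g x + f x * partial j g x" for x
    using partial_eqI[OF has_derivative_mult[OF has_derivative_partial[OF d(1), of x] has_derivative_partial[OF d(2), of x]], of j]
      partial_eqI[OF has_derivative_partial[OF d(1), of x], of j] partial_eqI[OF has_derivative_partial[OF d(2), of x], of j]
    by simp
qed

lemma C_k_mult: "C_k k f \<Longrightarrow> C_k k g \<Longrightarrow> C_k k (\<lambda>x. f x * g x)"
proof (induction k arbitrary: f g)
  case 0
  then show ?case by (auto intro: continuous_intros)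
next
  case (Suc k)
  then have d: "f differentiable_on UNIV" "g differentiable_on UNIV" by auto
  \<comment> \<open>The product rule leaves one factor undifferentiated in each term, so
    \<open>f\<close> and \<open>g\<close> are needed one level lower as well.\<close>
  have "C_k k f" "C_k k g" using Suc.prems C_k_SucD by blast+
  with Suc d show ?case by (auto simp: partial_mult intro: differentiable_on_mult C_k_add)
qed

lemma partial_const: "partial j (\<lambda>x. c) = (\<lambda>x. 0)"
  by (rule ext, rule partial_eqI[where D="\<lambda>x. 0", simplified]) auto

lemma C_k_const: "C_k k (\<lambda>x. c)"
  by (induction k arbitrary: c) (auto simp: partial_const)

lemma partial_nth: "partial j (\<lambda>x. x $ i) = (\<lambda>x. if i = j then 1 else 0)"
proof
  show "partial j (\<lambda>x. x $ i) x = (if i = j then 1 else 0)" for x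
    by (rule partial_eqI[where D="\<lambda>x. x $ i", THEN trans])
      (auto simp: axis_def intro: bounded_linear_imp_has_derivative bounded_linear_vec_nth)
qed

lemma differentiable_on_nth: "(\<lambda>x::real^2. x $ i) differentiable_on S"
  by (auto intro!: linear_imp_differentiable_on bounded_linear.linear bounded_linear_vec_nth)

lemma C_k_nth: "C_k k (\<lambda>x. x $ i)"
  by (cases k) (auto simp: partial_nth C_k_const differentiable_on_nth intro!: continuous_intros)

lemma partial_affine:
  assumes d: "f differentiable_on UNIV"
  shows "partial j (\<lambda>x. f (a + c *\<^sub>R x)) = (\<lambda>x. c * partial j f (a + c *\<^sub>R x))"
    and "(\<lambda>x. f (a + c *\<^sub>R x)) differentiable_on UNIV"
proof -
  have h: "((\<lambda>x. f (a + c *\<^sub>R x)) has_derivative (\<lambda>v. \<Sum>j\<in>UNIV. (c *\<^sub>R v) $ j * partial j f (a + c *\<^sub>R x))) (at x)" for x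
    by (rule has_derivative_compose[where f="\<lambda>x. a + c *\<^sub>R x", OF _ has_derivative_partial[OF d]])
      (auto intro!: derivative_eq_intros)
  show "(\<lambda>x. f (a + c *\<^sub>R x)) differentiable_on UNIV"
    using h by (auto simp: differentiable_on_def differentiable_def)
  have "(\<Sum>i\<in>UNIV. (c *\<^sub>R axis j 1) $ i * partial i f y) = c * partial j f y" for y
    by (simp add: axis_def if_distrib[of "\<lambda>x. c * x"] if_distrib[of "\<lambda>x. x * z" for z] cong: if_cong)
  then show "partial j (\<lambda>x. f (a + c *\<^sub>R x)) = (\<lambda>x. c * partial j f (a + c *\<^sub>R x))"
    using partial_eqI[OF h] by auto
qed

lemma C_k_affine: "C_k k f \<Longrightarrow> C_k k (\<lambda>x. f (a + c *\<^sub>R x))"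
proof (induction k arbitrary: f)
  case 0
  then show ?case
    by (auto intro!: continuous_on_compose2[of UNIV f] continuous_intros)
next
  case (Suc k)
  then have d: "f differentiable_on UNIV" by auto
  with Suc show ?case by (auto simp: partial_affine intro: C_k_mult C_k_const)
qed

text \<open>Separated from compact support because coordinates and components of the potential enter
  as factors: a smooth function times a test function is again a test function.\<close>

definition smooth :: "(real^2 \<Rightarrow> real) \<Rightarrow> bool" where
  "smooth f \<longleftrightarrow> (\<forall>k. C_k k f)"

lemma smooth_differentiable: "smooth f \<Longrightarrow> f differentiable_on UNIV"
  unfolding smooth_def by (metis C_k.simps(2))

lemma smooth_partial: "smooth f \<Longrightarrow> smooth (partial j f)"
  unfolding smooth_def by (metis C_k.simps(2))

lemma smooth_continuous: "smooth f \<Longrightarrow> continuous_on S f"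
  unfolding smooth_def by (metis C_k.simps(1) continuous_on_subset top_greatest)

lemma smooth_mult: "smooth f \<Longrightarrow> smooth g \<Longrightarrow> smooth (\<lambda>x. f x * g x)"
  and smooth_add: "smooth f \<Longrightarrow> smooth g \<Longrightarrow> smooth (\<lambda>x. f x + g x)"
  and smooth_const: "smooth (\<lambda>x. c)"
  and smooth_nth: "smooth (\<lambda>x. x $ i)"
  and smooth_affine: "smooth f \<Longrightarrow> smooth (\<lambda>x. f (a + c *\<^sub>R x))"
  by (auto simp: smooth_def C_k_mult C_k_add C_k_const C_k_nth C_k_affine)

lemma smooth_measurable[measurable_dest]: "smooth f \<Longrightarrow> f \<in> borel_measurable borel"
  by (intro borel_measurable_continuous_onI smooth_continuous)

text \<open>In the plane the closure of a set is compact exactly when the set is bounded. A radius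
  is easier to carry through products, translations and dilations than a closure.\<close>

lemma test_function_iff: "test_function \<phi> \<longleftrightarrow> smooth \<phi> \<and> (\<exists>R. \<forall>x. R < norm x \<longrightarrow> \<phi> x = 0)"
proof -
  have "compact (closure {x. \<phi> x \<noteq> 0}) \<longleftrightarrow> (\<exists>R. \<forall>x. R < norm x \<longrightarrow> \<phi> x = 0)"
    by (auto simp: bounded_iff) (metis linorder_not_less)+
  then show ?thesis by (simp add: test_function_def smooth_def)
qed

lemma partial_eq_0_outside:
  assumes "\<forall>x. R < norm x \<longrightarrow> \<phi> x = 0" "R < norm x"
  shows "partial j \<phi> x = 0"
proof -
  have "((\<lambda>x. 0) has_derivative (\<lambda>x. 0::real)) (at x)" by simp
  then have "(\<phi> has_derivative (\<lambda>x. 0)) (at x)"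
  proof (rule has_derivative_transform_within_open)
    show "open {x::real^2. R < norm x}" by (intro open_Collect_less continuous_intros)
  qed (use assms in auto)
  then show ?thesis using partial_eqI by force
qed

lemma test_function_partial: "test_function \<phi> \<Longrightarrow> test_function (partial j \<phi>)"
  unfolding test_function_iff using partial_eq_0_outside smooth_partial by blast

lemma test_function_mult: "smooth a \<Longrightarrow> test_function \<phi> \<Longrightarrow> test_function (\<lambda>x. a x * \<phi> x)"
  unfolding test_function_iff by (auto intro: smooth_mult)

lemma test_function_affine:
  assumes "test_function \<phi>" "c \<noteq> 0"
  shows "test_function (\<lambda>x. \<phi> (a + c *\<^sub>R x))"
proof -
  obtain R where R: "\<forall>x. R < norm x \<longrightarrow> \<phi> x = 0" using assms by (auto simp: test_function_iff)
  have "R < norm (a + c *\<^sub>R x)" if "(R + norm a) / \<bar>c\<bar> < norm x" for x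
    using that assms(2) norm_triangle_ineq4[of "a + c *\<^sub>R x" a] by (simp add: field_simps)
  with R assms show ?thesis unfolding test_function_iff by (blast intro: smooth_affine)
qed

lemma test_function_bounded:
  assumes "test_function \<phi>"
  obtains M R where "0 < M" "0 < R" "\<And>x. \<bar>\<phi> x\<bar> \<le> M * indicator (cball 0 R) x"
proof -
  obtain R where R: "\<forall>x. R < norm x \<longrightarrow> \<phi> x = 0" using assms by (auto simp: test_function_iff)
  have "compact (\<phi> ` cball 0 (max R 1))"
    using assms by (intro compact_continuous_image) (auto simp: test_function_iff smooth_continuous)
  then obtain M where M: "\<And>y. y \<in> \<phi> ` cball 0 (max R 1) \<Longrightarrow> \<bar>y\<bar> \<le> M"
    using compact_imp_bounded bounded_iff by (metis real_norm_def)
  have "\<bar>\<phi> x\<bar> \<le> max M 1 * indicator (cball 0 (max R 1)) x" for x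
    using M[of "\<phi> x"] R by (auto simp: indicator_def)
  then show ?thesis by (rule that[of "max M 1" "max R 1", rotated 2]) auto
qed

section \<open>Bump functions built from exp(-1/x)\<close>

definition exp_bump :: "real poly \<Rightarrow> real \<Rightarrow> real" where
  "exp_bump P x = (if 0 < x then poly P (inverse x) * exp (- inverse x) else 0)"

lemma poly_times_exp_tendsto_0: "((\<lambda>y. poly P y * exp (- y)) \<longlongrightarrow> (0::real)) at_top"
proof -
  have "((\<lambda>y. \<Sum>i\<le>degree P. coeff P i * (y ^ i / exp y)) \<longlongrightarrow> (\<Sum>i\<le>degree P. coeff P i * 0)) at_top"
    by (intro tendsto_sum tendsto_mult tendsto_const tendsto_power_div_exp_0)
  then show ?thesis
    by (simp add: poly_altdef exp_minus sum_distrib_right divide_inverse mult.assoc)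
qed

text \<open>Differentiating \<open>P(1/x) * exp(-1/x)\<close> gives
  \<open>(P - P')(1/x) * exp(-1/x) / x^2\<close>, the same form with the polynomial
  \<open>X^2 * (P - P')\<close>. The family is closed under differentiation, so all its members are
  smooth by one induction; this is why the definition carries a polynomial.\<close>

lemma exp_bump_DERIV:
  "(exp_bump P has_real_derivative exp_bump (monom 1 2 * (P - pderiv P)) x) (at x)"
proof -
  consider "x > 0" | "x < 0" | "x = 0" by linarith
  then show ?thesis
  proof cases
    case 1
    have "((\<lambda>x. poly P (inverse x) * exp (- inverse x)) has_real_derivative
        exp_bump (monom 1 2 * (P - pderiv P)) x) (at x)"
      using 1 by (auto intro!: derivative_eq_intros DERIV_chain2[OF poly_DERIV]
          simp: exp_bump_def poly_monom algebra_simps power2_eq_square)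
    then show ?thesis
      by (rule DERIV_cong_ev[THEN iffD1, rotated 3])
        (use 1 in \<open>auto simp: exp_bump_def intro!: eventually_mono[OF eventually_nhds_in_open[of "{0<..}"]]\<close>)
  next
    case 2
    have "((\<lambda>x. 0) has_real_derivative exp_bump (monom 1 2 * (P - pderiv P)) x) (at x)"
      using 2 by (simp add: exp_bump_def)
    then show ?thesis
      by (rule DERIV_cong_ev[THEN iffD1, rotated 3])
        (use 2 in \<open>auto simp: exp_bump_def intro!: eventually_mono[OF eventually_nhds_in_open[of "{..<0}"]]\<close>)
  next
    case 3
    have "((\<lambda>x. exp_bump P x / x) \<longlongrightarrow> 0) (at 0)"
    proof (rule filterlim_split_at)
      show "((\<lambda>x. exp_bump P x / x) \<longlongrightarrow> 0) (at_left 0)"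
        by (rule tendsto_eventually) (auto simp: exp_bump_def eventually_at_filter)
      \<comment> \<open>The difference quotient at 0 stays in the family: dividing by
        \<open>x\<close> multiplies \<open>P\<close> by its variable.\<close>
      have "((\<lambda>x. poly (pCons 0 P) (inverse x) * exp (- inverse x)) \<longlongrightarrow> 0) (at_right 0)"
        by (rule filterlim_compose[OF poly_times_exp_tendsto_0 filterlim_inverse_at_top_right])
      then show "((\<lambda>x. exp_bump P x / x) \<longlongrightarrow> 0) (at_right 0)"
        by (rule Lim_transform_eventually)
          (auto simp: exp_bump_def eventually_at_filter divide_inverse)
    qed
    then show ?thesis using 3 by (simp add: has_field_derivative_iff exp_bump_def)
  qed
qed

lemma partial_exp_bump:
  fixes i :: 2 and P :: "real poly"
  defines "Q \<equiv> monom 1 2 * (P - pderiv P)"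
  shows "partial j (\<lambda>x. exp_bump P (a + b * x $ i)) = (\<lambda>x. b * axis j 1 $ i * exp_bump Q (a + b * x $ i))"
    and "(\<lambda>x. exp_bump P (a + b * x $ i)) differentiable_on (UNIV :: (real^2) set)"
proof -
  have h: "((\<lambda>x. exp_bump P (a + b * x $ i)) has_derivative (\<lambda>v. b * v $ i * exp_bump Q (a + b * x $ i))) (at x)"
    for x :: "real^2"
    unfolding Q_def
    by (rule has_derivative_compose[where f="\<lambda>x. a + b * x $ i",
          OF _ exp_bump_DERIV[of P, unfolded has_field_derivative_def], THEN has_derivative_eq_rhs])
      (auto intro!: derivative_eq_intros bounded_linear_imp_has_derivative bounded_linear_vec_nth simp: mult_ac)
  then show "partial j (\<lambda>x. exp_bump P (a + b * x $ i)) = (\<lambda>x. b * axis j 1 $ i * exp_bump Q (a + b * x $ i))"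
    using partial_eqI[OF h] by auto
  show "(\<lambda>x. exp_bump P (a + b * x $ i)) differentiable_on (UNIV :: (real^2) set)"
    using h by (auto simp: differentiable_on_def differentiable_def)
qed

lemma C_k_exp_bump: "C_k k (\<lambda>x. exp_bump P (a + b * x $ i))"
proof (induction k arbitrary: P)
  case 0
  then show ?case
    by (auto intro: differentiable_imp_continuous_on partial_exp_bump)
next
  case (Suc k)
  then show ?case by (auto simp: partial_exp_bump intro!: C_k_mult C_k_const)
qed

lemma smooth_exp_bump: "smooth (\<lambda>x. exp_bump P (a + b * x $ i))"
  by (simp add: smooth_def C_k_exp_bump)

lemma exp_bump_1_range: "0 \<le> exp_bump 1 x" "exp_bump 1 x \<le> 1"
  by (auto simp: exp_bump_def)

lemma exp_bump_1_pos_iff: "0 < exp_bump 1 x \<longleftrightarrow> 0 < x" "exp_bump 1 x = 0 \<longleftrightarrow> x \<le> 0"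
  by (auto simp: exp_bump_def)

lemma exp_bump_1_tendsto: "filterlim f at_top F \<Longrightarrow> ((\<lambda>n. exp_bump 1 (f n)) \<longlongrightarrow> 1) F"
proof -
  assume f: "filterlim f at_top F"
  have "((\<lambda>y. exp (- inverse y)) \<longlongrightarrow> exp (- 0 :: real)) at_top"
    by (intro tendsto_intros tendsto_inverse_0_at_top filterlim_ident)
  then have "((\<lambda>y. exp_bump 1 y) \<longlongrightarrow> exp (- 0)) at_top"
    by (rule Lim_transform_eventually)
      (auto simp: exp_bump_def eventually_at_top_dense intro!: exI[of _ 0])
  then have "((\<lambda>y. exp_bump 1 y) \<longlongrightarrow> 1) at_top" by simp
  then show ?thesis using f by (rule filterlim_compose)
qed

text \<open>Each factor is positive on one side of one edge of the box, so the product is positive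
  exactly on the open box when \<open>s > 0\<close>. As \<open>s\<close> tends to infinity every
  factor tends to 1 there, which exhibits indicators of boxes as limits of test functions. The
  arguments have the form \<open>a + b * x $ i\<close> to fit
  \<open>smooth_exp_bump\<close>.\<close>

definition box_bump :: "real \<Rightarrow> real^2 \<Rightarrow> real^2 \<Rightarrow> real^2 \<Rightarrow> real" where
  "box_bump s a b x = (exp_bump 1 (- (s * a$1) + s * x$1) * exp_bump 1 (s * b$1 + (- s) * x$1)) *
     (exp_bump 1 (- (s * a$2) + s * x$2) * exp_bump 1 (s * b$2 + (- s) * x$2))"

lemma box_bump_range: "0 \<le> box_bump s a b x" "box_bump s a b x \<le> 1"
  by (auto simp: box_bump_def exp_bump_1_range intro!: mult_nonneg_nonneg mult_le_one)

lemma mem_box_vec2: "(x::real^2) \<in> box a b \<longleftrightarrow> a$1 < x$1 \<and> x$1 < b$1 \<and> a$2 < x$2 \<and> x$2 < b$2"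
  by (auto simp: mem_box_cart forall_2)

lemma box_bump_pos_iff:
  assumes "0 < s" shows "0 < box_bump s a b x \<longleftrightarrow> x \<in> box a b"
    "box_bump s a b x = 0 \<longleftrightarrow> x \<notin> box a b"
proof -
  have p: "x > 0 \<longleftrightarrow> x \<noteq> 0" if "x \<ge> 0" for x :: real using that by auto
  show *: "box_bump s a b x = 0 \<longleftrightarrow> x \<notin> box a b"
    using assms by (auto simp: box_bump_def exp_bump_1_pos_iff mem_box_vec2)
  show "0 < box_bump s a b x \<longleftrightarrow> x \<in> box a b"
    using * p box_bump_range by metis
qed

lemma smooth_box_bump: "smooth (box_bump s a b)"
  unfolding box_bump_def by (intro smooth_mult smooth_exp_bump)

lemma test_function_box_bump: "0 < s \<Longrightarrow> test_function (box_bump s a b)"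
proof -
  assume s: "0 < s"
  obtain R where "\<And>x. x \<in> box a b \<Longrightarrow> norm x \<le> R"
    using bounded_box[of a b] unfolding bounded_iff by auto
  then have "\<forall>x. R < norm x \<longrightarrow> box_bump s a b x = 0"
    using box_bump_pos_iff(2)[OF s] by (meson not_le)
  then show ?thesis using smooth_box_bump by (auto simp: test_function_iff)
qed

lemma box_bump_tendsto: "(\<lambda>n. box_bump (real n) a b x) \<longlonglongrightarrow> indicator (box a b) x"
proof (cases "x \<in> box a b")
  case True
  have lim: "filterlim (\<lambda>n. real n * d) at_top sequentially" if "0 < d" for d :: real
    using filterlim_tendsto_pos_mult_at_top[OF tendsto_const that filterlim_real_sequentially]
    by (simp add: mult.commute)
  have "(\<lambda>n. (exp_bump 1 (real n * (x$1 - a$1)) * exp_bump 1 (real n * (b$1 - x$1))) *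
     (exp_bump 1 (real n * (x$2 - a$2)) * exp_bump 1 (real n * (b$2 - x$2)))) \<longlonglongrightarrow> (1 * 1) * (1 * 1)"
    using True by (intro tendsto_mult exp_bump_1_tendsto lim) (auto simp: mem_box_vec2)
  then show ?thesis using True by (simp add: box_bump_def algebra_simps)
next
  case False
  have "box_bump (real n) a b x = 0" for n
    using False box_bump_pos_iff(2)[of "real n" a b x]
    by (cases "n = 0") (auto simp: box_bump_def exp_bump_1_pos_iff)
  then show ?thesis using False by simp
qed

definition unit_bump :: "real^2 \<Rightarrow> real" where
  "unit_bump = box_bump 1 (\<chi> i. - 1) (\<chi> i. 1)"

lemma test_function_unit_bump: "test_function unit_bump"
  by (simp add: unit_bump_def test_function_box_bump)

lemma unit_bump_0: "0 < unit_bump 0"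
  by (simp add: unit_bump_def box_bump_pos_iff mem_box_vec2)

text \<open>Because \<open>1 / (1 + t) + 1 / (1 - t) \<ge> 2\<close> for \<open>|t| < 1\<close>.\<close>
lemma unit_bump_le: "unit_bump x \<le> unit_bump 0"
proof -
  have e: "exp_bump 1 (1 + t) * exp_bump 1 (1 - t) \<le> exp_bump 1 1 * exp_bump 1 1" for t
  proof (cases "\<bar>t\<bar> < 1")
    case True
    then have t: "0 < 1 + t" "0 < 1 - t" by auto
    then have "0 < (1 + t) * (1 - t)" by simp
    moreover have "(1 + t) * (1 - t) \<le> 1" by (simp add: algebra_simps)
    ultimately have "2 \<le> 2 / ((1 + t) * (1 - t))" by (simp add: field_simps)
    also have "\<dots> = inverse (1 + t) + inverse (1 - t)"
      using t by (simp add: field_simps)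
    finally show ?thesis using t by (simp add: exp_bump_def flip: exp_add)
  qed (auto simp: exp_bump_def)
  show ?thesis
    unfolding unit_bump_def box_bump_def
    using mult_mono[OF e[of "x$1"] e[of "x$2"]] by (simp add: exp_bump_1_range)
qed

text \<open>Dilations of a single bump, divided by its maximum, which is attained at the origin.
  They lie between 0 and 1 and tend to 1 everywhere, and the chain rule brings out the factor
  \<open>1 / (n + 1)\<close> that makes their gradients tend to 0.\<close>

definition cutoff :: "nat \<Rightarrow> real^2 \<Rightarrow> real" where
  "cutoff n x = unit_bump (inverse (real (Suc n)) *\<^sub>R x) * inverse (unit_bump 0)"

lemma cutoff_range: "0 \<le> cutoff n x" "cutoff n x \<le> 1"
  using unit_bump_0 unit_bump_le box_bump_range
  by (auto simp: cutoff_def unit_bump_def field_simps)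

lemma test_function_cutoff: "test_function (cutoff n)"
  using test_function_mult[OF smooth_const test_function_affine[OF test_function_unit_bump], of "inverse (real (Suc n))" "inverse (unit_bump 0)" 0]
  by (simp add: cutoff_def[abs_def] mult.commute)

lemma smooth_cutoff: "smooth (cutoff n)"
  using test_function_cutoff by (simp add: test_function_iff)

lemma cutoff_tendsto: "(\<lambda>n. cutoff n x) \<longlonglongrightarrow> 1"
proof -
  have "isCont unit_bump 0"
    using smooth_continuous[of unit_bump UNIV] test_function_unit_bump
    by (simp add: test_function_iff continuous_on_eq_continuous_at)
  moreover have "(\<lambda>n. inverse (real (Suc n)) *\<^sub>R x) \<longlonglongrightarrow> 0"
    using tendsto_scaleR[OF LIMSEQ_inverse_real_of_nat tendsto_const[of x]] by simp
  ultimately have "(\<lambda>n. unit_bump (inverse (real (Suc n)) *\<^sub>R x)) \<longlonglongrightarrow> unit_bump 0"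
    by (rule isCont_tendsto_compose)
  from tendsto_mult[OF this tendsto_const[of "inverse (unit_bump 0)"]] show ?thesis
    using unit_bump_0 by (simp add: cutoff_def)
qed

lemma partial_cutoff_limits:
  "(\<lambda>n. partial j (cutoff n) x) \<longlonglongrightarrow> 0" "\<exists>M. \<forall>n x. \<bar>partial j (cutoff n) x\<bar> \<le> M"
proof -
  have d: "unit_bump differentiable_on UNIV"
    using test_function_unit_bump by (simp add: test_function_iff smooth_differentiable)
  obtain M R where M: "0 < M" "\<And>x. \<bar>partial j unit_bump x\<bar> \<le> M * indicator (cball 0 R) x"
    using test_function_bounded[OF test_function_partial[OF test_function_unit_bump]] by metis
  define K where "K = M * inverse (unit_bump 0)"
  have b: "\<bar>partial j (cutoff n) x\<bar> \<le> inverse (real (Suc n)) * K" for n x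
  proof -
    let ?c = "inverse (real (Suc n))"
    have "partial j (cutoff n) x = ?c * (partial j unit_bump (?c *\<^sub>R x) * inverse (unit_bump 0))"
      using partial_mult[OF partial_affine(2)[OF d] differentiable_on_const, of j 0 ?c "inverse (unit_bump 0)"]
        partial_affine(1)[OF d, of j 0 ?c]
      by (simp add: cutoff_def[abs_def] partial_const)
    moreover have "\<bar>partial j unit_bump (?c *\<^sub>R x)\<bar> \<le> M"
      using M(1) M(2)[of "?c *\<^sub>R x"] by (cases "?c *\<^sub>R x \<in> cball 0 R") (simp_all only: indicator_simps, auto)
    ultimately show ?thesis
      using unit_bump_0 by (simp only: K_def abs_mult) (auto intro!: mult_left_mono mult_right_mono)
  qed
  have "(\<lambda>n. inverse (real (Suc n)) * K) \<longlonglongrightarrow> 0"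
    by (rule tendsto_mult_left_zero[OF LIMSEQ_inverse_real_of_nat])
  then show "(\<lambda>n. partial j (cutoff n) x) \<longlonglongrightarrow> 0"
    by (rule Lim_null_comparison[rotated]) (use b in auto)
  have "inverse (real (Suc n)) * K \<le> K" for n
    using M(1) unit_bump_0 by (intro mult_left_le_one_le) (auto simp: K_def inverse_le_1_iff)
  then show "\<exists>M. \<forall>n x. \<bar>partial j (cutoff n) x\<bar> \<le> M"
    using b order_trans by blast
qed

section \<open>Locally integrable functions on the plane\<close>

lemma lborel_eq_distr_translate: "lborel = distr lborel borel (\<lambda>x::real^2. x + v)"
proof -
  have "(+) v = (\<lambda>x. x + v)" by (auto simp: add.commute)
  then show ?thesis using lborel_distr_plus[of v] by simp
qed

lemma nn_integral_translate:
  "f \<in> borel_measurable borel \<Longrightarrow> (\<integral>\<^sup>+x. f (x + v) \<partial>lborel) = (\<integral>\<^sup>+x. f (x::real^2) \<partial>lborel)"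
  by (subst (2) lborel_eq_distr_translate[of v]) (simp add: nn_integral_distr)

lemma integrable_translate_iff:
  fixes f :: "real^2 \<Rightarrow> 'a::{banach, second_countable_topology}"
  assumes "f \<in> borel_measurable borel"
  shows "integrable lborel (\<lambda>x. f (x + v)) \<longleftrightarrow> integrable lborel f"
  by (subst (2) lborel_eq_distr_translate[of v]) (use assms in \<open>simp add: integrable_distr_eq\<close>)

lemma integral_translate:
  fixes f :: "real^2 \<Rightarrow> 'a::{banach, second_countable_topology}"
  assumes "f \<in> borel_measurable borel"
  shows "(LINT x|lborel. f (x + v)) = (LINT x|lborel. f x)"
  by (subst (2) lborel_eq_distr_translate[of v]) (use assms in \<open>simp add: integral_distr\<close>)

lemma lborel_eq_scale: "c \<noteq> 0 \<Longrightarrow> lborel = density (distr lborel borel (\<lambda>x::real^2. c *\<^sub>R x)) (\<lambda>_. ennreal (c\<^sup>2))"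
  using lborel_affine[of c "0::real^2"] by simp

lemma integrable_scale_iff:
  fixes f :: "real^2 \<Rightarrow> 'a::{banach, second_countable_topology}"
  assumes "c \<noteq> 0" "f \<in> borel_measurable borel"
  shows "integrable lborel (\<lambda>x. f (c *\<^sub>R x)) \<longleftrightarrow> integrable lborel f"
proof -
  have "integrable lborel f \<longleftrightarrow> integrable lborel (\<lambda>x. c\<^sup>2 *\<^sub>R f (c *\<^sub>R x))"
    by (subst lborel_eq_scale[OF assms(1)])
      (use assms in \<open>simp add: integrable_density integrable_distr_eq\<close>)
  also have "\<dots> \<longleftrightarrow> integrable lborel (\<lambda>x. f (c *\<^sub>R x))"
    using assms(1) integrable_scaleR_right[of "inverse (c\<^sup>2)" lborel "\<lambda>x. c\<^sup>2 *\<^sub>R f (c *\<^sub>R x)"]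
    by auto
  finally show ?thesis by simp
qed

lemma integral_scale:
  fixes f :: "real^2 \<Rightarrow> 'a::{banach, second_countable_topology}"
  assumes "c \<noteq> 0" "f \<in> borel_measurable borel"
  shows "(LINT x|lborel. f x) = c\<^sup>2 *\<^sub>R (LINT x|lborel. f (c *\<^sub>R x))"
  by (subst lborel_eq_scale[OF assms(1)])
    (use assms in \<open>simp add: integral_density integral_distr\<close>)

lemma cball_in_borel[measurable]: "cball x R \<in> sets borel"
  by simp

text \<open>The Borel counterpart of \<open>locally_integrable\<close>. Borel functions stay
  measurable under composition with maps such as \<open>(x, t) \<mapsto> x + t v\<close> on a
  product space, which the Fubini arguments rely on.\<close>

definition loc_int :: "(real^2 \<Rightarrow> complex) \<Rightarrow> bool" where
  "loc_int f \<longleftrightarrow> f \<in> borel_measurable borel \<and> (\<forall>R. integrable lborel (\<lambda>x. indicator (cball 0 R) x *\<^sub>R f x))"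

lemma loc_int_measurable[measurable_dest]: "loc_int f \<Longrightarrow> f \<in> borel_measurable borel"
  by (simp add: loc_int_def)

lemma loc_int_add: "loc_int f \<Longrightarrow> loc_int g \<Longrightarrow> loc_int (\<lambda>x. f x + g x)"
  by (auto simp: loc_int_def scaleR_add_right)

lemma loc_int_diff: "loc_int f \<Longrightarrow> loc_int g \<Longrightarrow> loc_int (\<lambda>x. f x - g x)"
  by (auto simp: loc_int_def scaleR_diff_right)

lemma loc_int_cmult: "loc_int f \<Longrightarrow> loc_int (\<lambda>x. c * f x)"
  unfolding loc_int_def by (auto simp flip: mult_scaleR_right)

lemma integrable_loc_int_bounded:
  fixes a :: "real^2 \<Rightarrow> complex"
  assumes "loc_int f" and [measurable]: "a \<in> borel_measurable borel"
    and "\<And>x. norm (a x) \<le> M * indicator (cball 0 R) x"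
  shows "integrable lborel (\<lambda>x. f x * a x)"
proof (rule Bochner_Integration.integrable_bound)
  note [measurable] = loc_int_measurable[OF assms(1)]
  show "integrable lborel (\<lambda>x. M *\<^sub>R (indicator (cball 0 R) x *\<^sub>R f x))"
    using assms(1) unfolding loc_int_def by (intro integrable_scaleR_right) auto
  show "(\<lambda>x. f x * a x) \<in> borel_measurable lborel" by measurable
  have "norm (f x * a x) \<le> norm (M *\<^sub>R (indicator (cball 0 R) x *\<^sub>R f x))" for x
  proof -
    have "norm (f x) * norm (a x) \<le> norm (f x) * (M * indicator (cball 0 R) x)"
      by (intro mult_left_mono assms(3)) simp
    also have "\<dots> \<le> norm (M *\<^sub>R (indicator (cball 0 R) x *\<^sub>R f x))"
      using mult_right_mono[OF abs_ge_self[of M], of "norm (f x)"] by (auto simp: indicator_def mult.commute)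
    finally show ?thesis by (simp add: norm_mult)
  qed
  then show "AE x in lborel. norm (f x * a x) \<le> norm (M *\<^sub>R (indicator (cball 0 R) x *\<^sub>R f x))" by simp
qed

lemma test_function_measurable[measurable_dest]: "test_function \<phi> \<Longrightarrow> \<phi> \<in> borel_measurable borel"
  by (auto simp: test_function_iff smooth_measurable)

lemma integrable_loc_int_test:
  assumes "loc_int f" "test_function \<phi>" shows "integrable lborel (\<lambda>x. f x * of_real (\<phi> x))"
proof -
  obtain M R where "\<And>x. \<bar>\<phi> x\<bar> \<le> M * indicator (cball 0 R) x" using test_function_bounded[OF assms(2)] by blast
  moreover note [measurable] = test_function_measurable[OF assms(2)]
  ultimately show ?thesis by (intro integrable_loc_int_bounded[OF assms(1), of _ M R]) auto
qed

lemma loc_int_mult_continuous: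
  assumes f: "loc_int f" and a: "continuous_on UNIV a"
  shows "loc_int (\<lambda>x. f x * a x)"
  unfolding loc_int_def
proof safe
  note [measurable] = loc_int_measurable[OF f] borel_measurable_continuous_onI[OF a]
  show "(\<lambda>x. f x * a x) \<in> borel_measurable borel" by measurable
  fix R :: real
  have "bounded (a ` cball 0 R)"
    by (intro compact_imp_bounded compact_continuous_image continuous_on_subset[OF a]) auto
  then obtain M where "\<forall>x\<in>cball 0 R. norm (a x) \<le> M" by (auto simp: bounded_iff)
  then have "integrable lborel (\<lambda>x. f x * (indicator (cball 0 R) x *\<^sub>R a x))"
    by (intro integrable_loc_int_bounded[OF f, of _ M R]) (auto simp: indicator_def)
  then show "integrable lborel (\<lambda>x. indicator (cball 0 R) x *\<^sub>R (f x * a x))" by simp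
qed

lemma loc_int_bound:
  assumes "loc_int g" and [measurable]: "f \<in> borel_measurable borel" and "\<And>x. norm (f x) \<le> norm (g x)"
  shows "loc_int f"
  unfolding loc_int_def
proof safe
  show "f \<in> borel_measurable borel" by fact
  fix R
  show "integrable lborel (\<lambda>x. indicator (cball 0 R) x *\<^sub>R f x)"
  proof (rule Bochner_Integration.integrable_bound)
    show "integrable lborel (\<lambda>x. indicator (cball 0 R) x *\<^sub>R g x)"
      using assms(1) by (simp add: loc_int_def)
    show "(\<lambda>x. indicator (cball 0 R) x *\<^sub>R f x) \<in> borel_measurable lborel" by measurable
    show "AE x in lborel. norm (indicator (cball 0 R) x *\<^sub>R f x) \<le> norm (indicator (cball 0 R) x *\<^sub>R g x)"
      using assms(3) by (simp add: indicator_def)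
  qed
qed

lemma loc_int_translate:
  assumes "loc_int f" shows "loc_int (\<lambda>x. f (x + v))"
  unfolding loc_int_def
proof safe
  note [measurable] = loc_int_measurable[OF assms]
  show "(\<lambda>x. f (x + v)) \<in> borel_measurable borel" by measurable
  fix R
  have "integrable lborel (\<lambda>x. indicator (cball 0 (R + norm v)) x *\<^sub>R f x)"
    using assms by (simp add: loc_int_def)
  then have "integrable lborel (\<lambda>x. indicator (cball 0 (R + norm v)) (x + v) *\<^sub>R f (x + v))"
    by (subst integrable_translate_iff) auto
  then show "integrable lborel (\<lambda>x. indicator (cball 0 R) x *\<^sub>R f (x + v))"
  proof (rule Bochner_Integration.integrable_bound)
    have "norm (x + v) \<le> R + norm v" if "norm x \<le> R" for x using that norm_triangle_ineq[of x v] by linarith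
    then show "AE x in lborel. norm (indicator (cball 0 R) x *\<^sub>R f (x + v))
        \<le> norm (indicator (cball 0 (R + norm v)) (x + v) *\<^sub>R f (x + v))"
      by (auto simp: indicator_def)
  qed measurable
qed

text \<open>Dynkin's argument: boxes are closed under intersection and generate the Borel sets, and
  the sets over which \<open>h\<close> integrates to 0 are closed under complements and countable
  disjoint unions. The complement step uses that the integral over the whole plane vanishes.\<close>

lemma integral_over_sets_eq_0:
  fixes h :: "real^2 \<Rightarrow> real"
  assumes h: "integrable lborel h" and box: "\<And>a b. (LINT x:box a b|lborel. h x) = 0"
    and UNIV: "(LINT x|lborel. h x) = 0" and A: "A \<in> sets borel"
  shows "(LINT x:A|lborel. h x) = 0"
proof -
  let ?E = "range (\<lambda>(a, b). box a b :: (real^2) set)"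
  have "Int_stable ?E" by (auto simp: Int_stable_def box_Int_box)
  moreover have "?E \<subseteq> Pow UNIV" by simp
  moreover have "A \<in> sigma_sets UNIV ?E" using A by (simp add: borel_eq_box)
  ultimately show ?thesis
  proof (induct rule: sigma_sets_induct_disjoint)
    case (compl A)
    then have [measurable]: "A \<in> sets borel" by (simp add: borel_eq_box)
    have i: "integrable lborel (\<lambda>x. indicator A x *\<^sub>R h x)"
      using h by (intro integrable_mult_indicator) auto
    have e: "indicator (UNIV - A) x *\<^sub>R h x = h x - indicator A x *\<^sub>R h x" for x
      by (auto simp: indicator_def)
    have "(LINT x:UNIV - A|lborel. h x) = (LINT x|lborel. h x) - (LINT x:A|lborel. h x)"
      unfolding set_lebesgue_integral_def e using Bochner_Integration.integral_diff[OF h i] .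
    with compl UNIV show ?case by simp
  next
    case (union A)
    have A: "A i \<in> sets borel" for i using union by (auto simp: borel_eq_box)
    have U: "(\<Union>i. A i) \<in> sets borel" using A by blast
    then have "(LINT x:(\<Union>i. A i)|lborel. h x) = (\<Sum>i. (LINT x:A i|lborel. h x))"
      using union(1) A integrable_mult_indicator[of _ lborel h, OF _ h] U
      by (intro lebesgue_integral_countable_add) (auto simp: disjoint_family_on_def set_integrable_def)
    with union show ?case by simp
  qed (use box in \<open>auto simp: set_lebesgue_integral_def\<close>)
qed

text \<open>The fundamental lemma of the calculus of variations. Multiplication by a cutoff makes
  \<open>f\<close> integrable over the plane; the cutoff times a box bump is a test function, and
  letting the bumps tend to the indicator gives vanishing integrals over all boxes.\<close>

lemma fundamental_real:
  fixes f :: "real^2 \<Rightarrow> real"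
  assumes f: "\<And>\<phi>. test_function \<phi> \<Longrightarrow> integrable lborel (\<lambda>x. f x * \<phi> x)"
    and z: "\<And>\<phi>. test_function \<phi> \<Longrightarrow> (LINT x|lborel. f x * \<phi> x) = 0"
  shows "AE x in lborel. f x = 0"
proof -
  have "AE x in lborel. f x * cutoff n x = 0" for n
  proof -
    have i: "integrable lborel (\<lambda>x. f x * cutoff n x)" by (intro f test_function_cutoff)
    have "(LINT x:A|lborel. f x * cutoff n x) = 0" if "A \<in> sets borel" for A
    proof (rule integral_over_sets_eq_0[OF i _ _ that])
      fix a b :: "real^2"
      have "(\<lambda>m. LINT x|lborel. f x * cutoff n x * box_bump (real (Suc m)) a b x) \<longlonglongrightarrow> (LINT x:box a b|lborel. f x * cutoff n x)"
        unfolding set_lebesgue_integral_def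
      proof (rule integral_dominated_convergence[where w="\<lambda>x. norm (f x * cutoff n x)"])
        note [measurable] = borel_measurable_integrable[OF i]
        note [measurable] = smooth_measurable[OF smooth_box_bump]
        show "(\<lambda>x. indicator (box a b) x *\<^sub>R (f x * cutoff n x)) \<in> borel_measurable lborel"
          "(\<lambda>x. f x * cutoff n x * box_bump (real (Suc m)) a b x) \<in> borel_measurable lborel" for m
          by measurable
        have "(\<lambda>m. f x * cutoff n x * box_bump (real (Suc m)) a b x) \<longlonglongrightarrow> f x * cutoff n x * indicator (box a b) x" for x
          by (intro tendsto_intros LIMSEQ_Suc box_bump_tendsto)
        then show "AE x in lborel. (\<lambda>m. f x * cutoff n x * box_bump (real (Suc m)) a b x) \<longlonglongrightarrow> indicator (box a b) x *\<^sub>R (f x * cutoff n x)"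
          by (simp add: mult.commute)
        show "AE x in lborel. norm (f x * cutoff n x * box_bump (real (Suc m)) a b x) \<le> norm (f x * cutoff n x)" for m
          using box_bump_range by (auto simp: abs_mult intro!: mult_left_le)
      qed (use i in auto)
      moreover have "(LINT x|lborel. f x * cutoff n x * box_bump (real (Suc m)) a b x) = 0" for m
        using z[OF test_function_mult[OF smooth_cutoff test_function_box_bump]]
        by (simp add: mult.assoc)
      ultimately show "(LINT x:box a b|lborel. f x * cutoff n x) = 0"
        by (simp add: LIMSEQ_const_iff)
    qed (simp add: z test_function_cutoff)
    then show ?thesis
      using density_unique_real[OF i, of "\<lambda>x. 0"] by (simp add: set_lebesgue_integral_def)
  qed
  then have "AE x in lborel. \<forall>n. f x * cutoff n x = 0" by (simp only: AE_all_countable) blast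
  then show ?thesis
  proof eventually_elim
    case (elim x)
    \<comment> \<open>The cutoffs tend to 1, so at each point some cutoff is positive and can be
      divided out.\<close>
    obtain n where "cutoff n x > 0"
      using order_tendstoD(1)[OF cutoff_tendsto[of x], of 0] by (auto simp: eventually_sequentially)
    with elim show ?case by (metis less_irrefl mult_eq_0_iff)
  qed
qed

lemma fundamental:
  assumes f: "loc_int f" and z: "\<And>\<phi>. test_function \<phi> \<Longrightarrow> (LINT x|lborel. f x * of_real (\<phi> x)) = 0"
  shows "AE x in lborel. f x = 0"
proof -
  have "AE x in lborel. Re (f x) = 0"
  proof (rule fundamental_real)
    fix \<phi> assume "test_function \<phi>"
    note i = integrable_loc_int_test[OF f this] and z = z[OF this]
    show "integrable lborel (\<lambda>x. Re (f x) * \<phi> x)" using integrable_Re[OF i] by simp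
    show "(LINT x|lborel. Re (f x) * \<phi> x) = 0" using integral_Re[OF i] z by simp
  qed
  moreover have "AE x in lborel. Im (f x) = 0"
  proof (rule fundamental_real)
    fix \<phi> assume "test_function \<phi>"
    note i = integrable_loc_int_test[OF f this] and z = z[OF this]
    show "integrable lborel (\<lambda>x. Im (f x) * \<phi> x)" using integrable_Im[OF i] by simp
    show "(LINT x|lborel. Im (f x) * \<phi> x) = 0" using integral_Im[OF i] z by simp
  qed
  ultimately show ?thesis by eventually_elim (simp add: complex_eq_iff)
qed

section \<open>Continuity of translations in the square norm\<close>

definition sq_int :: "(real^2 \<Rightarrow> complex) \<Rightarrow> bool" where
  "sq_int f \<longleftrightarrow> f \<in> borel_measurable borel \<and> integrable lborel (\<lambda>x. (norm (f x))\<^sup>2)"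

definition sq_norm :: "(real^2 \<Rightarrow> complex) \<Rightarrow> real" where
  "sq_norm f = (LINT x|lborel. (norm (f x))\<^sup>2)"

lemma sq_int_measurable[measurable_dest]: "sq_int f \<Longrightarrow> f \<in> borel_measurable borel"
  by (simp add: sq_int_def)

lemma sq_norm_nonneg: "0 \<le> sq_norm f"
  by (simp add: sq_norm_def)

lemma sq_int_bound:
  assumes "sq_int g" "f \<in> borel_measurable borel" "\<And>x. norm (f x) \<le> C * norm (g x)"
  shows "sq_int f"
  unfolding sq_int_def
proof
  note [measurable] = assms(2)
  show "integrable lborel (\<lambda>x. (norm (f x))\<^sup>2)"
  proof (rule Bochner_Integration.integrable_bound)
    show "integrable lborel (\<lambda>x. C\<^sup>2 * (norm (g x))\<^sup>2)" using assms by (simp add: sq_int_def)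
    show "AE x in lborel. norm ((norm (f x))\<^sup>2) \<le> norm (C\<^sup>2 * (norm (g x))\<^sup>2)"
      using power_mono[OF assms(3) norm_ge_zero, of _ 2] by (simp add: power_mult_distrib)
  qed measurable
qed fact

lemma square_add_le: "(a + b)\<^sup>2 \<le> 2 * a\<^sup>2 + 2 * (b::real)\<^sup>2"
  using zero_le_power2[of "a - b"] by (simp add: power2_sum power2_diff)

lemma norm_add_square_le: "(norm (a + b))\<^sup>2 \<le> 2 * (norm a)\<^sup>2 + 2 * (norm b)\<^sup>2"
  for a b :: "'a::real_normed_vector"
  using power_mono[OF norm_triangle_ineq[of a b] norm_ge_zero, of 2] square_add_le[of "norm a" "norm b"]
  by linarith

lemma sq_int_add:
  assumes "sq_int f" "sq_int g" shows "sq_int (\<lambda>x. f x + g x)"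
  unfolding sq_int_def
proof
  note [measurable] = assms[THEN sq_int_measurable]
  show "(\<lambda>x. f x + g x) \<in> borel_measurable borel" by measurable
  show "integrable lborel (\<lambda>x. (norm (f x + g x))\<^sup>2)"
  proof (rule Bochner_Integration.integrable_bound)
    show "integrable lborel (\<lambda>x. 2 * (norm (f x))\<^sup>2 + 2 * (norm (g x))\<^sup>2)"
      using assms by (simp add: sq_int_def)
    show "AE x in lborel. norm ((norm (f x + g x))\<^sup>2) \<le> norm (2 * (norm (f x))\<^sup>2 + 2 * (norm (g x))\<^sup>2)"
      using norm_add_square_le by auto
  qed measurable
qed

lemma sq_int_cmult: "sq_int f \<Longrightarrow> sq_int (\<lambda>x. c * f x)"
  by (rule sq_int_bound[of f _ "norm c"]) (auto simp: norm_mult dest: sq_int_measurable)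

lemma cnj_measurable[measurable]: "cnj \<in> borel_measurable borel"
  by (intro borel_measurable_continuous_onI continuous_intros)

lemma sq_int_cnj: "sq_int f \<Longrightarrow> sq_int (\<lambda>x. cnj (f x))"
  by (rule sq_int_bound[of f _ 1]) (auto dest: sq_int_measurable)

lemma sq_int_diff: "sq_int f \<Longrightarrow> sq_int g \<Longrightarrow> sq_int (\<lambda>x. f x - g x)"
  using sq_int_add[of f "\<lambda>x. -1 * g x"] sq_int_cmult[of g "-1"] by simp

lemma sq_int_translate: "sq_int f \<Longrightarrow> sq_int (\<lambda>x. f (x + v))"
  unfolding sq_int_def by (auto simp: integrable_translate_iff[of "\<lambda>x. (norm (f x))\<^sup>2"])

lemma sq_norm_translate: "sq_int f \<Longrightarrow> sq_norm (\<lambda>x. f (x + v)) = sq_norm f"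
  unfolding sq_norm_def using integral_translate[of "\<lambda>x. (norm (f x))\<^sup>2" v] by (auto dest: sq_int_measurable)

lemma sq_norm_add_le:
  assumes "sq_int f" "sq_int g"
  shows "sq_norm (\<lambda>x. f x + g x) \<le> 2 * sq_norm f + 2 * sq_norm g"
proof -
  have i: "integrable lborel (\<lambda>x. (norm (f x))\<^sup>2)" "integrable lborel (\<lambda>x. (norm (g x))\<^sup>2)"
    using assms by (simp_all add: sq_int_def)
  have "sq_norm (\<lambda>x. f x + g x) \<le> (LINT x|lborel. 2 * (norm (f x))\<^sup>2 + 2 * (norm (g x))\<^sup>2)"
    unfolding sq_norm_def
    by (rule integral_mono[OF _ _ norm_add_square_le]) (use i sq_int_add[OF assms] in \<open>auto simp: sq_int_def\<close>)
  then show ?thesis unfolding sq_norm_def using i by simp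
qed

lemma integrable_sq_int_mult:
  assumes "sq_int f" "sq_int g" shows "integrable lborel (\<lambda>x. f x * g x)"
proof (rule Bochner_Integration.integrable_bound)
  note [measurable] = assms[THEN sq_int_measurable]
  show "integrable lborel (\<lambda>x. (norm (f x))\<^sup>2 + (norm (g x))\<^sup>2)"
    using assms by (simp add: sq_int_def)
  have "norm (f x) * norm (g x) \<le> (norm (f x))\<^sup>2 + (norm (g x))\<^sup>2" for x
    using sum_squares_bound[of "norm (f x)" "norm (g x)"] mult_nonneg_nonneg[OF norm_ge_zero norm_ge_zero, of "f x" "g x"]
    by linarith
  then show "AE x in lborel. norm (f x * g x) \<le> norm ((norm (f x))\<^sup>2 + (norm (g x))\<^sup>2)"
    by (simp add: norm_mult)
qed (use assms[THEN sq_int_measurable] in simp)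

lemma Cauchy_Schwarz_sq_norm:
  assumes "sq_int f" "sq_int g"
  shows "norm (LINT x|lborel. f x * g x) \<le> sqrt (sq_norm f) * sqrt (sq_norm g)"
proof -
  note [measurable] = assms[THEN sq_int_measurable]
  have i: "integrable lborel (\<lambda>x. norm (f x) * norm (g x))"
    using integrable_norm[OF integrable_sq_int_mult[OF assms]] by (simp add: norm_mult)
  let ?I = "LINT x|lborel. norm (f x) * norm (g x)"
  have I0: "0 \<le> ?I" by (simp add: integral_nonneg_AE)
  have "(\<integral>\<^sup>+x. ennreal (norm (f x)) * ennreal (norm (g x)) \<partial>lborel)\<^sup>2
      \<le> (\<integral>\<^sup>+x. (ennreal (norm (f x)))\<^sup>2 \<partial>lborel) * (\<integral>\<^sup>+x. (ennreal (norm (g x)))\<^sup>2 \<partial>lborel)"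
    by (intro Cauchy_Schwarz_nn_integral) measurable
  also have "(\<integral>\<^sup>+x. ennreal (norm (f x)) * ennreal (norm (g x)) \<partial>lborel) = ennreal ?I"
    using i by (subst nn_integral_eq_integral[symmetric]) (auto simp: ennreal_mult)
  also have "(\<integral>\<^sup>+x. (ennreal (norm (f x)))\<^sup>2 \<partial>lborel) = ennreal (sq_norm f)"
    using assms unfolding sq_norm_def sq_int_def
    by (subst nn_integral_eq_integral[symmetric]) (auto simp: ennreal_power)
  also have "(\<integral>\<^sup>+x. (ennreal (norm (g x)))\<^sup>2 \<partial>lborel) = ennreal (sq_norm g)"
    using assms unfolding sq_norm_def sq_int_def
    by (subst nn_integral_eq_integral[symmetric]) (auto simp: ennreal_power)
  finally have "?I\<^sup>2 \<le> sq_norm f * sq_norm g"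
    using I0 by (simp add: ennreal_power sq_norm_nonneg flip: ennreal_mult)
  then have "?I \<le> sqrt (sq_norm f) * sqrt (sq_norm g)"
    using real_le_rsqrt by (simp flip: real_sqrt_mult)
  moreover have "norm (LINT x|lborel. f x * g x) \<le> ?I"
    using integral_norm_bound[of lborel "\<lambda>x. f x * g x"] by (simp add: norm_mult)
  ultimately show ?thesis by linarith
qed

text \<open>The two products differ by \<open>a' (b - b') + (a - a') b' + (a - a') (b - b')\<close>,
  and the integral of each term tends to 0 by Cauchy-Schwarz. This is how products of difference
  quotients pass to the limit.\<close>

lemma tendsto_integral_sq_int_mult:
  assumes a: "\<And>n. sq_int (a n)" "sq_int a'" "(\<lambda>n. sq_norm (\<lambda>x. a n x - a' x)) \<longlonglongrightarrow> 0"
    and b: "\<And>n. sq_int (b n)" "sq_int b'" "(\<lambda>n. sq_norm (\<lambda>x. b n x - b' x)) \<longlonglongrightarrow> 0"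
  shows "(\<lambda>n. LINT x|lborel. a n x * b n x) \<longlonglongrightarrow> (LINT x|lborel. a' x * b' x)"
proof -
  let ?A = "\<lambda>n x. a n x - a' x" and ?B = "\<lambda>n x. b n x - b' x"
  note s = sq_int_diff[OF a(1,2)] sq_int_diff[OF b(1,2)]
  note cs = Cauchy_Schwarz_sq_norm
  have z: "(\<lambda>n. LINT x|lborel. u n x * w n x) \<longlonglongrightarrow> 0"
    if "\<And>n. sq_int (u n)" "\<And>n. sq_int (w n)" "(\<lambda>n. sqrt (sq_norm (u n)) * sqrt (sq_norm (w n))) \<longlonglongrightarrow> 0" for u w
    by (rule Lim_null_comparison[OF _ that(3)]) (simp add: cs that)
  have lA: "(\<lambda>n. sqrt (sq_norm (?A n))) \<longlonglongrightarrow> 0" and lB: "(\<lambda>n. sqrt (sq_norm (?B n))) \<longlonglongrightarrow> 0"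
    using tendsto_real_sqrt[OF a(3)] tendsto_real_sqrt[OF b(3)] by simp_all
  have "(LINT x|lborel. a n x * b n x) = (LINT x|lborel. a' x * b' x) +
     ((LINT x|lborel. a' x * ?B n x) + (LINT x|lborel. ?A n x * b' x) + (LINT x|lborel. ?A n x * ?B n x))" for n
    using s a(2) b(2)
    by (subst Bochner_Integration.integral_add[symmetric],
        auto intro!: integrable_sq_int_mult Bochner_Integration.integrable_add simp del: integral_add)+
      (simp add: algebra_simps)
  moreover have "(\<lambda>n. (LINT x|lborel. a' x * b' x) +
     ((LINT x|lborel. a' x * ?B n x) + (LINT x|lborel. ?A n x * b' x) + (LINT x|lborel. ?A n x * ?B n x)))
     \<longlonglongrightarrow> (LINT x|lborel. a' x * b' x) + (0 + 0 + 0)"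
    by (intro tendsto_add tendsto_const z s a(2) b(2) tendsto_mult_left_zero tendsto_mult_right_zero tendsto_mult_zero lA lB)
  ultimately show ?thesis by simp
qed

text \<open>At a point of \<open>U\<close> small translations stay in \<open>U\<close>, so the part
  lost by translating, \<open>?m n\<close>, tends to 0 pointwise and is dominated by the indicator.
  Nothing is known at boundary points outside \<open>U\<close>, but translation invariance makes the
  part gained as large as the part lost, whence the factor 2.\<close>

lemma translate_indicator_open:
  fixes v :: "nat \<Rightarrow> real^2"
  assumes U: "open U" "emeasure lborel U < \<infinity>" and v: "v \<longlonglongrightarrow> 0"
  shows "(\<lambda>n. LINT x|lborel. \<bar>indicator U (x + v n) - indicator U x\<bar>) \<longlonglongrightarrow> (0::real)"
proof -
  have [measurable]: "U \<in> sets borel" using U by simp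
  let ?u = "indicator U :: real^2 \<Rightarrow> real"
  have i: "integrable lborel ?u" using U by (simp add: integrable_indicator_iff)
  then have iv: "integrable lborel (\<lambda>x. ?u (x + w))" for w by (subst integrable_translate_iff) auto
  let ?m = "\<lambda>n x. max 0 (?u x - ?u (x + v n))"
  have im: "integrable lborel (?m n)" for n
    using i iv by auto
  have "(\<lambda>n. LINT x|lborel. ?m n x) \<longlonglongrightarrow> (LINT x|(lborel::(real^2) measure). 0)"
  proof (rule integral_dominated_convergence[where w="?u"])
    have "(\<lambda>n. ?m n x) \<longlonglongrightarrow> 0" for x
    proof (cases "x \<in> U")
      case True
      have "(\<lambda>n. x + v n) \<longlonglongrightarrow> x + 0" by (intro tendsto_intros v)
      then have "\<forall>\<^sub>F n in sequentially. x + v n \<in> U"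
        using topological_tendstoD[OF _ U(1)] True by simp
      then show ?thesis by (intro tendsto_eventually) (auto elim: eventually_mono)
    qed simp
    then show "AE x in lborel. (\<lambda>n. ?m n x) \<longlonglongrightarrow> 0" by simp
    show "AE x in lborel. norm (?m n x) \<le> ?u x" for n by (auto simp: indicator_def)
  qed (use i in auto)
  moreover have "(LINT x|lborel. \<bar>?u (x + v n) - ?u x\<bar>) = 2 * (LINT x|lborel. ?m n x)" for n
  proof -
    have "\<bar>?u (x + v n) - ?u x\<bar> = 2 * ?m n x - (?u x - ?u (x + v n))" for x
      by (auto simp: indicator_def)
    then have "(LINT x|lborel. \<bar>?u (x + v n) - ?u x\<bar>) = 2 * (LINT x|lborel. ?m n x) -
        ((LINT x|lborel. ?u x) - (LINT x|lborel. ?u (x + v n)))"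
      using i iv im by (simp del: integral_indicator)
    then show ?thesis using integral_translate[of ?u "v n"] by simp
  qed
  ultimately show ?thesis using tendsto_mult_right_zero[where c=2] by simp
qed

text \<open>Outer regularity replaces \<open>A\<close> by an open superset \<open>U\<close>. The
  error is the indicator of \<open>U - A\<close> and its translate, each of integral less than
  \<open>e / 4\<close>, while the open case contributes \<open>e / 2\<close>.\<close>

lemma translate_indicator:
  fixes v :: "nat \<Rightarrow> real^2"
  assumes A: "A \<in> sets borel" "emeasure lborel A < \<infinity>" and v: "v \<longlonglongrightarrow> 0"
  shows "(\<lambda>n. LINT x|lborel. \<bar>indicator A (x + v n) - indicator A x\<bar>) \<longlonglongrightarrow> (0::real)"
proof (rule LIMSEQ_I)
  fix e :: real assume e: "0 < e"
  obtain U where U: "open U" "A \<subseteq> U" and m: "emeasure lborel (U - A) < ennreal (e / 4)"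
    using outer_regular_lborel[OF A(1), of "e/4"] e by auto
  note [measurable] = A(1) borel_open[OF U(1)]
  have [measurable]: "U - A \<in> sets borel" by measurable
  have "emeasure lborel U = emeasure lborel A + emeasure lborel (U - A)"
    using U A by (subst plus_emeasure) (auto simp: Un_absorb1 intro!: arg_cong[where f="emeasure lborel"])
  with m A(2) have fin: "emeasure lborel U < \<infinity>" "emeasure lborel (U - A) < \<infinity>"
    by (auto simp: less_top[symmetric] ennreal_add_eq_top)
  have iU: "integrable lborel (indicator U :: _ \<Rightarrow> real)" "integrable lborel (indicator (U - A) :: _ \<Rightarrow> real)"
    "integrable lborel (indicator A :: _ \<Rightarrow> real)"
    using fin A by (simp_all add: integrable_indicator_iff)
  have iv: "integrable lborel (\<lambda>x. indicator B (x + w) :: real)" if "integrable lborel (indicator B :: _ \<Rightarrow> real)"  "B \<in> sets borel" for w :: "real^2" and B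
    using that by (intro integrable_translate_iff[of "indicator B", THEN iffD2]) auto
  have d: "(LINT x|lborel. indicator (U - A) x :: real) < e / 4"
  proof -
    have "ennreal (measure lborel (U - A)) < ennreal (e / 4)"
      using m fin(2) by (subst emeasure_eq_ennreal_measure[symmetric]) auto
    then show ?thesis using e by (simp add: ennreal_less_iff)
  qed
  have d': "(LINT x|lborel. indicator (U - A) (x + w) :: real) < e / 4" for w
    using d integral_translate[of "indicator (U - A) :: _ \<Rightarrow> real" w] by simp
  have le: "(LINT x|lborel. \<bar>indicator A (x + w) - indicator A x :: real\<bar>) \<le>
      (LINT x|lborel. \<bar>indicator U (x + w) - indicator U x :: real\<bar>) + 
       ((LINT x|lborel. indicator (U - A) (x + w) :: real) + (LINT x|lborel. indicator (U - A) x))" for w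
  proof -
    have "(LINT x|lborel. \<bar>indicator A (x + w) - indicator A x :: real\<bar>) \<le>
      (LINT x|lborel. \<bar>indicator U (x + w) - indicator U x :: real\<bar> + (indicator (U - A) (x + w) + indicator (U - A) x))"
    proof (rule integral_mono)
      show "\<bar>indicator A (x + w) - indicator A x :: real\<bar> \<le> \<bar>indicator U (x + w) - indicator U x :: real\<bar> + (indicator (U - A) (x + w) + indicator (U - A) x)" for x
        using U(2) by (auto simp: indicator_def)
    qed (intro Bochner_Integration.integrable_add Bochner_Integration.integrable_diff integrable_abs iU iv; simp)+
    also have "\<dots> = (LINT x|lborel. \<bar>indicator U (x + w) - indicator U x :: real\<bar>) + 
       ((LINT x|lborel. indicator (U - A) (x + w) :: real) + (LINT x|lborel. indicator (U - A) x))"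
      by (subst Bochner_Integration.integral_add Bochner_Integration.integral_add[OF iv iU(2)],
        (intro Bochner_Integration.integrable_add Bochner_Integration.integrable_diff integrable_abs iU iv; simp)+)+ simp
    finally show ?thesis .
  qed
  obtain N where N: "\<And>n. n \<ge> N \<Longrightarrow> \<bar>LINT x|lborel. \<bar>indicator U (x + v n) - indicator U x :: real\<bar>\<bar> < e / 2"
    using LIMSEQ_D[OF translate_indicator_open[OF U(1) fin(1) v], of "e/2"] e by auto
  have "norm ((LINT x|lborel. \<bar>indicator A (x + v n) - indicator A x :: real\<bar>) - 0) < e" if "n \<ge> N" for n
    using le[of "v n"] d d'[of "v n"] N[OF that] by (simp add: abs_of_nonneg)
  then show "\<exists>N. \<forall>n\<ge>N. norm ((LINT x|lborel. \<bar>indicator A (x + v n) - indicator A x :: real\<bar>) - 0) < e" by blast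
qed

text \<open>Induction over integrable functions, with indicators as the base case. In the limit case
  the error \<open>f - s i\<close> appears once in place and once translated, and translation
  invariance gives both the same norm.\<close>

lemma translate_L1:
  fixes f :: "real^2 \<Rightarrow> complex" and v :: "nat \<Rightarrow> real^2"
  assumes "integrable lborel f" and v: "v \<longlonglongrightarrow> 0"
  shows "(\<lambda>n. LINT x|lborel. norm (f (x + v n) - f x)) \<longlonglongrightarrow> 0"
  using assms(1)
proof induct
  case (base A c)
  have "norm (indicator A (x + w) *\<^sub>R c - indicator A x *\<^sub>R c) = norm c * \<bar>indicator A (x + w) - indicator A x\<bar>" for x w
    by (auto simp: indicator_def)
  then show ?case
    using tendsto_mult_right_zero[OF translate_indicator[OF _ _ v, of A], of "norm c"] base by simp
next
  case (add f g)
  have i: "integrable lborel (\<lambda>x. f (x + w))" "integrable lborel (\<lambda>x. g (x + w))" for w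
    using add by (subst integrable_translate_iff; auto)+
  have "(\<lambda>n. (LINT x|lborel. norm (f (x + v n) - f x)) + (LINT x|lborel. norm (g (x + v n) - g x))) \<longlonglongrightarrow> 0 + 0"
    using add by (intro tendsto_add) auto
  then have lim: "(\<lambda>n. (LINT x|lborel. norm (f (x + v n) - f x)) + (LINT x|lborel. norm (g (x + v n) - g x))) \<longlonglongrightarrow> 0"
    by simp
  show ?case
  proof (rule Lim_null_comparison[OF _ lim], intro always_eventually allI)
    fix n
    have "(LINT x|lborel. norm (f (x + v n) + g (x + v n) - (f x + g x))) \<le>
      (LINT x|lborel. norm (f (x + v n) - f x) + norm (g (x + v n) - g x))"
    proof (rule integral_mono)
      show "norm (f (x + v n) + g (x + v n) - (f x + g x)) \<le> norm (f (x + v n) - f x) + norm (g (x + v n) - g x)" for x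
        using norm_triangle_ineq[of "f (x + v n) - f x" "g (x + v n) - g x"] by (simp add: algebra_simps)
    qed (use i add in auto)
    also have "\<dots> = (LINT x|lborel. norm (f (x + v n) - f x)) + (LINT x|lborel. norm (g (x + v n) - g x))"
      using i add by simp
    finally show "norm (LINT x|lborel. norm (f (x + v n) + g (x + v n) - (f x + g x))) \<le>
      (LINT x|lborel. norm (f (x + v n) - f x)) + (LINT x|lborel. norm (g (x + v n) - g x))"
      by (simp add: abs_of_nonneg)
  qed
next
  case (lim f s)
  note [measurable] = borel_measurable_integrable[OF lim(5)]
  have ms[measurable]: "s i \<in> borel_measurable borel" for i using borel_measurable_integrable[OF lim(1)] by simp
  have i: "integrable lborel (\<lambda>x. f (x + w))" "integrable lborel (\<lambda>x. s i (x + w))" for w i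
    using lim(1,5) by (subst integrable_translate_iff; auto)+
  \<comment> \<open>The approximating functions satisfy
    \<open>norm (s i x) \<le> 2 * norm (f x)\<close>, which gives the majorant
    \<open>3 * norm (f x)\<close>.\<close>
  have "(\<lambda>i. LINT x|lborel. norm (s i x - f x)) \<longlonglongrightarrow> (LINT x|(lborel::(real^2) measure). 0)"
  proof (rule integral_dominated_convergence[where w="\<lambda>x. 3 * norm (f x)"])
    show "AE x in lborel. (\<lambda>i. norm (s i x - f x)) \<longlonglongrightarrow> 0"
      using lim(3) by (auto simp: LIM_zero_iff tendsto_norm_zero_iff)
    have "norm (s i x - f x) \<le> 3 * norm (f x)" for i x
      using lim(4)[of x i] norm_triangle_ineq4[of "s i x" "f x"] by simp
    then show "AE x in lborel. norm (norm (s i x - f x)) \<le> 3 * norm (f x)" for i by simp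
  qed (use lim in auto)
  then have l0: "(\<lambda>i. LINT x|lborel. norm (s i x - f x)) \<longlonglongrightarrow> 0" by simp
  show ?case
  proof (rule LIMSEQ_I)
    fix e :: real assume e: "0 < e"
    obtain i where i1: "(LINT x|lborel. norm (s i x - f x)) < e / 4"
      using LIMSEQ_D[OF l0, of "e/4"] e by (auto simp: abs_of_nonneg)
    obtain N where N: "\<And>n. n \<ge> N \<Longrightarrow> (LINT x|lborel. norm (s i (x + v n) - s i x)) < e / 2"
      using LIMSEQ_D[OF lim(2)[of i], of "e/2"] e by (auto simp: abs_of_nonneg)
    have "(LINT x|lborel. norm (f (x + v n) - f x)) < e" if "n \<ge> N" for n
    proof -
      have "(LINT x|lborel. norm (f (x + v n) - f x)) \<le>
        (LINT x|lborel. norm (s i (x + v n) - f (x + v n)) + (norm (s i (x + v n) - s i x) + norm (s i x - f x)))"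
      proof (rule integral_mono)
        show "norm (f (x + v n) - f x) \<le> norm (s i (x + v n) - f (x + v n)) + (norm (s i (x + v n) - s i x) + norm (s i x - f x))" for x
          by norm
      qed (use i lim in auto)
      also have "\<dots> = (LINT x|lborel. norm (s i (x + v n) - f (x + v n))) + ((LINT x|lborel. norm (s i (x + v n) - s i x)) + (LINT x|lborel. norm (s i x - f x)))"
        using i lim by simp
      also have "(LINT x|lborel. norm (s i (x + v n) - f (x + v n))) = (LINT x|lborel. norm (s i x - f x))"
        using integral_translate[of "\<lambda>x. norm (s i x - f x)" "v n"] by simp
      finally show ?thesis using i1 N[OF that] by simp
    qed
    then show "\<exists>N. \<forall>n\<ge>N. norm ((LINT x|lborel. norm (f (x + v n) - f x)) - 0) < e"
      by (auto simp: abs_of_nonneg)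
  qed
qed

text \<open>Truncation to values of modulus at most \<open>m\<close> on the ball of radius
  \<open>m\<close> gives integrable functions \<open>s m\<close>. Their squared increments are at
  most \<open>2 * m\<close> times the increments, which reduces them to the integrable case, and
  they approximate \<open>f\<close> in the square norm.\<close>

lemma translate_L2:
  fixes v :: "nat \<Rightarrow> real^2"
  assumes f: "sq_int f" and v: "v \<longlonglongrightarrow> 0"
  shows "(\<lambda>n. sq_norm (\<lambda>x. f (x + v n) - f x)) \<longlonglongrightarrow> 0"
proof -
  note [measurable] = sq_int_measurable[OF f]
  define s where "s m x = (if norm x \<le> real m \<and> norm (f x) \<le> real m then f x else 0)" for m x
  have [measurable]: "s m \<in> borel_measurable borel" for m unfolding s_def by measurable
  have sf: "norm (s m x) \<le> norm (f x)" and sm: "norm (s m x) \<le> real m" for m x by (auto simp: s_def)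
  have si: "sq_int (s m)" for m by (rule sq_int_bound[OF f, of _ 1]) (use sf in auto)
  have i1: "integrable lborel (s m)" for m
  proof (rule Bochner_Integration.integrable_bound)
    show "integrable lborel (\<lambda>x. indicator (cball 0 (real m)) x *\<^sub>R real m)"
      by (intro integrable_scaleR_left) (simp add: integrable_indicator_iff emeasure_bounded_finite[OF bounded_cball, unfolded infinity_ennreal_def])
    show "AE x in lborel. norm (s m x) \<le> norm (indicator (cball 0 (real m)) x *\<^sub>R real m)"
      by (auto simp: s_def)
  qed simp
  have "(\<lambda>m. LINT x|lborel. (norm (s m x - f x))\<^sup>2) \<longlonglongrightarrow> (LINT x|(lborel::(real^2) measure). 0)"
  proof (rule integral_dominated_convergence[where w="\<lambda>x. (2 * norm (f x))\<^sup>2"])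
    have "(\<lambda>m. (norm (s m x - f x))\<^sup>2) \<longlonglongrightarrow> 0" for x
    proof (rule tendsto_eventually)
      obtain m0 where "norm x \<le> real m0" "norm (f x) \<le> real m0"
        by (metis max.bounded_iff real_arch_simple)
      then show "\<forall>\<^sub>F m in sequentially. (norm (s m x - f x))\<^sup>2 = 0"
        unfolding eventually_sequentially by (intro exI[of _ m0]) (auto simp: s_def)
    qed
    then show "AE x in lborel. (\<lambda>m. (norm (s m x - f x))\<^sup>2) \<longlonglongrightarrow> 0" by simp
    show "AE x in lborel. norm ((norm (s m x - f x))\<^sup>2) \<le> (2 * norm (f x))\<^sup>2" for m
      by (auto simp: s_def intro!: power_mono)
    show "integrable lborel (\<lambda>x. (2 * norm (f x))\<^sup>2)" using f by (simp add: sq_int_def power_mult_distrib)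
  qed auto
  then have l0: "(\<lambda>m. sq_norm (\<lambda>x. s m x - f x)) \<longlonglongrightarrow> 0" by (simp add: sq_norm_def)
  have l1: "(\<lambda>n. sq_norm (\<lambda>x. s m (x + v n) - s m x)) \<longlonglongrightarrow> 0" for m
  proof (rule Lim_null_comparison)
    show "(\<lambda>n. 2 * real m * (LINT x|lborel. norm (s m (x + v n) - s m x))) \<longlonglongrightarrow> 0"
      by (rule tendsto_mult_right_zero[OF translate_L1[OF i1 v]])
    have "sq_norm (\<lambda>x. s m (x + v n) - s m x) \<le> (LINT x|lborel. 2 * real m * norm (s m (x + v n) - s m x))" for n
      unfolding sq_norm_def
    proof (rule integral_mono)
      show "(norm (s m (x + v n) - s m x))\<^sup>2 \<le> 2 * real m * norm (s m (x + v n) - s m x)" for x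
        unfolding power2_eq_square
        using norm_triangle_ineq4[of "s m (x + v n)" "s m x"] sm[of m x] sm[of m "x + v n"]
        by (intro mult_right_mono) auto
      show "integrable lborel (\<lambda>x. (norm (s m (x + v n) - s m x))\<^sup>2)"
        using sq_int_diff[OF sq_int_translate[OF si] si] by (auto simp: sq_int_def)
      show "integrable lborel (\<lambda>x. 2 * real m * norm (s m (x + v n) - s m x))"
        using i1 integrable_translate_iff[of "s m" "v n"] by auto
    qed
    then show "\<forall>\<^sub>F n in sequentially. norm (sq_norm (\<lambda>x. s m (x + v n) - s m x)) \<le> 2 * real m * (LINT x|lborel. norm (s m (x + v n) - s m x))"
      by (simp add: sq_norm_nonneg)
  qed
  show ?thesis
  proof (rule LIMSEQ_I)
    fix e :: real assume e: "0 < e"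
    \<comment> \<open>The square of a sum costs a factor 2 at each of two splittings:
      \<open>2 * e/12 + 2 * (2 * e/8 + 2 * e/12) = e\<close>.\<close>
    obtain m where m: "sq_norm (\<lambda>x. s m x - f x) < e / 12"
      using LIMSEQ_D[OF l0, of "e/12"] e by (auto simp: abs_of_nonneg sq_norm_nonneg)
    obtain N where N: "\<And>n. n \<ge> N \<Longrightarrow> sq_norm (\<lambda>x. s m (x + v n) - s m x) < e / 8"
      using LIMSEQ_D[OF l1[of m], of "e/8"] e by (auto simp: abs_of_nonneg sq_norm_nonneg)
    have "sq_norm (\<lambda>x. f (x + v n) - f x) < e" if n: "n \<ge> N" for n
    proof -
      note d = sq_int_diff[OF si f, of m]
      have d': "sq_int (\<lambda>x. -1 * (s m (x + v n) - f (x + v n)))"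
        using sq_int_cmult[OF sq_int_translate[OF d]] .
      have d'': "sq_int (\<lambda>x. s m (x + v n) - s m x)" by (intro sq_int_diff sq_int_translate si)
      have le: "sq_norm (\<lambda>x. (s m (x + v n) - s m x) + (s m x - f x)) \<le>
          2 * sq_norm (\<lambda>x. s m (x + v n) - s m x) + 2 * sq_norm (\<lambda>x. s m x - f x)"
        by (rule sq_norm_add_le[OF d'' d])
      have "sq_norm (\<lambda>x. f (x + v n) - f x) =
          sq_norm (\<lambda>x. -1 * (s m (x + v n) - f (x + v n)) + ((s m (x + v n) - s m x) + (s m x - f x)))"
        by simp
      also have "\<dots> \<le> 2 * sq_norm (\<lambda>x. -1 * (s m (x + v n) - f (x + v n))) +
          2 * sq_norm (\<lambda>x. (s m (x + v n) - s m x) + (s m x - f x))"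
        by (intro sq_norm_add_le d' sq_int_add d d'')
      also have "sq_norm (\<lambda>x. -1 * (s m (x + v n) - f (x + v n))) = sq_norm (\<lambda>x. s m x - f x)"
        using sq_norm_translate[OF d, of "v n"] by (simp add: sq_norm_def norm_minus_commute)
      finally show ?thesis using le m N[OF n] by linarith
    qed
    then show "\<exists>N. \<forall>n\<ge>N. norm (sq_norm (\<lambda>x. f (x + v n) - f x) - 0) < e"
      by (auto simp: abs_of_nonneg sq_norm_nonneg)
  qed
qed

section \<open>Weak directional derivatives and increments\<close>

text \<open>Jensen's inequality for the squared distance to \<open>c\<close>. With values in
  \<open>ennreal\<close> an infinite right-hand side is allowed; if it is finite,
  \<open>g - c\<close> is square integrable, hence integrable on a probability space, and
  Cauchy-Schwarz against the constant 1 applies.\<close>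

lemma (in prob_space) norm_integral_square_le:
  fixes g :: "'a \<Rightarrow> complex"
  assumes [measurable]: "g \<in> borel_measurable M"
  shows "ennreal ((norm ((LINT t|M. g t) - c))\<^sup>2) \<le> (\<integral>\<^sup>+t. ennreal ((norm (g t - c))\<^sup>2) \<partial>M)"
proof (cases "(\<integral>\<^sup>+t. ennreal ((norm (g t - c))\<^sup>2) \<partial>M) < \<infinity>")
  case True
  then have i2: "integrable M (\<lambda>t. (g t - c)\<^sup>2)"
    by (intro integrableI_bounded) (measurable, simp add: norm_power)
  have i: "integrable M (\<lambda>t. g t - c)"
    by (rule square_integrable_imp_integrable[OF _ i2]) measurable
  have "(LINT t|M. g t) = (LINT t|M. (g t - c) + c)" by simp
  also have "\<dots> = (LINT t|M. g t - c) + (LINT t|M. c)"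
    by (rule Bochner_Integration.integral_add[OF i integrable_const])
  finally have "(LINT t|M. g t) - c = (LINT t|M. g t - c)" by (simp add: prob_space)
  then have "norm ((LINT t|M. g t) - c) \<le> (LINT t|M. norm (g t - c))"
    using integral_norm_bound[of M "\<lambda>t. g t - c"] by simp
  then have "ennreal (norm ((LINT t|M. g t) - c)) \<le> ennreal (LINT t|M. norm (g t - c))"
    by (rule ennreal_leI)
  also have "\<dots> = (\<integral>\<^sup>+t. ennreal (norm (g t - c)) * 1 \<partial>M)"
    using i by (subst nn_integral_eq_integral[symmetric]) auto
  finally have "(ennreal (norm ((LINT t|M. g t) - c)))\<^sup>2 \<le> (\<integral>\<^sup>+t. ennreal (norm (g t - c)) * 1 \<partial>M)\<^sup>2"
    by (rule power_mono) simp
  also have "\<dots> \<le> (\<integral>\<^sup>+t. (ennreal (norm (g t - c)))\<^sup>2 \<partial>M) * (\<integral>\<^sup>+t. 1\<^sup>2 \<partial>M)"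
    by (rule Cauchy_Schwarz_nn_integral) measurable
  finally show ?thesis by (simp add: ennreal_power emeasure_space_1)
qed (simp add: not_less top_unique)

text \<open>The uniform distribution on the unit interval. Being a probability measure, it turns the
  mean over a segment into an expectation, so that Jensen's inequality and Fubini on the product
  with Lebesgue measure are directly available.\<close>

definition unit_time :: "real measure" where
  "unit_time = density lborel (\<lambda>t. ennreal (indicator {0..1} t))"

lemma sets_unit_time[simp, measurable_cong]: "sets unit_time = sets borel"
  and space_unit_time[simp]: "space unit_time = UNIV"
  by (simp_all add: unit_time_def)

lemma measurable_unit_time[simp]: "borel_measurable unit_time = borel_measurable borel"
  by (rule measurable_cong_sets) auto

interpretation unit_time: prob_space unit_time
proof
  have "ennreal (indicator {0..1::real} t) = indicator {0..1} t" for t by (auto simp: indicator_def)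
  then show "emeasure unit_time (space unit_time) = 1"
    by (simp add: unit_time_def emeasure_density)
qed

interpretation space_time: pair_sigma_finite "lborel :: (real^2) measure" unit_time ..

lemma AE_unit_time: "AE t in unit_time. t \<in> {0..1}"
  unfolding unit_time_def by (subst AE_density) (auto simp: indicator_def simp del: atLeastAtMost_iff)

lemma integral_unit_time:
  fixes f :: "real \<Rightarrow> 'a::{banach, second_countable_topology}"
  shows "f \<in> borel_measurable borel \<Longrightarrow> (LINT t|unit_time. f t) = (LINT t:{0..1}|lborel. f t)"
  by (simp add: unit_time_def integral_density set_lebesgue_integral_def)

definition dir_deriv :: "real^2 \<Rightarrow> (real^2 \<Rightarrow> real) \<Rightarrow> real^2 \<Rightarrow> real" where
  "dir_deriv v \<phi> x = (\<Sum>j\<in>UNIV. v $ j * partial j \<phi> x)"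

lemma dir_deriv_axis: "dir_deriv (axis j 1) \<phi> = partial j \<phi>"
  by (auto simp: dir_deriv_def axis_def if_distrib[of "\<lambda>x. x * z" for z] cong: if_cong)

lemma dir_deriv_scale: "dir_deriv (c *\<^sub>R v) \<phi> x = c * dir_deriv v \<phi> x"
  by (simp add: dir_deriv_def sum_distrib_left mult.assoc)

lemma smooth_dir_deriv: "smooth \<phi> \<Longrightarrow> smooth (dir_deriv v \<phi>)"
  unfolding dir_deriv_def[abs_def] sum_2
  by (intro smooth_add smooth_mult smooth_const smooth_partial)

lemma test_function_dir_deriv: "test_function \<phi> \<Longrightarrow> test_function (dir_deriv v \<phi>)"
  unfolding test_function_iff dir_deriv_def[abs_def] sum_2
  by (auto intro!: smooth_add smooth_mult smooth_const smooth_partial simp: partial_eq_0_outside)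
    (metis add.right_neutral mult_zero_right partial_eq_0_outside)

lemma dir_deriv_translate:
  "smooth \<phi> \<Longrightarrow> dir_deriv v (\<lambda>x. \<phi> (x + w)) = (\<lambda>x. dir_deriv v \<phi> (x + w))"
  using partial_affine(1)[OF smooth_differentiable, of \<phi> _ w 1]
  by (simp add: dir_deriv_def[abs_def] add.commute)

lemma test_function_translate: "test_function \<phi> \<Longrightarrow> test_function (\<lambda>x. \<phi> (x + w))"
  using test_function_affine[of \<phi> 1 w] by (simp add: add.commute)

lemma smooth_diff_eq_integral:
  assumes "smooth \<phi>"
  shows "\<phi> (x + v) - \<phi> x = (LINT t|unit_time. dir_deriv v \<phi> (x + t *\<^sub>R v))"
proof -
  note [measurable] = smooth_measurable[OF smooth_dir_deriv[OF assms]]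
  have d: "((\<lambda>t. \<phi> (x + t *\<^sub>R v)) has_vector_derivative dir_deriv v \<phi> (x + t *\<^sub>R v)) (at t within {0..1})" for t
  proof -
    have "((\<lambda>t. \<phi> (x + t *\<^sub>R v)) has_derivative (\<lambda>s. \<Sum>j\<in>UNIV. (s *\<^sub>R v) $ j * partial j \<phi> (x + t *\<^sub>R v))) (at t within {0..1})"
      by (rule has_derivative_compose[where f="\<lambda>t. x + t *\<^sub>R v", OF _ has_derivative_partial[OF smooth_differentiable[OF assms]]])
        (auto intro!: derivative_eq_intros)
    then show ?thesis
      by (simp add: has_vector_derivative_def dir_deriv_def sum_distrib_left mult.assoc)
  qed
  have "(LINT t:{0..1}|lborel. dir_deriv v \<phi> (x + t *\<^sub>R v)) = \<phi> (x + 1 *\<^sub>R v) - \<phi> (x + 0 *\<^sub>R v)"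
    unfolding set_lebesgue_integral_def
    by (rule integral_FTC_Icc[OF _ d])
      (auto intro!: continuous_on_compose2[OF smooth_continuous[OF smooth_dir_deriv[OF assms], of UNIV]] continuous_intros)
  then show ?thesis by (simp add: integral_unit_time)
qed

lemma nn_integral_local_less_top:
  assumes "loc_int f"
  shows "(\<integral>\<^sup>+x. ennreal (norm (f x) * (M * indicator (cball 0 R) x)) \<partial>lborel) < \<infinity>"
proof -
  note [measurable] = loc_int_measurable[OF assms]
  have "integrable lborel (\<lambda>x. f x * of_real (M * indicator (cball 0 R) x))"
    by (rule integrable_loc_int_bounded[OF assms, where M="\<bar>M\<bar>" and R=R]) (auto simp: indicator_def)
  then have "(\<integral>\<^sup>+x. ennreal (norm (f x) * \<bar>M * indicator (cball 0 R) x\<bar>) \<partial>lborel) < \<infinity>"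
    by (simp add: integrable_iff_bounded norm_mult abs_mult)
  moreover have "(\<integral>\<^sup>+x. ennreal (norm (f x) * (M * indicator (cball 0 R) x)) \<partial>lborel)
      \<le> (\<integral>\<^sup>+x. ennreal (norm (f x) * \<bar>M * indicator (cball 0 R) x\<bar>) \<partial>lborel)"
    by (intro nn_integral_mono ennreal_leI mult_left_mono) auto
  ultimately show ?thesis by (rule le_less_trans[rotated])
qed

text \<open>Supplies the hypothesis of Fubini's theorem. For \<open>t\<close> in the unit interval
  the translated ball stays inside the ball of radius \<open>R + norm v\<close>, so the inner
  integrals over the plane are bounded by one constant \<open>C\<close>.\<close>

lemma integrable_segment_fixed:
  fixes a :: "real^2 \<Rightarrow> complex"
  assumes f: "loc_int f" and [measurable]: "a \<in> borel_measurable borel"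
    and M: "0 \<le> M" and a: "\<And>x. norm (a x) \<le> M * indicator (cball 0 R) x"
  shows "integrable (lborel \<Otimes>\<^sub>M unit_time) (\<lambda>(x, t). f x * a (x - t *\<^sub>R v))"
    and "integrable (lborel \<Otimes>\<^sub>M unit_time) (\<lambda>(x, t). f (x + t *\<^sub>R v) * a x)"
proof -
  note [measurable] = loc_int_measurable[OF f]
  define C where "C = (\<integral>\<^sup>+x. ennreal (norm (f x) * (M * indicator (cball 0 (R + norm v)) x)) \<partial>lborel)"
  have C: "C < \<infinity>" unfolding C_def by (rule nn_integral_local_less_top[OF f])
  have m[measurable]: "(\<lambda>(x, t). f x * a (x - t *\<^sub>R v)) \<in> borel_measurable (lborel \<Otimes>\<^sub>M unit_time)"
    "(\<lambda>(x, t). f (x + t *\<^sub>R v) * a x) \<in> borel_measurable (lborel \<Otimes>\<^sub>M unit_time)"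
    by measurable
  have le: "(\<integral>\<^sup>+x. ennreal (norm (f x * a (x - t *\<^sub>R v))) \<partial>lborel) \<le> C" if "t \<in> {0..1}" for t
    unfolding C_def
  proof (rule nn_integral_mono, rule ennreal_leI)
    fix x
    have "norm x \<le> norm (x - t *\<^sub>R v) + norm v"
    proof -
      have "norm x \<le> norm (x - t *\<^sub>R v) + norm (t *\<^sub>R v)"
        using norm_triangle_ineq[of "x - t *\<^sub>R v" "t *\<^sub>R v"] by simp
      moreover have "norm (t *\<^sub>R v) \<le> norm v" using that by (auto intro: mult_left_le_one_le)
      ultimately show ?thesis by linarith
    qed
    then have "norm (a (x - t *\<^sub>R v)) \<le> M * indicator (cball 0 (R + norm v)) x"
      using M by (intro order_trans[OF a] mult_left_mono) (auto simp: indicator_def)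
    then show "norm (f x * a (x - t *\<^sub>R v)) \<le> norm (f x) * (M * indicator (cball 0 (R + norm v)) x)"
      by (simp add: norm_mult mult_left_mono)
  qed
  have tr: "(\<integral>\<^sup>+x. ennreal (norm (f (x + t *\<^sub>R v) * a x)) \<partial>lborel) = (\<integral>\<^sup>+x. ennreal (norm (f x * a (x - t *\<^sub>R v))) \<partial>lborel)" for t
    using nn_integral_translate[of "\<lambda>x. ennreal (norm (f x * a (x - t *\<^sub>R v)))" "t *\<^sub>R v"] by simp
  have fin: "(\<integral>\<^sup>+t. g t \<partial>unit_time) < \<infinity>" if "\<And>t. t \<in> {0..1} \<Longrightarrow> g t \<le> C" for g
  proof -
    have "(\<integral>\<^sup>+t. g t \<partial>unit_time) \<le> (\<integral>\<^sup>+t. C \<partial>unit_time)"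
      by (rule nn_integral_mono_AE, rule eventually_mono[OF AE_unit_time that])
    also have "\<dots> = C" by (simp add: unit_time.emeasure_space_1[simplified])
    finally show ?thesis using C by simp
  qed
  show "integrable (lborel \<Otimes>\<^sub>M unit_time) (\<lambda>(x, t). f x * a (x - t *\<^sub>R v))"
  proof (rule integrableI_bounded[OF m(1)])
    have "(\<integral>\<^sup>+z. ennreal (norm (case z of (x, t) \<Rightarrow> f x * a (x - t *\<^sub>R v))) \<partial>(lborel \<Otimes>\<^sub>M unit_time)) =
        (\<integral>\<^sup>+t. (\<integral>\<^sup>+x. ennreal (norm (f x * a (x - t *\<^sub>R v))) \<partial>lborel) \<partial>unit_time)"
      by (subst space_time.nn_integral_snd[symmetric]) (auto simp: case_prod_unfold)
    also have "\<dots> < \<infinity>" by (rule fin[OF le])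
    finally show "(\<integral>\<^sup>+z. ennreal (norm (case z of (x, t) \<Rightarrow> f x * a (x - t *\<^sub>R v))) \<partial>(lborel \<Otimes>\<^sub>M unit_time)) < \<infinity>" .
  qed
  show "integrable (lborel \<Otimes>\<^sub>M unit_time) (\<lambda>(x, t). f (x + t *\<^sub>R v) * a x)"
  proof (rule integrableI_bounded[OF m(2)])
    have "(\<integral>\<^sup>+z. ennreal (norm (case z of (x, t) \<Rightarrow> f (x + t *\<^sub>R v) * a x)) \<partial>(lborel \<Otimes>\<^sub>M unit_time)) =
        (\<integral>\<^sup>+t. (\<integral>\<^sup>+x. ennreal (norm (f (x + t *\<^sub>R v) * a x)) \<partial>lborel) \<partial>unit_time)"
      by (subst space_time.nn_integral_snd[symmetric]) (auto simp: case_prod_unfold)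
    also have "\<dots> < \<infinity>" unfolding tr by (rule fin[OF le])
    finally show "(\<integral>\<^sup>+z. ennreal (norm (case z of (x, t) \<Rightarrow> f (x + t *\<^sub>R v) * a x)) \<partial>(lborel \<Otimes>\<^sub>M unit_time)) < \<infinity>" .
  qed
qed

definition weak_dir :: "real^2 \<Rightarrow> (real^2 \<Rightarrow> complex) \<Rightarrow> (real^2 \<Rightarrow> complex) \<Rightarrow> bool" where
  "weak_dir v \<psi> W \<longleftrightarrow> loc_int \<psi> \<and> loc_int W \<and>
     (\<forall>\<phi>. test_function \<phi> \<longrightarrow>
        (LINT x|lborel. \<psi> x * of_real (dir_deriv v \<phi> x)) = - (LINT x|lborel. W x * of_real (\<phi> x)))"

lemma loc_int_segment_mean:
  assumes W: "loc_int W" shows "loc_int (\<lambda>x. LINT t|unit_time. W (x + t *\<^sub>R v))"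
  unfolding loc_int_def
proof safe
  note [measurable] = loc_int_measurable[OF W]
  have "(\<lambda>x. LINT t|unit_time. (case (x, t) of (x, t) \<Rightarrow> W (x + t *\<^sub>R v))) \<in> borel_measurable lborel"
    by (rule unit_time.borel_measurable_lebesgue_integral) measurable
  then show "(\<lambda>x. LINT t|unit_time. W (x + t *\<^sub>R v)) \<in> borel_measurable borel" by simp
  fix R
  have "integrable (lborel \<Otimes>\<^sub>M unit_time) (\<lambda>(x, t). W (x + t *\<^sub>R v) * of_real (indicator (cball 0 R) x))"
    by (rule integrable_segment_fixed(2)[OF W, of _ 1 R]) (auto simp: indicator_def)
  from space_time.integrable_fst'[OF this]
  show "integrable lborel (\<lambda>x. indicator (cball 0 R) x *\<^sub>R (LINT t|unit_time. W (x + t *\<^sub>R v)))"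
    by (simp add: scaleR_conv_of_real mult.commute)
qed

text \<open>Duality with a test function \<theta>: the translations in the segment mean move over to
  \<theta>, the weak derivative replaces \<open>W\<close> by \<psi> tested against a derivative of
  \<theta>, and the fundamental theorem of calculus for the smooth \<theta> evaluates the mean.
  Equality almost everywhere then comes from \<open>fundamental\<close>.\<close>

lemma weak_dir_increment:
  assumes w: "weak_dir v \<psi> W"
  shows "AE x in lborel. \<psi> (x + v) - \<psi> x = (LINT t|unit_time. W (x + t *\<^sub>R v))"
proof -
  have L: "loc_int \<psi>" "loc_int W" using w by (auto simp: weak_dir_def)
  note [measurable] = L[THEN loc_int_measurable]
  let ?w = "\<lambda>x. LINT t|unit_time. W (x + t *\<^sub>R v)"
  have lw: "loc_int ?w" by (rule loc_int_segment_mean[OF L(2)])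
  have lt: "loc_int (\<lambda>x. \<psi> (x + v) - \<psi> x)" by (intro loc_int_diff loc_int_translate L)
  have "AE x in lborel. \<psi> (x + v) - \<psi> x - ?w x = 0"
  proof (rule fundamental)
    show "loc_int (\<lambda>x. \<psi> (x + v) - \<psi> x - ?w x)" by (intro loc_int_diff lt lw)
    fix \<theta> assume t: "test_function \<theta>"
    then have s: "smooth \<theta>" by (simp add: test_function_iff)
    note [measurable] = test_function_measurable[OF t] test_function_measurable[OF test_function_dir_deriv[OF t]]
    obtain M R where b: "0 < M" "\<And>x. \<bar>\<theta> x\<bar> \<le> M * indicator (cball 0 R) x" using test_function_bounded[OF t] by metis
    obtain M' R' where b': "0 < M'" "\<And>x. \<bar>dir_deriv (- v) \<theta> x\<bar> \<le> M' * indicator (cball 0 R') x"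
      using test_function_bounded[OF test_function_dir_deriv[OF t]] by metis
    have [measurable]: "dir_deriv (- v) \<theta> \<in> borel_measurable borel"
      by (rule test_function_measurable[OF test_function_dir_deriv[OF t]])
    \<comment> \<open>Moving the translation by \<open>t *\<^sub>R v\<close> to \<theta> reverses
      it, so calculus is applied to \<theta> along \<open>- v\<close>. This sign absorbs the one in
      the definition of the weak derivative.\<close>
    have neg: "dir_deriv (- v) \<theta> x = - dir_deriv v \<theta> x" for x
      using dir_deriv_scale[of "-1" v \<theta> x] by simp
    have "(LINT x|lborel. ?w x * of_real (\<theta> x)) = (LINT x|lborel. (LINT t|unit_time. W (x + t *\<^sub>R v) * of_real (\<theta> x)))"
      by simp
    also have "\<dots> = (LINT t|unit_time. (LINT x|lborel. W (x + t *\<^sub>R v) * of_real (\<theta> x)))"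
      by (rule space_time.Fubini_integral[symmetric], rule integrable_segment_fixed(2)[OF L(2), of _ M R]) (use b in auto)
    also have "\<dots> = (LINT t|unit_time. (LINT x|lborel. \<psi> x * of_real (dir_deriv (- v) \<theta> (x - t *\<^sub>R v))))"
    proof (rule Bochner_Integration.integral_cong[OF refl])
      fix t :: real
      have "(LINT x|lborel. W (x + t *\<^sub>R v) * of_real (\<theta> x)) = (LINT x|lborel. W x * of_real (\<theta> (x + (- t *\<^sub>R v))))"
        using integral_translate[of "\<lambda>x. W x * of_real (\<theta> (x + (- t *\<^sub>R v)))" "t *\<^sub>R v"] by simp
      also have "\<dots> = - (LINT x|lborel. \<psi> x * of_real (dir_deriv v (\<lambda>x. \<theta> (x + (- t *\<^sub>R v))) x))"
        using w test_function_translate[OF t, of "- t *\<^sub>R v"] by (simp add: weak_dir_def)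
      also have "\<dots> = (LINT x|lborel. \<psi> x * of_real (dir_deriv (- v) \<theta> (x - t *\<^sub>R v)))"
        by (subst dir_deriv_translate[OF s]) (simp add: neg)
      finally show "(LINT x|lborel. W (x + t *\<^sub>R v) * of_real (\<theta> x)) =
        (LINT x|lborel. \<psi> x * of_real (dir_deriv (- v) \<theta> (x - t *\<^sub>R v)))" .
    qed
    also have "\<dots> = (LINT x|lborel. (LINT t|unit_time. \<psi> x * of_real (dir_deriv (- v) \<theta> (x - t *\<^sub>R v))))"
      by (rule space_time.Fubini_integral, rule integrable_segment_fixed(1)[OF L(1), of "\<lambda>x. of_real (dir_deriv (- v) \<theta> x)" M' R']) (use b' in auto)
    also have "\<dots> = (LINT x|lborel. \<psi> x * of_real (\<theta> (x - v) - \<theta> x))"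
      using smooth_diff_eq_integral[OF s, of _ "- v"] by simp
    also have "\<dots> = (LINT x|lborel. \<psi> x * of_real (\<theta> (x - v))) - (LINT x|lborel. \<psi> x * of_real (\<theta> x))"
      using integrable_loc_int_test[OF L(1) t] integrable_loc_int_test[OF L(1) test_function_translate[OF t, of "- v"]]
      by (simp add: algebra_simps)
    also have "(LINT x|lborel. \<psi> x * of_real (\<theta> (x - v))) = (LINT x|lborel. \<psi> (x + v) * of_real (\<theta> x))"
      using integral_translate[of "\<lambda>x. \<psi> x * of_real (\<theta> (x - v))" v] by simp
    finally have "(LINT x|lborel. ?w x * of_real (\<theta> x)) =
      (LINT x|lborel. \<psi> (x + v) * of_real (\<theta> x)) - (LINT x|lborel. \<psi> x * of_real (\<theta> x))" .
    then show "(LINT x|lborel. (\<psi> (x + v) - \<psi> x - ?w x) * of_real (\<theta> x)) = 0"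
      using integrable_loc_int_test[OF lw t] integrable_loc_int_test[OF L(1) t]
        integrable_loc_int_test[OF loc_int_translate[OF L(1)] t, of v]
      by (simp add: left_diff_distrib)
  qed
  then show ?thesis by eventually_elim simp
qed

lemma weak_dir_scale:
  assumes "weak_dir v \<psi> W" shows "weak_dir (c *\<^sub>R v) \<psi> (\<lambda>x. of_real c * W x)"
  using assms unfolding weak_dir_def
  by (auto simp: dir_deriv_scale loc_int_cmult mult.assoc mult.left_commute[of _ "complex_of_real c"])

lemma weak_dir_test:
  assumes "weak_dir v \<psi> W" "test_function \<phi>"
  shows "(LINT x|lborel. \<psi> x * of_real (dir_deriv v \<phi> x)) = - (LINT x|lborel. W x * of_real (\<phi> x))"
  using assms by (simp add: weak_dir_def)

lemma sq_norm_eq_nn_integral: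
  "sq_int f \<Longrightarrow> ennreal (sq_norm f) = (\<integral>\<^sup>+x. ennreal ((norm (f x))\<^sup>2) \<partial>lborel)"
  unfolding sq_norm_def sq_int_def by (intro nn_integral_eq_integral[symmetric]) auto

text \<open>By Jensen, the squared distance of the segment mean of \<open>W\<close> from
  \<open>b * W\<close> is at most the mean of the squared distances of the translates; Tonelli then
  moves the mean outside the integral over the plane. The factor \<open>b\<close> serves two uses: 0
  bounds the increments of \<psi>, and 1 gives the convergence of difference quotients.\<close>

lemma weak_dir_increment_sq_norm:
  assumes w: "weak_dir v \<psi> W" and \<psi>: "sq_int \<psi>" and W: "sq_int W"
    and C: "\<And>t. t \<in> {0..1} \<Longrightarrow> sq_norm (\<lambda>x. W (x + t *\<^sub>R v) - b * W x) \<le> C"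
  shows "sq_norm (\<lambda>x. \<psi> (x + v) - \<psi> x - b * W x) \<le> C"
proof -
  note [measurable] = sq_int_measurable[OF \<psi>] sq_int_measurable[OF W]
  have s: "sq_int (\<lambda>x. \<psi> (x + v) - \<psi> x - b * W x)"
    by (intro sq_int_diff sq_int_translate sq_int_cmult \<psi> W)
  have s': "sq_int (\<lambda>x. W (x + t *\<^sub>R v) - b * W x)" for t
    by (intro sq_int_diff sq_int_translate sq_int_cmult W)
  have C0: "0 \<le> C" using C[of 0] sq_norm_nonneg[of "\<lambda>x. W (x + 0 *\<^sub>R v) - b * W x"] by simp
  have "ennreal (sq_norm (\<lambda>x. \<psi> (x + v) - \<psi> x - b * W x)) =
      (\<integral>\<^sup>+x. ennreal ((norm (\<psi> (x + v) - \<psi> x - b * W x))\<^sup>2) \<partial>lborel)"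
    by (rule sq_norm_eq_nn_integral[OF s])
  also have "\<dots> \<le> (\<integral>\<^sup>+x. (\<integral>\<^sup>+t. ennreal ((norm (W (x + t *\<^sub>R v) - b * W x))\<^sup>2) \<partial>unit_time) \<partial>lborel)"
  proof (rule nn_integral_mono_AE)
    have "ennreal ((norm ((LINT t|unit_time. W (x + t *\<^sub>R v)) - b * W x))\<^sup>2)
        \<le> (\<integral>\<^sup>+t. ennreal ((norm (W (x + t *\<^sub>R v) - b * W x))\<^sup>2) \<partial>unit_time)" for x
      by (rule unit_time.norm_integral_square_le) measurable
    then show "AE x in lborel. ennreal ((norm (\<psi> (x + v) - \<psi> x - b * W x))\<^sup>2)
        \<le> (\<integral>\<^sup>+t. ennreal ((norm (W (x + t *\<^sub>R v) - b * W x))\<^sup>2) \<partial>unit_time)"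
      using weak_dir_increment[OF w] by (auto elim: eventually_mono)
  qed
  also have "\<dots> = (\<integral>\<^sup>+t. (\<integral>\<^sup>+x. ennreal ((norm (W (x + t *\<^sub>R v) - b * W x))\<^sup>2) \<partial>lborel) \<partial>unit_time)"
    by (rule space_time.Fubini'[symmetric]) measurable
  also have "\<dots> \<le> (\<integral>\<^sup>+t. ennreal C \<partial>unit_time)"
  proof (rule nn_integral_mono_AE)
    show "AE t in unit_time. (\<integral>\<^sup>+x. ennreal ((norm (W (x + t *\<^sub>R v) - b * W x))\<^sup>2) \<partial>lborel) \<le> ennreal C"
      using AE_unit_time
      by (rule eventually_mono) (auto simp flip: sq_norm_eq_nn_integral[OF s'] intro!: ennreal_leI C)
  qed
  also have "\<dots> = ennreal C" by (simp add: unit_time.emeasure_space_1[simplified])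
  finally show ?thesis using C0 by simp
qed

lemma weak_dir_translate_le:
  assumes "weak_dir v \<psi> W" "sq_int \<psi>" "sq_int W"
  shows "sq_norm (\<lambda>x. \<psi> (x + v) - \<psi> x) \<le> sq_norm W"
  using weak_dir_increment_sq_norm[OF assms, of 0 "sq_norm W"] by (simp add: sq_norm_translate[OF assms(3)])

lemma sq_norm_cmult: "sq_norm (\<lambda>x. c * f x) = (norm c)\<^sup>2 * sq_norm f"
  by (simp add: sq_norm_def norm_mult power_mult_distrib)

text \<open>The sequential statement in terms of a radius, because all points of a segment have to
  be controlled at once.\<close>

lemma translate_L2_uniform:
  assumes f: "sq_int f" and e: "0 < e"
  obtains d where "0 < d" "\<And>v. norm v < d \<Longrightarrow> sq_norm (\<lambda>x. f (x + v) - f x) < e"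
proof -
  have "isCont (\<lambda>v. sq_norm (\<lambda>x. f (x + v) - f x)) 0"
    unfolding continuous_at_sequentially o_def
    using translate_L2[OF f] by (auto simp: sq_norm_def)
  then obtain d where "0 < d" "\<And>v. norm v < d \<Longrightarrow> \<bar>sq_norm (\<lambda>x. f (x + v) - f x)\<bar> < e"
    using e unfolding continuous_at_eps_delta by (auto simp: dist_norm sq_norm_def)
  then show ?thesis by (intro that) (auto simp: abs_of_nonneg sq_norm_nonneg)
qed

lemma difference_quotient_tendsto:
  assumes w: "weak_dir v \<psi> W" and \<psi>: "sq_int \<psi>" and W: "sq_int W"
    and h: "h \<longlonglongrightarrow> 0" "\<And>n. h n \<noteq> (0::real)"
  shows "(\<lambda>n. sq_norm (\<lambda>x. (\<psi> (x + h n *\<^sub>R v) - \<psi> x) / of_real (h n) - W x)) \<longlonglongrightarrow> 0"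
proof (rule LIMSEQ_I)
  fix e :: real assume e: "0 < e"
  then have e2: "0 < e / 2" by simp
  obtain d where d: "0 < d" "\<And>u. norm u < d \<Longrightarrow> sq_norm (\<lambda>x. W (x + u) - W x) < e / 2"
    using translate_L2_uniform[OF W e2] by blast
  have "(\<lambda>n. norm (h n *\<^sub>R v)) \<longlonglongrightarrow> norm (0 *\<^sub>R v)"
    by (intro tendsto_intros h)
  then have "\<forall>\<^sub>F n in sequentially. norm (h n *\<^sub>R v) < d"
    using d(1) by (intro order_tendstoD(2)) auto
  then obtain N where N: "\<And>n. n \<ge> N \<Longrightarrow> norm (h n *\<^sub>R v) < d"
    by (auto simp: eventually_sequentially)
  have "sq_norm (\<lambda>x. (\<psi> (x + h n *\<^sub>R v) - \<psi> x) / of_real (h n) - W x) < e" if n: "n \<ge> N" for n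
  proof -
    let ?H = "of_real (h n) :: complex"
    \<comment> \<open>The weak derivative along \<open>h n *\<^sub>R v\<close> is \<open>h n\<close>
      times \<open>W\<close>, and every point of the segment is a translation by less than
      \<open>d\<close>. Division by \<open>(h n)\<^sup>2\<close> afterwards leaves
      \<open>e / 2\<close>.\<close>
    have "sq_norm (\<lambda>x. \<psi> (x + h n *\<^sub>R v) - \<psi> x - 1 * (?H * W x)) \<le> (h n)\<^sup>2 * (e / 2)"
    proof (rule weak_dir_increment_sq_norm[OF weak_dir_scale[OF w] \<psi> sq_int_cmult[OF W]])
      fix t :: real assume t: "t \<in> {0..1}"
      have "\<bar>t * h n\<bar> \<le> \<bar>h n\<bar>" using t by (auto simp: abs_mult intro: mult_left_le_one_le)
      then have "norm (t *\<^sub>R h n *\<^sub>R v) \<le> norm (h n *\<^sub>R v)" by (simp add: mult_right_mono)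
      then have "sq_norm (\<lambda>x. W (x + t *\<^sub>R h n *\<^sub>R v) - W x) \<le> e / 2"
        using d(2)[of "t *\<^sub>R h n *\<^sub>R v"] N[OF n] by linarith
      then have "sq_norm (\<lambda>x. ?H * (W (x + t *\<^sub>R h n *\<^sub>R v) - W x)) \<le> (h n)\<^sup>2 * (e / 2)"
        using mult_left_mono[OF _ zero_le_power2[of "h n"]] by (simp only: sq_norm_cmult norm_of_real power2_abs)
      then show "sq_norm (\<lambda>x. ?H * W (x + t *\<^sub>R h n *\<^sub>R v) - 1 * (?H * W x)) \<le> (h n)\<^sup>2 * (e / 2)"
        by (simp add: right_diff_distrib)
    qed
    moreover have "(\<lambda>x. \<psi> (x + h n *\<^sub>R v) - \<psi> x - 1 * (?H * W x)) =
      (\<lambda>x. ?H * ((\<psi> (x + h n *\<^sub>R v) - \<psi> x) / ?H - W x))"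
      using h(2)[of n] by (auto simp: field_simps)
    ultimately have "(h n)\<^sup>2 * sq_norm (\<lambda>x. (\<psi> (x + h n *\<^sub>R v) - \<psi> x) / ?H - W x) \<le> (h n)\<^sup>2 * (e / 2)"
      by (simp only: sq_norm_cmult) simp
    then show ?thesis using h(2)[of n] e by simp
  qed
  then show "\<exists>N. \<forall>n\<ge>N. norm (sq_norm (\<lambda>x. (\<psi> (x + h n *\<^sub>R v) - \<psi> x) / of_real (h n) - W x) - 0) < e"
    by (auto simp: abs_of_nonneg sq_norm_nonneg)
qed

section \<open>Calculus of weak derivatives\<close>

lemma loc_int_const: "loc_int (\<lambda>x. c)"
proof -
  have "loc_int (\<lambda>x. 1)"
    unfolding loc_int_def
    by (auto simp: scaleR_conv_of_real integrable_indicator_iff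
        intro!: integrable_of_real emeasure_bounded_finite[OF bounded_cball, unfolded infinity_ennreal_def])
  from loc_int_cmult[OF this, of c] show ?thesis by simp
qed

lemma sq_int_test:
  assumes t: "test_function \<phi>" shows "sq_int (\<lambda>x. of_real (\<phi> x))"
proof -
  note [measurable] = test_function_measurable[OF t]
  have "smooth \<phi>" using t by (simp add: test_function_iff)
  from integrable_loc_int_test[OF loc_int_const test_function_mult[OF this t], of 1]
  have "integrable lborel (\<lambda>x. Re (of_real (\<phi> x * \<phi> x)))" by (intro integrable_Re) simp
  then show ?thesis by (simp add: sq_int_def power2_eq_square)
qed

text \<open>By translation invariance the integral equals its mean over the translates along a
  segment. After exchanging the integrals, the fundamental theorem of calculus on the segment leaves
  the integral of a translate of \<phi> minus that of \<phi>, which is 0.\<close>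

lemma integral_dir_deriv_eq_0:
  assumes t: "test_function \<phi>" shows "(LINT x|lborel. complex_of_real (dir_deriv v \<phi> x)) = 0"
proof -
  have s: "smooth \<phi>" using t by (simp add: test_function_iff)
  note one = loc_int_const[of 1]
  note it = integrable_loc_int_test[OF one, simplified]
  note t' = test_function_dir_deriv[OF t, of "- v"]
  note [measurable] = test_function_measurable[OF t] test_function_measurable[OF t']
  obtain M R where b: "0 < M" "\<And>x. \<bar>dir_deriv (- v) \<phi> x\<bar> \<le> M * indicator (cball 0 R) x"
    using test_function_bounded[OF t'] by metis
  have "(LINT x|lborel. complex_of_real (dir_deriv (- v) \<phi> x)) =
     (LINT t|unit_time. (LINT x|lborel. complex_of_real (dir_deriv (- v) \<phi> x)))"
    using unit_time.prob_space[simplified] by simp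
  also have "\<dots> = (LINT t|unit_time. (LINT x|lborel. 1 * complex_of_real (dir_deriv (- v) \<phi> (x - t *\<^sub>R v))))"
  proof (rule Bochner_Integration.integral_cong[OF refl])
    fix t :: real
    show "(LINT x|lborel. complex_of_real (dir_deriv (- v) \<phi> x)) = (LINT x|lborel. 1 * complex_of_real (dir_deriv (- v) \<phi> (x - t *\<^sub>R v)))"
      using integral_translate[of "\<lambda>x. complex_of_real (dir_deriv (- v) \<phi> x)" "- t *\<^sub>R v"] by simp
  qed
  also have "\<dots> = (LINT x|lborel. (LINT t|unit_time. 1 * complex_of_real (dir_deriv (- v) \<phi> (x - t *\<^sub>R v))))"
    by (rule space_time.Fubini_integral, rule integrable_segment_fixed(1)[OF one, of "\<lambda>x. of_real (dir_deriv (- v) \<phi> x)" M R]) (use b in auto)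
  also have "\<dots> = (LINT x|lborel. complex_of_real (\<phi> (x + - v)) - complex_of_real (\<phi> x))"
    using smooth_diff_eq_integral[OF s, of _ "- v"] by (simp flip: of_real_diff)
  also have "\<dots> = (LINT x|lborel. complex_of_real (\<phi> (x + - v))) - (LINT x|lborel. complex_of_real (\<phi> x))"
    by (rule Bochner_Integration.integral_diff[OF it[OF test_function_translate[OF t]] it[OF t]])
  also have "\<dots> = 0"
    using integral_translate[of "\<lambda>x. complex_of_real (\<phi> x)" "- v"] by simp
  finally have z: "(LINT x|lborel. complex_of_real (dir_deriv (- v) \<phi> x)) = 0" .
  have "dir_deriv (- v) \<phi> x = - dir_deriv v \<phi> x" for x using dir_deriv_scale[of "-1" v \<phi> x] by simp
  with z have "(LINT x|lborel. - complex_of_real (dir_deriv v \<phi> x)) = 0" by (simp only: of_real_minus)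
  then show ?thesis by (simp only: Bochner_Integration.integral_minus) simp
qed

lemma loc_int_continuous: "continuous_on UNIV f \<Longrightarrow> loc_int f"
  using loc_int_mult_continuous[OF loc_int_const[of 1]] by simp

lemma loc_int_smooth: "smooth a \<Longrightarrow> loc_int (\<lambda>x. of_real (a x))"
  by (intro loc_int_continuous continuous_intros smooth_continuous)

lemma dir_deriv_mult:
  "smooth f \<Longrightarrow> smooth g \<Longrightarrow> dir_deriv v (\<lambda>x. f x * g x) x = dir_deriv v f x * g x + f x * dir_deriv v g x"
  by (simp add: dir_deriv_def partial_mult smooth_differentiable sum_2 algebra_simps)

lemma weak_dir_smooth:
  assumes s: "smooth a" shows "weak_dir v (\<lambda>x. of_real (a x)) (\<lambda>x. of_real (dir_deriv v a x))"
  unfolding weak_dir_def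
proof (intro conjI allI impI loc_int_smooth s smooth_dir_deriv)
  fix \<theta> assume t: "test_function \<theta>"
  then have s': "smooth \<theta>" by (simp add: test_function_iff)
  note i = integrable_loc_int_test[OF loc_int_smooth[OF s] test_function_dir_deriv[OF t], of v]
    integrable_loc_int_test[OF loc_int_smooth[OF smooth_dir_deriv[OF s]] t, of v]
  have "0 = (LINT x|lborel. complex_of_real (dir_deriv v (\<lambda>x. a x * \<theta> x) x))"
    by (rule integral_dir_deriv_eq_0[symmetric]) (intro test_function_mult s t)
  also have "\<dots> = (LINT x|lborel. of_real (dir_deriv v a x) * of_real (\<theta> x) + of_real (a x) * of_real (dir_deriv v \<theta> x))"
    by (simp add: dir_deriv_mult[OF s s'])
  also have "\<dots> = (LINT x|lborel. of_real (dir_deriv v a x) * of_real (\<theta> x)) + (LINT x|lborel. of_real (a x) * of_real (dir_deriv v \<theta> x))"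
    by (rule Bochner_Integration.integral_add[OF i(2,1)])
  finally show "(LINT x|lborel. complex_of_real (a x) * of_real (dir_deriv v \<theta> x)) = - (LINT x|lborel. of_real (dir_deriv v a x) * of_real (\<theta> x))"
    by (simp add: add_eq_0_iff)
qed

lemma loc_int_mult_smooth: "loc_int f \<Longrightarrow> smooth a \<Longrightarrow> loc_int (\<lambda>x. f x * of_real (a x))"
  by (intro loc_int_mult_continuous continuous_intros smooth_continuous)

text \<open>The product \<open>a * \<phi>\<close> is again a test function; testing the derivative
  of \<psi> with it and expanding by the classical product rule gives the Leibniz formula.\<close>

lemma weak_dir_mult_smooth:
  assumes w: "weak_dir v \<psi> W" and s: "smooth a"
  shows "weak_dir v (\<lambda>x. \<psi> x * of_real (a x)) (\<lambda>x. W x * of_real (a x) + \<psi> x * of_real (dir_deriv v a x))"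
  unfolding weak_dir_def
proof (intro conjI allI impI)
  have L: "loc_int \<psi>" "loc_int W" using w by (auto simp: weak_dir_def)
  show l1: "loc_int (\<lambda>x. \<psi> x * of_real (a x))"
    "loc_int (\<lambda>x. W x * of_real (a x) + \<psi> x * of_real (dir_deriv v a x))"
    by (intro loc_int_add loc_int_mult_smooth L s smooth_dir_deriv)+
  fix \<phi> assume t: "test_function \<phi>"
  then have s': "smooth \<phi>" by (simp add: test_function_iff)
  have i: "integrable lborel (\<lambda>x. \<psi> x * of_real (a x) * of_real (dir_deriv v \<phi> x))"
    "integrable lborel (\<lambda>x. W x * of_real (a x) * of_real (\<phi> x))"
    "integrable lborel (\<lambda>x. \<psi> x * of_real (dir_deriv v a x) * of_real (\<phi> x))"
    by (intro integrable_loc_int_test loc_int_mult_smooth L s smooth_dir_deriv test_function_dir_deriv t)+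
  have "(LINT x|lborel. \<psi> x * of_real (a x) * of_real (dir_deriv v \<phi> x)) +
      (LINT x|lborel. \<psi> x * of_real (dir_deriv v a x) * of_real (\<phi> x)) =
      (LINT x|lborel. \<psi> x * of_real (dir_deriv v (\<lambda>x. a x * \<phi> x) x))"
    unfolding dir_deriv_mult[OF s s'] using i
    by (subst Bochner_Integration.integral_add[symmetric]) (auto simp: algebra_simps)
  also have "\<dots> = - (LINT x|lborel. W x * of_real (a x) * of_real (\<phi> x))"
    using weak_dir_test[OF w test_function_mult[OF s t]] by (simp add: mult.assoc)
  finally have e: "(LINT x|lborel. \<psi> x * of_real (a x) * of_real (dir_deriv v \<phi> x)) +
      (LINT x|lborel. \<psi> x * of_real (dir_deriv v a x) * of_real (\<phi> x)) = - (LINT x|lborel. W x * of_real (a x) * of_real (\<phi> x))" .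
  have "(LINT x|lborel. (W x * of_real (a x) + \<psi> x * of_real (dir_deriv v a x)) * of_real (\<phi> x)) =
    (LINT x|lborel. W x * of_real (a x) * of_real (\<phi> x)) + (LINT x|lborel. \<psi> x * of_real (dir_deriv v a x) * of_real (\<phi> x))"
    using i by (simp add: distrib_right)
  with e show "(LINT x|lborel. \<psi> x * of_real (a x) * of_real (dir_deriv v \<phi> x)) =
    - (LINT x|lborel. (W x * of_real (a x) + \<psi> x * of_real (dir_deriv v a x)) * of_real (\<phi> x))"
    by (simp only: eq_diff_eq minus_add_distrib diff_conv_add_uminus[symmetric])
qed

lemma loc_int_cnj: "loc_int f \<Longrightarrow> loc_int (\<lambda>x. cnj (f x))"
  by (rule loc_int_bound[of f]) (auto dest: loc_int_measurable)

lemma weak_dir_cnj: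
  assumes "weak_dir v \<psi> W" shows "weak_dir v (\<lambda>x. cnj (\<psi> x)) (\<lambda>x. cnj (W x))"
  unfolding weak_dir_def
proof (intro conjI allI impI)
  show "loc_int (\<lambda>x. cnj (\<psi> x))" "loc_int (\<lambda>x. cnj (W x))"
    using assms by (auto simp: weak_dir_def intro: loc_int_cnj)
  fix \<phi> assume "test_function \<phi>"
  from arg_cong[OF weak_dir_test[OF assms this], of cnj]
  show "(LINT x|lborel. cnj (\<psi> x) * of_real (dir_deriv v \<phi> x)) = - (LINT x|lborel. cnj (W x) * of_real (\<phi> x))"
    using Bochner_Integration.integral_cnj[of lborel "\<lambda>x. \<psi> x * of_real (dir_deriv v \<phi> x)"]
      Bochner_Integration.integral_cnj[of lborel "\<lambda>x. W x * of_real (\<phi> x)"] by simp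
qed

section \<open>Difference quotients and integration by parts\<close>

definition diff_quot :: "real \<Rightarrow> real^2 \<Rightarrow> (real^2 \<Rightarrow> complex) \<Rightarrow> real^2 \<Rightarrow> complex" where
  "diff_quot h v f x = (f (x + h *\<^sub>R v) - f x) / of_real h"

lemma sq_int_diff_quot: "sq_int f \<Longrightarrow> sq_int (diff_quot h v f)"
  using sq_int_cmult[OF sq_int_diff[OF sq_int_translate], of f f "1 / of_real h" "h *\<^sub>R v"]
  by (simp add: diff_quot_def[abs_def])

text \<open>Discrete integration by parts: translation invariance moves the shift to the other
  factor, so the transpose of a quotient is the negative of the quotient with reversed step.\<close>

lemma integral_diff_quot_mult:
  assumes u: "sq_int u" and w: "sq_int w"
  shows "(LINT x|lborel. diff_quot h v u x * w x) = - (LINT x|lborel. u x * diff_quot (- h) v w x)"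
proof -
  note [measurable] = u[THEN sq_int_measurable] w[THEN sq_int_measurable]
  note i = integrable_sq_int_mult[OF sq_int_translate[OF u] w, of "h *\<^sub>R v"]
    integrable_sq_int_mult[OF u sq_int_translate[OF w], of "- h *\<^sub>R v"]
    integrable_sq_int_mult[OF u w]
  have "(LINT x|lborel. diff_quot h v u x * w x) = (LINT x|lborel. (u (x + h *\<^sub>R v) * w x - u x * w x) / of_real h)"
    by (simp add: diff_quot_def algebra_simps)
  also have "\<dots> = ((LINT x|lborel. u (x + h *\<^sub>R v) * w x) - (LINT x|lborel. u x * w x)) / of_real h"
    using i by simp
  also have "(LINT x|lborel. u (x + h *\<^sub>R v) * w x) = (LINT x|lborel. u x * w (x + (- h *\<^sub>R v)))"
    using integral_translate[of "\<lambda>x. u x * w (x + (- h *\<^sub>R v))" "h *\<^sub>R v"] by simp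
  also have "((LINT x|lborel. u x * w (x + (- h *\<^sub>R v))) - (LINT x|lborel. u x * w x)) / of_real h =
      (LINT x|lborel. (u x * w (x + (- h *\<^sub>R v)) - u x * w x) / of_real h)"
    using i by simp
  also have "\<dots> = (LINT x|lborel. - (u x * diff_quot (- h) v w x))"
    by (intro Bochner_Integration.integral_cong refl) (simp add: diff_quot_def right_diff_distrib)
  finally show ?thesis by simp
qed

definition step :: "nat \<Rightarrow> real" where
  "step n = 1 / real (Suc n)"

lemma step: "step \<longlonglongrightarrow> 0" "0 < step n"
  using LIMSEQ_inverse_real_of_nat by (simp_all add: step_def[abs_def] inverse_eq_divide del: of_nat_Suc) 

lemma diff_quot_tendsto:
  assumes "weak_dir v \<psi> W" "sq_int \<psi>" "sq_int W"
  shows "(\<lambda>n. sq_norm (\<lambda>x. diff_quot (step n) v \<psi> x - W x)) \<longlonglongrightarrow> 0"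
    and "(\<lambda>n. sq_norm (\<lambda>x. diff_quot (- step n) v \<psi> x - W x)) \<longlonglongrightarrow> 0"
proof -
  have "step n \<noteq> 0" for n using step(2)[of n] by simp
  with step(1) show "(\<lambda>n. sq_norm (\<lambda>x. diff_quot (step n) v \<psi> x - W x)) \<longlonglongrightarrow> 0"
    and "(\<lambda>n. sq_norm (\<lambda>x. diff_quot (- step n) v \<psi> x - W x)) \<longlonglongrightarrow> 0"
    using difference_quotient_tendsto[OF assms, of step] difference_quotient_tendsto[OF assms, of "\<lambda>n. - step n"]
      tendsto_minus[OF step(1)]
    by (simp_all add: diff_quot_def)
qed

lemma weak_dir_by_parts:
  assumes u: "weak_dir v u U" "sq_int u" "sq_int U" and w: "weak_dir v w W" "sq_int w" "sq_int W"
  shows "(LINT x|lborel. U x * w x) = - (LINT x|lborel. u x * W x)"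
proof (rule LIMSEQ_unique)
  have z: "(\<lambda>n. sq_norm (\<lambda>x. f x - f x)) \<longlonglongrightarrow> 0" for f by (simp add: sq_norm_def)
  show "(\<lambda>n. LINT x|lborel. diff_quot (step n) v u x * w x) \<longlonglongrightarrow> (LINT x|lborel. U x * w x)"
    by (intro tendsto_integral_sq_int_mult sq_int_diff_quot u w diff_quot_tendsto z)
  show "(\<lambda>n. LINT x|lborel. diff_quot (step n) v u x * w x) \<longlonglongrightarrow> - (LINT x|lborel. u x * W x)"
    unfolding integral_diff_quot_mult[OF u(2) w(2)]
    by (intro tendsto_minus tendsto_integral_sq_int_mult sq_int_diff_quot u w diff_quot_tendsto z)
qed

text \<open>The symmetry of mixed second derivatives in a form that mentions only first derivatives.
  Difference quotients commute exactly, so two discrete integrations by parts interchange the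
  directions \<open>a\<close> and \<open>b\<close> at the price of reversing both steps, which is
  harmless since both signs of the step have the same limit.\<close>

lemma weak_dir_commute:
  assumes u: "weak_dir a u U1" "weak_dir b u U2" "sq_int u" "sq_int U1" "sq_int U2"
    and w: "weak_dir a w W1" "weak_dir b w W2" "sq_int w" "sq_int W1" "sq_int W2"
  shows "(LINT x|lborel. W1 x * U2 x) = (LINT x|lborel. W2 x * U1 x)"
proof (rule LIMSEQ_unique)
  note [measurable] = u(3)[THEN sq_int_measurable] w(3)[THEN sq_int_measurable]
  show "(\<lambda>n. LINT x|lborel. diff_quot (step n) a w x * diff_quot (step n) b u x) \<longlonglongrightarrow> (LINT x|lborel. W1 x * U2 x)"
    by (intro tendsto_integral_sq_int_mult sq_int_diff_quot u w diff_quot_tendsto(1)[OF u(2)] diff_quot_tendsto(1)[OF w(1)])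
  have "(LINT x|lborel. diff_quot h a w x * diff_quot h b u x) = (LINT x|lborel. diff_quot (- h) b w x * diff_quot (- h) a u x)" for h
  proof -
    have c: "diff_quot (- h) a (diff_quot h b u) x = diff_quot h b (diff_quot (- h) a u) x" for x
      by (simp add: diff_quot_def add_ac diff_divide_distrib algebra_simps)
    have "(LINT x|lborel. diff_quot h a w x * diff_quot h b u x) = - (LINT x|lborel. w x * diff_quot (- h) a (diff_quot h b u) x)"
      by (rule integral_diff_quot_mult[OF w(3) sq_int_diff_quot[OF u(3)]])
    also have "\<dots> = (LINT x|lborel. diff_quot (- h) b w x * diff_quot (- h) a u x)"
      using integral_diff_quot_mult[OF w(3) sq_int_diff_quot[OF u(3)], of "- h" b "- h" a] by (simp add: c)
    finally show ?thesis .
  qed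
  then show "(\<lambda>n. LINT x|lborel. diff_quot (step n) a w x * diff_quot (step n) b u x) \<longlonglongrightarrow> (LINT x|lborel. W2 x * U1 x)"
    by simp (intro tendsto_integral_sq_int_mult sq_int_diff_quot u w diff_quot_tendsto(2)[OF u(1)] diff_quot_tendsto(2)[OF w(2)])
qed

text \<open>Rationalise: the difference of the squared norms is
  \<open>4 * h n * Re (cnj z * w)\<close>, and the sum of the norms tends to
  \<open>2 * norm z\<close>. For \<open>z = 0\<close> the two norms agree, and the limit is 0 by the
  convention for division by 0.\<close>

lemma norm_symmetric_quotient_tendsto:
  fixes z w :: complex
  assumes h: "h \<longlonglongrightarrow> 0" "\<And>n. 0 < h n"
  shows "(\<lambda>n. (norm (z + of_real (h n) * w) - norm (z - of_real (h n) * w)) / h n) \<longlonglongrightarrow> 2 * (Re (cnj z * w) / norm z)"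
proof (cases "z = 0")
  case False
  have "(\<lambda>n. 4 * Re (cnj z * w) / (norm (z + of_real (h n) * w) + norm (z - of_real (h n) * w)))
     \<longlonglongrightarrow> 4 * Re (cnj z * w) / (norm (z + of_real 0 * w) + norm (z - of_real 0 * w))"
    using False by (intro tendsto_intros h) auto
  moreover have "4 * Re (cnj z * w) / (norm (z + of_real (h n) * w) + norm (z - of_real (h n) * w)) =
      (norm (z + of_real (h n) * w) - norm (z - of_real (h n) * w)) / h n" for n
  proof -
    let ?a = "z + of_real (h n) * w" and ?b = "z - of_real (h n) * w"
    have "?a + ?b \<noteq> 0" using False by simp
    then have "0 < norm ?a + norm ?b" using norm_triangle_ineq[of ?a ?b] by (smt (verit) zero_less_norm_iff)
    moreover have "(norm ?a)\<^sup>2 - (norm ?b)\<^sup>2 = 4 * h n * Re (cnj z * w)"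
      unfolding cmod_power2 by (simp add: power2_eq_square algebra_simps)
    moreover have "(norm ?a)\<^sup>2 - (norm ?b)\<^sup>2 = (norm ?a - norm ?b) * (norm ?a + norm ?b)"
      by (simp only: power2_eq_square square_diff_square_factored mult.commute)
    ultimately show ?thesis using h(2)[of n] by (simp add: field_simps)
  qed
  moreover have "4 * r / (norm (z + of_real 0 * w) + norm (z - of_real 0 * w)) = 2 * (r / norm z)" for r
    by simp
  ultimately show ?thesis by (simp only:)
qed simp

text \<open>
  The symmetric difference quotient of \<open>|\<psi>|\<close> is compared with that of \<open>t \<mapsto> |\<psi> x + t W x|\<close> at
  \<open>t = 0\<close>, which converges to \<open>2 Re (cnj \<psi> W) / |\<psi>|\<close>, and to \<open>0\<close> (the value of \<open>x / 0\<close>) where \<open>\<psi>\<close>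
  vanishes; a one-sided quotient would leave \<open>|W|\<close> there.
\<close>
lemma weak_dir_norm:
  assumes w: "weak_dir v \<psi> W" and \<psi>: "sq_int \<psi>" and W: "sq_int W"
    and t: "test_function \<phi>"
  shows "(LINT x|lborel. of_real (norm (\<psi> x)) * of_real (dir_deriv v \<phi> x)) =
     - (LINT x|lborel. of_real (Re (cnj (\<psi> x) * W x) / norm (\<psi> x)) * complex_of_real (\<phi> x))"
proof -
  note [measurable] = \<psi>[THEN sq_int_measurable] W[THEN sq_int_measurable] test_function_measurable[OF t]
  have s: "smooth \<phi>" using t by (simp add: test_function_iff)
  let ?N = "\<lambda>x. complex_of_real (norm (\<psi> x))" and ?\<phi> = "\<lambda>x. complex_of_real (\<phi> x)"
    and ?g = "\<lambda>x. Re (cnj (\<psi> x) * W x) / norm (\<psi> x)"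
  let ?q = "\<lambda>n x. complex_of_real ((norm (\<psi> x + of_real (step n) * W x) - norm (\<psi> x - of_real (step n) * W x)) / step n)"
  \<comment> \<open>The quotients with steps \<open>h\<close> and \<open>- h\<close> add up to the
    increment of the modulus from \<open>x - h v\<close> to \<open>x + h v\<close> divided by
    \<open>h\<close>. This is twice the symmetric quotient, whence the factors 2 below.\<close>
  let ?s = "\<lambda>n x. diff_quot (step n) v ?N x + diff_quot (- step n) v ?N x"
  have N: "sq_int ?N" by (rule sq_int_bound[OF \<psi>, of _ 1]) auto
  have p: "sq_int ?\<phi>" "sq_int (\<lambda>x. of_real (dir_deriv v \<phi> x))"
    by (intro sq_int_test t test_function_dir_deriv)+
  note dp = diff_quot_tendsto[OF weak_dir_smooth[OF s] p]
  have z: "(\<lambda>n. sq_norm (\<lambda>x. f x - f x)) \<longlonglongrightarrow> 0" for f by (simp add: sq_norm_def)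
  note dq = sq_int_diff_quot
  have q2: "norm (?q n x) \<le> 2 * norm (W x)" for n x
  proof -
    have "\<bar>norm (\<psi> x + of_real (step n) * W x) - norm (\<psi> x - of_real (step n) * W x)\<bar> \<le> norm (2 * of_real (step n) * W x)"
      using norm_triangle_ineq3[of "\<psi> x + of_real (step n) * W x" "\<psi> x - of_real (step n) * W x"] by (simp add: algebra_simps)
    also have "\<dots> = step n * (2 * norm (W x))" using step(2)[of n] by (simp add: norm_mult)
    finally have "\<bar>norm (\<psi> x + of_real (step n) * W x) - norm (\<psi> x - of_real (step n) * W x)\<bar> / step n \<le> 2 * norm (W x)"
      using step(2)[of n] by (simp add: field_simps)
    then show ?thesis using step(2)[of n] by (simp only: norm_of_real abs_divide abs_of_pos)
  qed
  have qs: "sq_int (?q n)" for n by (rule sq_int_bound[OF W, of _ 2]) (use q2 in auto)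
  let ?a = "\<lambda>n x. complex_of_real (norm (diff_quot (step n) v \<psi> x - W x))"
    and ?b = "\<lambda>n x. complex_of_real (norm (diff_quot (- step n) v \<psi> x - W x))"
  have ab: "sq_int (?a n)" "sq_int (?b n)" for n
    by (rule sq_int_bound[OF sq_int_diff[OF dq[OF \<psi>] W], of _ 1], use sq_int_measurable[OF dq[OF \<psi>]] in auto)+
  \<comment> \<open>By the reverse triangle inequality, replacing \<psi> at \<open>x + h v\<close>
    and \<open>x - h v\<close> by its linearisation at \<open>x\<close> costs at most the errors of
    the two difference quotients of \<psi>, and these tend to 0 in the square norm.\<close>
  have r: "sq_norm (\<lambda>x. ?s n x - ?q n x) \<le>
      2 * sq_norm (\<lambda>x. diff_quot (step n) v \<psi> x - W x) + 2 * sq_norm (\<lambda>x. diff_quot (- step n) v \<psi> x - W x)" for n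
  proof -
    have "norm (?s n x - ?q n x) \<le> norm (diff_quot (step n) v \<psi> x - W x) + norm (diff_quot (- step n) v \<psi> x - W x)" for x
    proof -
      let ?h = "step n" let ?c = "complex_of_real ?h"
      note h = step(2)[of n]
      have e: "?s n x - ?q n x = of_real (((norm (\<psi> (x + ?h *\<^sub>R v)) - norm (\<psi> x + ?c * W x)) - (norm (\<psi> (x - ?h *\<^sub>R v)) - norm (\<psi> x - ?c * W x))) / ?h)"
        using h by (simp add: diff_quot_def field_simps)
      have "norm (?s n x - ?q n x) = \<bar>(norm (\<psi> (x + ?h *\<^sub>R v)) - norm (\<psi> x + ?c * W x)) - (norm (\<psi> (x - ?h *\<^sub>R v)) - norm (\<psi> x - ?c * W x))\<bar> / ?h"
        unfolding e using h by (simp only: norm_of_real abs_divide)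
      also have "\<dots> \<le> (norm (\<psi> (x + ?h *\<^sub>R v) - (\<psi> x + ?c * W x)) + norm (\<psi> (x - ?h *\<^sub>R v) - (\<psi> x - ?c * W x))) / ?h"
        using norm_triangle_ineq3[of "\<psi> (x + ?h *\<^sub>R v)" "\<psi> x + ?c * W x"] norm_triangle_ineq3[of "\<psi> (x - ?h *\<^sub>R v)" "\<psi> x - ?c * W x"] h
        by (intro divide_right_mono) auto
      also have "\<dots> = norm ((\<psi> (x + ?h *\<^sub>R v) - (\<psi> x + ?c * W x)) / ?c) + norm ((\<psi> (x - ?h *\<^sub>R v) - (\<psi> x - ?c * W x)) / - ?c)"
        using h by (simp add: norm_divide add_divide_distrib)
      also have "\<dots> = norm (diff_quot ?h v \<psi> x - W x) + norm (diff_quot (- ?h) v \<psi> x - W x)"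
      proof -
        have "(\<psi> (x + ?h *\<^sub>R v) - (\<psi> x + ?c * W x)) / ?c = diff_quot ?h v \<psi> x - W x"
          "(\<psi> (x - ?h *\<^sub>R v) - (\<psi> x - ?c * W x)) / - ?c = diff_quot (- ?h) v \<psi> x - W x"
          using h by (simp_all add: diff_quot_def field_simps)
        then show ?thesis by (simp only:)
      qed
      finally show ?thesis .
    qed
    then have "sq_norm (\<lambda>x. ?s n x - ?q n x) \<le> sq_norm (\<lambda>x. ?a n x + ?b n x)"
      unfolding sq_norm_def
      by (intro integral_mono) (use sq_int_diff[OF sq_int_add[OF dq[OF N] dq[OF N]] qs] sq_int_add[OF ab] in
          \<open>auto simp: sq_int_def simp flip: of_real_add intro: power_mono\<close>)
    also have "\<dots> \<le> 2 * sq_norm (?a n) + 2 * sq_norm (?b n)" by (rule sq_norm_add_le[OF ab])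
    finally show ?thesis by (simp add: sq_norm_def)
  qed
  have "(\<lambda>n. sq_norm (\<lambda>x. ?s n x - ?q n x - 0)) \<longlonglongrightarrow> 0"
  proof (rule Lim_null_comparison)
    show "(\<lambda>n. 2 * sq_norm (\<lambda>x. diff_quot (step n) v \<psi> x - W x) + 2 * sq_norm (\<lambda>x. diff_quot (- step n) v \<psi> x - W x)) \<longlonglongrightarrow> 0"
      by (intro tendsto_add_zero tendsto_mult_right_zero diff_quot_tendsto[OF w \<psi> W])
  qed (use r in \<open>auto simp: sq_norm_nonneg\<close>)
  then have "(\<lambda>n. LINT x|lborel. (?s n x - ?q n x) * ?\<phi> x) \<longlonglongrightarrow> (LINT x|lborel. 0 * ?\<phi> x)"
    by (intro tendsto_integral_sq_int_mult z p sq_int_diff sq_int_add dq N qs) (auto simp: sq_int_def)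
  then have l1: "(\<lambda>n. LINT x|lborel. (?s n x - ?q n x) * ?\<phi> x) \<longlonglongrightarrow> 0" by simp
  \<comment> \<open>The linearised quotients converge pointwise, so the limit is taken after pairing
    with \<phi>, by domination through \<open>q2\<close>.\<close>
  have l2: "(\<lambda>n. LINT x|lborel. ?q n x * ?\<phi> x) \<longlonglongrightarrow> (LINT x|lborel. of_real (2 * ?g x) * ?\<phi> x)"
  proof (rule integral_dominated_convergence[where w="\<lambda>x. norm (2 * W x * ?\<phi> x)"])
    show "integrable lborel (\<lambda>x. norm (2 * W x * ?\<phi> x))"
      by (intro integrable_norm integrable_sq_int_mult sq_int_cmult W p)
    show "AE x in lborel. (\<lambda>n. ?q n x * ?\<phi> x) \<longlonglongrightarrow> of_real (2 * ?g x) * ?\<phi> x"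
      by (intro AE_I2 tendsto_mult tendsto_const tendsto_of_real norm_symmetric_quotient_tendsto step)
    show "AE x in lborel. norm (?q n x * ?\<phi> x) \<le> norm (2 * W x * ?\<phi> x)" for n
      by (intro AE_I2) (simp only: norm_mult norm_numeral, intro mult_right_mono norm_ge_zero q2)
    show "(\<lambda>x. of_real (2 * ?g x) * ?\<phi> x) \<in> borel_measurable lborel" by measurable
    show "(\<lambda>x. ?q n x * ?\<phi> x) \<in> borel_measurable lborel" for n
      using sq_int_measurable[OF qs] by simp
  qed
  have "(\<lambda>n. - (LINT x|lborel. ?s n x * ?\<phi> x)) \<longlonglongrightarrow> - (0 + (LINT x|lborel. of_real (2 * ?g x) * ?\<phi> x))"
  proof (rule tendsto_minus)
    have "(LINT x|lborel. ?s n x * ?\<phi> x) = (LINT x|lborel. (?s n x - ?q n x) * ?\<phi> x) + (LINT x|lborel. ?q n x * ?\<phi> x)" for n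
      using integrable_sq_int_mult[OF sq_int_diff[OF sq_int_add[OF dq[OF N] dq[OF N]] qs] p(1)] integrable_sq_int_mult[OF qs p(1)]
      by (subst Bochner_Integration.integral_add[symmetric]) (auto simp: algebra_simps)
    then show "(\<lambda>n. LINT x|lborel. ?s n x * ?\<phi> x) \<longlonglongrightarrow> 0 + (LINT x|lborel. of_real (2 * ?g x) * ?\<phi> x)"
      using tendsto_add[OF l1 l2] by simp
  qed
  moreover have "- (LINT x|lborel. ?s n x * ?\<phi> x) =
      (LINT x|lborel. ?N x * diff_quot (step n) v ?\<phi> x) + (LINT x|lborel. ?N x * diff_quot (- step n) v ?\<phi> x)" for n
    using integrable_sq_int_mult[OF dq[OF N] p(1), of _ v] integral_diff_quot_mult[OF N p(1), of "step n" v] integral_diff_quot_mult[OF N p(1), of "- step n" v]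
    by (simp add: distrib_right)
  moreover have "(\<lambda>n. (LINT x|lborel. ?N x * diff_quot (step n) v ?\<phi> x) + (LINT x|lborel. ?N x * diff_quot (- step n) v ?\<phi> x))
     \<longlonglongrightarrow> (LINT x|lborel. ?N x * of_real (dir_deriv v \<phi> x)) + (LINT x|lborel. ?N x * of_real (dir_deriv v \<phi> x))"
    by (intro tendsto_add tendsto_integral_sq_int_mult N p dq dp z)
  ultimately have "(LINT x|lborel. ?N x * of_real (dir_deriv v \<phi> x)) + (LINT x|lborel. ?N x * of_real (dir_deriv v \<phi> x)) =
      - (LINT x|lborel. of_real (2 * ?g x) * ?\<phi> x)"
    using LIMSEQ_unique by fastforce
  also have "(LINT x|lborel. of_real (2 * ?g x) * ?\<phi> x) = 2 * (LINT x|lborel. of_real (?g x) * ?\<phi> x)"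
  proof -
    have "(LINT x|lborel. of_real (2 * g x) * ?\<phi> x) = 2 * (LINT x|lborel. of_real (g x) * ?\<phi> x)" for g
      by (simp add: mult.assoc)
    then show ?thesis .
  qed
  finally show ?thesis by simp
qed

section \<open>The Loss-Thaller inequality\<close>

text \<open>Integration by parts against \<open>x $ j\<close> differentiates either \<psi> or the
  coordinate: the integral equals minus its own conjugate minus \<open>sq_norm \<psi>\<close>. The
  bounded support keeps the factor \<open>x $ j\<close> from destroying square
  integrability.\<close>

lemma moment_identity:
  assumes w: "weak_dir (axis j 1) \<psi> F" and \<psi>: "sq_int \<psi>" and F: "sq_int F"
    and R: "\<And>x. R < norm x \<Longrightarrow> \<psi> x = 0 \<and> F x = 0"
  shows "integrable lborel (\<lambda>x. cnj (F x) * (\<psi> x * of_real (x $ j)))"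
    and "2 * Re (LINT x|lborel. cnj (F x) * (\<psi> x * of_real (x $ j))) = - sq_norm \<psi>"
proof -
  note [measurable] = sq_int_measurable[OF \<psi>] sq_int_measurable[OF F]
  have m: "sq_int (\<lambda>x. f x * of_real (x $ j))" if "sq_int f" "\<And>x. R < norm x \<Longrightarrow> f x = 0" for f
  proof (rule sq_int_bound[OF that(1), of _ "\<bar>R\<bar>"])
    note [measurable] = sq_int_measurable[OF that(1)]
    show "(\<lambda>x. f x * of_real (x $ j)) \<in> borel_measurable borel" by measurable
    fix x
    show "norm (f x * of_real (x $ j)) \<le> \<bar>R\<bar> * norm (f x)"
    proof (cases "R < norm x")
      case False
      then have "\<bar>x $ j\<bar> \<le> \<bar>R\<bar>" using component_le_norm_cart[of x j] by linarith
      then have "\<bar>x $ j\<bar> * norm (f x) \<le> \<bar>R\<bar> * norm (f x)" by (rule mult_right_mono) simp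
      then show ?thesis by (simp add: norm_mult mult.commute)
    qed (simp add: that(2))
  qed
  have s: "sq_int (\<lambda>x. \<psi> x * of_real (x $ j))" "sq_int (\<lambda>x. F x * of_real (x $ j))"
    using R by (auto intro: m \<psi> F)
  have d: "dir_deriv (axis j 1) (\<lambda>x. x $ j) = (\<lambda>x. 1)"
    by (simp add: dir_deriv_axis partial_nth)
  have w2: "weak_dir (axis j 1) (\<lambda>x. \<psi> x * of_real (x $ j)) (\<lambda>x. F x * of_real (x $ j) + \<psi> x)"
    using weak_dir_mult_smooth[OF w smooth_nth[of j]] by (simp add: d)
  let ?I = "LINT x|lborel. cnj (F x) * (\<psi> x * of_real (x $ j))"
  show "integrable lborel (\<lambda>x. cnj (F x) * (\<psi> x * of_real (x $ j)))"
    by (intro integrable_sq_int_mult sq_int_cnj F s)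
  have i: "integrable lborel (\<lambda>x. cnj (\<psi> x) * (F x * of_real (x $ j)))" "integrable lborel (\<lambda>x. cnj (\<psi> x) * \<psi> x)"
    by (intro integrable_sq_int_mult sq_int_cnj \<psi> s)+
  have "?I = - (LINT x|lborel. cnj (\<psi> x) * (F x * of_real (x $ j) + \<psi> x))"
    by (rule weak_dir_by_parts[OF weak_dir_cnj[OF w] _ _ w2]) (intro sq_int_cnj sq_int_add \<psi> F s)+
  also have "(LINT x|lborel. cnj (\<psi> x) * (F x * of_real (x $ j) + \<psi> x)) =
     (LINT x|lborel. cnj (\<psi> x) * (F x * of_real (x $ j))) + (LINT x|lborel. cnj (\<psi> x) * \<psi> x)"
    using i by (simp add: distrib_left)
  also have "(LINT x|lborel. cnj (\<psi> x) * (F x * of_real (x $ j))) = cnj ?I"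
    unfolding Bochner_Integration.integral_cnj[symmetric] by (simp add: mult_ac)
  also have "(LINT x|lborel. cnj (\<psi> x) * \<psi> x) = of_real (sq_norm \<psi>)"
  proof -
    have "cnj (\<psi> x) * \<psi> x = of_real ((norm (\<psi> x))\<^sup>2)" for x
      by (simp only: complex_norm_square mult.commute)
    then show ?thesis unfolding sq_norm_def integral_complex_of_real[symmetric] by (simp only:)
  qed
  finally have "Re ?I = Re (- (cnj ?I + of_real (sq_norm \<psi>)))" by (rule arg_cong)
  then show "2 * Re ?I = - sq_norm \<psi>" by simp
qed

text \<open>Expand the product. The term quadratic in the potential is real, and so is the integral
  of \<open>cnj (F1 x) * F2 x\<close>, because interchanging the derivatives turns it into its own
  conjugate. Only the two mixed terms remain; they are first moments, and each contributes
  \<open>B / 2\<close> times \<open>sq_norm \<psi>\<close>.\<close>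

lemma magnetic_identity_compact:
  fixes B :: real
  assumes w: "weak_dir (axis 1 1) \<psi> F1" "weak_dir (axis 2 1) \<psi> F2"
    and s: "sq_int \<psi>" "sq_int F1" "sq_int F2"
    and R: "\<And>x. R < norm x \<Longrightarrow> \<psi> x = 0 \<and> F1 x = 0 \<and> F2 x = 0"
  shows "(LINT x|lborel. 2 * Im (cnj (F1 x + \<i> * of_real (B / 2 * x $ 2) * \<psi> x) *
      (F2 x + \<i> * of_real (- (B / 2 * x $ 1)) * \<psi> x))) = B * sq_norm \<psi>"
proof -
  note m1 = moment_identity[OF w(1) s(1,2), of R] and m2 = moment_identity[OF w(2) s(1,3), of R]
  let ?I1 = "LINT x|lborel. cnj (F1 x) * (\<psi> x * of_real (x $ 1))"
  let ?I2 = "LINT x|lborel. cnj (F2 x) * (\<psi> x * of_real (x $ 2))"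
  let ?J = "LINT x|lborel. cnj (F1 x) * F2 x"
  have i: "integrable lborel (\<lambda>x. cnj (F1 x) * F2 x)"
    by (intro integrable_sq_int_mult sq_int_cnj s)
  have "?J = (LINT x|lborel. cnj (F2 x) * F1 x)"
    by (rule weak_dir_commute[OF w s weak_dir_cnj[OF w(1)] weak_dir_cnj[OF w(2)]]) (intro sq_int_cnj s)+
  also have "\<dots> = cnj ?J"
    unfolding Bochner_Integration.integral_cnj[symmetric] by (simp add: mult.commute)
  finally have J: "Im ?J = 0" by (metis Reals_cnj_iff complex_is_Real_iff)
  have e: "2 * Im (cnj (F1 x + \<i> * of_real (B / 2 * x $ 2) * \<psi> x) * (F2 x + \<i> * of_real (- (B / 2 * x $ 1)) * \<psi> x))
    = 2 * Im (cnj (F1 x) * F2 x) - B * Re (cnj (F1 x) * (\<psi> x * of_real (x $ 1))) - B * Re (cnj (F2 x) * (\<psi> x * of_real (x $ 2)))" for x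
    by (simp add: field_simps)
  have "(LINT x|lborel. 2 * Im (cnj (F1 x + \<i> * of_real (B / 2 * x $ 2) * \<psi> x) *
      (F2 x + \<i> * of_real (- (B / 2 * x $ 1)) * \<psi> x))) = 2 * Im ?J - B * Re ?I1 - B * Re ?I2"
    unfolding e using i m1(1) m2(1) R integrable_Im[OF i] integrable_Re[OF m1(1)] integrable_Re[OF m2(1)]
    by (simp only: Bochner_Integration.integral_diff Bochner_Integration.integrable_diff integrable_mult_right
        integral_mult_right_zero integral_Re integral_Im)
  also have "\<dots> = B * sq_norm \<psi>"
  proof -
    have "2 * Re ?I1 = - sq_norm \<psi>" "2 * Re ?I2 = - sq_norm \<psi>" using m1(2) m2(2) R by blast+
    then have "Re ?I1 = - sq_norm \<psi> / 2" "Re ?I2 = - sq_norm \<psi> / 2" by linarith+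
    then show ?thesis by (simp add: J)
  qed
  finally show ?thesis .
qed

lemma sq_int_mult_bounded:
  assumes "sq_int f" "a \<in> borel_measurable borel" "\<And>x. \<bar>a x\<bar> \<le> M"
  shows "sq_int (\<lambda>x. f x * of_real (a x))"
proof (rule sq_int_bound[OF assms(1), of _ M])
  note [measurable] = sq_int_measurable[OF assms(1)] assms(2)
  show "(\<lambda>x. f x * of_real (a x)) \<in> borel_measurable borel" by measurable
  show "norm (f x * of_real (a x)) \<le> M * norm (f x)" for x
    using mult_right_mono[OF assms(3) norm_ge_zero, of x "f x"] by (simp add: norm_mult mult.commute)
qed

lemma test_function_bounded_UNIV:
  assumes "test_function \<phi>" obtains M where "\<And>x. \<bar>\<phi> x\<bar> \<le> M"
proof -
  obtain M R where b: "0 < M" "\<And>x. \<bar>\<phi> x\<bar> \<le> M * indicator (cball 0 R) x" using test_function_bounded[OF assms] by metis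
  have "\<bar>\<phi> x\<bar> \<le> M" for x using b(1) b(2)[of x] by (cases "x \<in> cball 0 R") auto
  then show ?thesis by (rule that)
qed

text \<open>Rotating by the phase \<open>y\<close> of \<open>cnj z\<close> preserves all norms and
  products involved and turns \<open>g u\<close> into the real part of \<open>y * u\<close>. With
  \<open>h\<close> the imaginary part, the claim is
  \<open>0 \<le> (c * g u - h w)\<^sup>2 + (c * g w + h u)\<^sup>2\<close> written out.\<close>

lemma magnetic_pointwise_bound:
  fixes z u w :: complex and c :: real
  assumes c: "0 \<le> c" "c \<le> 1"
  defines "g v \<equiv> Re (cnj z * v) / norm z"
  shows "(1 - c\<^sup>2) * ((g u)\<^sup>2 + (g w)\<^sup>2) + c * (2 * Im (cnj u * w)) \<le> (norm u)\<^sup>2 + (norm w)\<^sup>2"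
proof (cases "z = 0")
  case True
  \<comment> \<open>Both quotients are 0 here by the convention for division by 0, and it is
    \<open>c \<le> 1\<close> that keeps the cross term below the sum of squares.\<close>
  have "Im (cnj u * w) \<le> norm u * norm w"
    using abs_Im_le_cmod[of "cnj u * w"] by (simp add: norm_mult)
  then have "2 * Im (cnj u * w) \<le> (norm u)\<^sup>2 + (norm w)\<^sup>2"
    using sum_squares_bound[of "norm u" "norm w"] by linarith
  moreover have "c * (2 * Im (cnj u * w)) \<le> max 0 (2 * Im (cnj u * w))"
    using c by (cases "Im (cnj u * w) \<ge> 0") (auto intro: mult_left_le_one_le mult_nonneg_nonpos simp del: times_complex.sel)
  ultimately have "c * (2 * Im (cnj u * w)) \<le> (norm u)\<^sup>2 + (norm w)\<^sup>2"
    by (smt (verit) sum_power2_ge_zero)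
  then show ?thesis using True by (simp add: g_def)
next
  case False
  define y where "y = cnj z / norm z"
  have y: "norm y = 1" using False by (simp add: y_def norm_divide)
  have g: "g v = Re (y * v)" for v
    by (simp add: g_def y_def add_divide_distrib diff_divide_distrib)
  define h where "h v = Im (y * v)" for v
  have n: "(norm v)\<^sup>2 = (g v)\<^sup>2 + (h v)\<^sup>2" for v
  proof -
    have "norm v = norm (y * v)" using y by (simp add: norm_mult)
    then show ?thesis by (simp only: cmod_power2 g h_def)
  qed
  have "cnj u * w = cnj (y * u) * (y * w)"
  proof -
    have "cnj (y * u) * (y * w) = (y * cnj y) * (cnj u * w)" by simp
    also have "y * cnj y = 1" using complex_norm_square[of y] y by simp
    finally show ?thesis by simp
  qed
  then have "Im (cnj u * w) = Im (cnj (y * u) * (y * w))" by (rule arg_cong)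
  also have "\<dots> = g u * h w - h u * g w"
  proof -
    have "Im (cnj a * b) = Re a * Im b - Im a * Re b" for a b by simp
    then show ?thesis unfolding g h_def .
  qed
  finally have i: "Im (cnj u * w) = g u * h w - h u * g w" .
  have "0 \<le> (c * g u - h w)\<^sup>2 + (c * g w + h u)\<^sup>2" by simp
  then show ?thesis unfolding n i by (simp add: power2_eq_square algebra_simps)
qed

lemma abs_Re_quotient_le: "\<bar>Re (cnj z * u) / norm z\<bar> \<le> norm u" for z u :: complex
proof (cases "z = 0")
  case False
  have "\<bar>Re (cnj z * u)\<bar> \<le> norm z * norm u"
    using abs_Re_le_cmod[of "cnj z * u"] by (simp only: norm_mult complex_mod_cnj)
  with False show ?thesis by (simp add: abs_divide field_simps del: times_complex.sel)
qed simp

lemma loc_int_of_sq_int: "sq_int f \<Longrightarrow> loc_int f"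
proof -
  assume f: "sq_int f"
  note [measurable] = sq_int_measurable[OF f]
  show "loc_int f"
    unfolding loc_int_def
  proof safe
    fix R
    have [simp]: "emeasure lborel (cball (0::real^2) R) < top"
      by (rule emeasure_bounded_finite[OF bounded_cball, unfolded infinity_ennreal_def])
    show "integrable lborel (\<lambda>x. indicator (cball 0 R) x *\<^sub>R f x)"
    proof (rule Bochner_Integration.integrable_bound)
      show "integrable lborel (\<lambda>x. (norm (f x))\<^sup>2 + indicator (cball 0 R) x)"
        using f by (intro Bochner_Integration.integrable_add) (auto simp: sq_int_def integrable_indicator_iff)
      have "norm (f x) \<le> (norm (f x))\<^sup>2 + 1" for x
        using zero_le_power2[of "norm (f x) - 1 / 2"] by (simp add: power2_eq_square algebra_simps)
      then show "AE x in lborel. norm (indicator (cball 0 R) x *\<^sub>R f x) \<le> norm ((norm (f x))\<^sup>2 + indicator (cball 0 R) x :: real)"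
        by (auto simp: indicator_def)
    qed measurable
  qed measurable
qed

section \<open>The linear potential, and truncation of functions with a square-integrable magnetic
  gradient\<close>

lemma mag_potential_components: "mag_potential B x $ 1 = B / 2 * x $ 2" "mag_potential B x $ 2 = - (B / 2 * x $ 1)"
  by (simp_all add: mag_potential_def)

lemma smooth_mag_potential: "smooth (\<lambda>x. mag_potential B x $ j)"
proof -
  have "smooth (\<lambda>x. B / 2 * x $ 2)" "smooth (\<lambda>x. - (B / 2) * x $ 1)"
    by (intro smooth_mult smooth_const smooth_nth)+
  then show ?thesis using exhaust_2[of j] by (auto simp: mag_potential_components)
qed

text \<open>\<open>F\<close> holds the plain weak derivatives and \<open>G\<close> the components of
  the magnetic gradient. Square integrability is available for \<psi> and \<open>G\<close>, whereas
  \<open>F\<close> differs from \<open>G\<close> by the unbounded potential times \<psi>.\<close>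

locale magnetic =
  fixes B :: real and \<psi> :: "real^2 \<Rightarrow> complex" and F G :: "2 \<Rightarrow> real^2 \<Rightarrow> complex"
  assumes w: "\<And>j. weak_dir (axis j 1) \<psi> (F j)" and \<psi>: "sq_int \<psi>" and G: "\<And>j. sq_int (G j)"
    and FG: "\<And>j x. G j x = F j x + \<i> * of_real (mag_potential B x $ j) * \<psi> x"
begin

lemmas measurable_components[measurable] = sq_int_measurable[OF \<psi>] sq_int_measurable[OF G]

definition "\<psi>_cut n x = \<psi> x * of_real (cutoff n x)"
definition "F_cut n j x = F j x * of_real (cutoff n x) + \<psi> x * of_real (partial j (cutoff n) x)"
text \<open>The magnetic gradient of the truncated function: multiplication by a real cutoff adds
  the same Leibniz term to \<open>F\<close> and to \<open>G\<close>.\<close>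

definition "G_cut n j x = G j x * of_real (cutoff n x) + \<psi> x * of_real (partial j (cutoff n) x)"
definition "M = (SOME M. \<forall>j n x. \<bar>partial j (cutoff n) x\<bar> \<le> M)"

lemma partial_cutoff_le: "\<bar>partial j (cutoff n) x\<bar> \<le> M"
proof -
  obtain M1 M2 where "\<And>n x. \<bar>partial 1 (cutoff n) x\<bar> \<le> M1" "\<And>n x. \<bar>partial 2 (cutoff n) x\<bar> \<le> M2"
    using partial_cutoff_limits(2) by metis
  then have "\<exists>M. \<forall>j n x. \<bar>partial j (cutoff n) x\<bar> \<le> M"
    by (intro exI[of _ "max M1 M2"]) (auto simp: forall_2 le_max_iff_disj)
  from someI_ex[OF this] show ?thesis unfolding M_def by blast
qed

lemma measurable_cutoffs[measurable]: "cutoff n \<in> borel_measurable borel" "partial j (cutoff n) \<in> borel_measurable borel"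
  by (intro smooth_measurable smooth_cutoff smooth_partial)+

lemma G_cut_eq: "G_cut n j x = F_cut n j x + \<i> * of_real (mag_potential B x $ j) * \<psi>_cut n x"
  by (simp add: G_cut_def F_cut_def \<psi>_cut_def FG algebra_simps)

text \<open>This is what truncation achieves: potential times cutoff is a test function, hence
  bounded, so \<open>F_cut\<close> inherits square integrability from \<open>G_cut\<close> and
  \<psi>.\<close>

lemma sq_int_cutoffs: "sq_int (\<psi>_cut n)" "sq_int (G_cut n j)" "sq_int (F_cut n j)"
proof -
  have c: "\<bar>cutoff n x\<bar> \<le> 1" for x using cutoff_range[of n x] by auto
  show \<psi>_cut: "sq_int (\<psi>_cut n)"
    unfolding \<psi>_cut_def[abs_def] by (rule sq_int_mult_bounded[OF \<psi> _ c]) measurable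
  have "sq_int (\<lambda>x. G j x * of_real (cutoff n x))" by (rule sq_int_mult_bounded[OF G _ c]) measurable
  moreover have "sq_int (\<lambda>x. \<psi> x * of_real (partial j (cutoff n) x))"
    by (rule sq_int_mult_bounded[OF \<psi> _ partial_cutoff_le]) measurable
  ultimately show G_cut: "sq_int (G_cut n j)"
    unfolding G_cut_def[abs_def] by (rule sq_int_add)
  have t: "test_function (\<lambda>x. mag_potential B x $ j * cutoff n x)"
    by (intro test_function_mult smooth_mag_potential test_function_cutoff)
  obtain K where K: "\<And>x. \<bar>mag_potential B x $ j * cutoff n x\<bar> \<le> K" using test_function_bounded_UNIV[OF t] by blast
  have "sq_int (\<lambda>x. \<psi> x * of_real (mag_potential B x $ j * cutoff n x))"
    by (rule sq_int_mult_bounded[OF \<psi> test_function_measurable[OF t] K])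
  from sq_int_diff[OF G_cut sq_int_cmult[OF this, of \<i>]]
  show "sq_int (F_cut n j)"
    by (simp add: G_cut_def F_cut_def[abs_def] FG algebra_simps)
qed

lemma weak_dir_cutoff: "weak_dir (axis j 1) (\<psi>_cut n) (F_cut n j)"
  using weak_dir_mult_smooth[OF w smooth_cutoff, of j n]
  by (simp add: \<psi>_cut_def[abs_def] F_cut_def[abs_def] dir_deriv_axis)

lemma magnetic_identity_cutoff: "(LINT x|lborel. 2 * Im (cnj (G_cut n 1 x) * G_cut n 2 x)) = B * sq_norm (\<psi>_cut n)"
proof -
  obtain R where R: "\<forall>x. R < norm x \<longrightarrow> cutoff n x = 0"
    using test_function_cutoff by (auto simp: test_function_iff)
  have "R < norm x \<Longrightarrow> \<psi>_cut n x = 0 \<and> F_cut n 1 x = 0 \<and> F_cut n 2 x = 0" for x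
    using R partial_eq_0_outside[OF R] by (auto simp: \<psi>_cut_def F_cut_def)
  from magnetic_identity_compact[OF weak_dir_cutoff weak_dir_cutoff sq_int_cutoffs(1,3,3) this, where B=B]
  show ?thesis unfolding G_cut_eq mag_potential_components .
qed

lemma \<psi>_cut_le: "norm (\<psi>_cut n x) \<le> norm (\<psi> x)"
  using cutoff_range[of n x] by (auto simp: \<psi>_cut_def norm_mult intro: mult_left_le)

lemma G_cut_le: "norm (G_cut n j x) \<le> norm (G j x) + M * norm (\<psi> x)"
proof -
  have "norm (G_cut n j x) \<le> norm (G j x * of_real (cutoff n x)) + norm (\<psi> x * of_real (partial j (cutoff n) x))"
    unfolding G_cut_def by (rule norm_triangle_ineq)
  also have "\<dots> \<le> norm (G j x) + M * norm (\<psi> x)"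
  proof (rule add_mono)
    show "norm (G j x * of_real (cutoff n x)) \<le> norm (G j x)"
      using cutoff_range[of n x] by (auto simp: norm_mult intro: mult_left_le)
    show "norm (\<psi> x * of_real (partial j (cutoff n) x)) \<le> M * norm (\<psi> x)"
      using mult_right_mono[OF partial_cutoff_le norm_ge_zero, of j n x "\<psi> x"] by (simp add: norm_mult mult.commute)
  qed
  finally show ?thesis .
qed

lemma \<psi>_cut_tendsto: "(\<lambda>n. \<psi>_cut n x) \<longlonglongrightarrow> \<psi> x"
  using tendsto_mult[OF tendsto_const tendsto_of_real[OF cutoff_tendsto], of "\<psi> x" x] by (simp add: \<psi>_cut_def)

lemma G_cut_tendsto: "(\<lambda>n. G_cut n j x) \<longlonglongrightarrow> G j x"
proof -
  have "(\<lambda>n. G_cut n j x) \<longlonglongrightarrow> G j x * of_real 1 + \<psi> x * of_real 0"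
    unfolding G_cut_def by (intro tendsto_intros cutoff_tendsto partial_cutoff_limits)
  then show ?thesis by simp
qed

text \<open>Dominates every \<open>G_cut n j\<close>, uniformly in \<open>n\<close>. It is
  complex-valued so that the calculus of \<open>sq_int\<close> applies to it.\<close>

definition "majorant j x = complex_of_real (norm (G j x) + M * norm (\<psi> x))"

lemma sq_int_majorant: "sq_int (majorant j)"
proof -
  have "sq_int (\<lambda>x. of_real (norm (G j x)))" by (rule sq_int_bound[OF G[of j], of _ 1]) auto
  moreover have "sq_int (\<lambda>x. of_real (norm (\<psi> x)))" by (rule sq_int_bound[OF \<psi>, of _ 1]) auto
  ultimately show ?thesis
    unfolding majorant_def[abs_def] using sq_int_add[OF _ sq_int_cmult, of _ _ "of_real M"] by simp
qed

lemma G_cut_le_majorant: "norm (G_cut n j x) \<le> norm (majorant j x)"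
  using G_cut_le[of n j x] by (simp only: majorant_def norm_of_real)

text \<open>Dominated convergence from the truncated identity. It is stated there through
  \<open>G_cut\<close> and \<open>\<psi>_cut\<close>, which have integrable majorants, and no longer
  through the plain derivatives.\<close>

lemma magnetic_identity: "(LINT x|lborel. 2 * Im (cnj (G 1 x) * G 2 x)) = B * sq_norm \<psi>"
proof (rule LIMSEQ_unique)
  show "(\<lambda>n. LINT x|lborel. 2 * Im (cnj (G_cut n 1 x) * G_cut n 2 x)) \<longlonglongrightarrow> (LINT x|lborel. 2 * Im (cnj (G 1 x) * G 2 x))"
  proof (rule integral_dominated_convergence[where w="\<lambda>x. norm (2 * (majorant 1 x * majorant 2 x))"])
    show "integrable lborel (\<lambda>x. norm (2 * (majorant 1 x * majorant 2 x)))"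
      by (intro integrable_norm integrable_mult_right integrable_sq_int_mult sq_int_majorant)
    show "AE x in lborel. (\<lambda>n. 2 * Im (cnj (G_cut n 1 x) * G_cut n 2 x)) \<longlonglongrightarrow> 2 * Im (cnj (G 1 x) * G 2 x)"
      by (intro AE_I2 tendsto_intros G_cut_tendsto)
    show "AE x in lborel. norm (2 * Im (cnj (G_cut n 1 x) * G_cut n 2 x)) \<le> norm (2 * (majorant 1 x * majorant 2 x))" for n
    proof (rule AE_I2)
      fix x
      have "\<bar>Im (cnj (G_cut n 1 x) * G_cut n 2 x)\<bar> \<le> norm (G_cut n 1 x) * norm (G_cut n 2 x)"
        using abs_Im_le_cmod[of "cnj (G_cut n 1 x) * G_cut n 2 x"] by (simp only: norm_mult complex_mod_cnj)
      also have "\<dots> \<le> norm (majorant 1 x) * norm (majorant 2 x)" by (intro mult_mono G_cut_le_majorant) auto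
      finally show "norm (2 * Im (cnj (G_cut n 1 x) * G_cut n 2 x)) \<le> norm (2 * (majorant 1 x * majorant 2 x))"
        by (simp only: norm_mult real_norm_def abs_mult norm_numeral abs_numeral)
    qed
    show "(\<lambda>x. 2 * Im (cnj (G 1 x) * G 2 x)) \<in> borel_measurable lborel" by measurable
    show "(\<lambda>x. 2 * Im (cnj (G_cut n 1 x) * G_cut n 2 x)) \<in> borel_measurable lborel" for n
      unfolding G_cut_def by measurable
  qed
  have "(\<lambda>n. sq_norm (\<psi>_cut n)) \<longlonglongrightarrow> sq_norm \<psi>"
    unfolding sq_norm_def
  proof (rule integral_dominated_convergence[where w="\<lambda>x. (norm (\<psi> x))\<^sup>2"])
    show "integrable lborel (\<lambda>x. (norm (\<psi> x))\<^sup>2)" using \<psi> by (simp add: sq_int_def)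
    show "AE x in lborel. (\<lambda>n. (norm (\<psi>_cut n x))\<^sup>2) \<longlonglongrightarrow> (norm (\<psi> x))\<^sup>2"
      by (intro AE_I2 tendsto_intros \<psi>_cut_tendsto)
    show "AE x in lborel. norm ((norm (\<psi>_cut n x))\<^sup>2) \<le> (norm (\<psi> x))\<^sup>2" for n
      by (auto intro: power_mono \<psi>_cut_le)
    show "(\<lambda>x. (norm (\<psi>_cut n x))\<^sup>2) \<in> borel_measurable lborel" for n
      unfolding \<psi>_cut_def by measurable
  qed measurable
  then show "(\<lambda>n. LINT x|lborel. 2 * Im (cnj (G_cut n 1 x) * G_cut n 2 x)) \<longlonglongrightarrow> B * sq_norm \<psi>"
    unfolding magnetic_identity_cutoff by (intro tendsto_intros)
qed

text \<open>Since \<open>cnj (\<psi> x) * \<i> * A * \<psi> x\<close> is purely imaginary for real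
  \<open>A\<close>, replacing \<open>G\<close> by \<open>F\<close> gives the same value: the
  potential drops out of the derivative of the modulus.\<close>

definition "g j x = Re (cnj (\<psi> x) * G j x) / norm (\<psi> x)"

lemma g_measurable[measurable]: "g j \<in> borel_measurable borel"
  unfolding g_def[abs_def] by measurable

lemma g_le: "\<bar>g j x\<bar> \<le> norm (G j x)"
  unfolding g_def by (rule abs_Re_quotient_le)

lemma sq_int_g: "sq_int (\<lambda>x. of_real (g j x))"
  by (rule sq_int_bound[OF G[of j], of _ 1]) (use g_le in auto)

lemma sq_int_norm: "sq_int (\<lambda>x. of_real (norm (\<psi> x)))"
  by (rule sq_int_bound[OF \<psi>, of _ 1]) auto

text \<open>\<open>weak_dir_norm\<close> wants a square-integrable plain derivative, so it is
  applied to the truncations. Written with \<open>G_cut\<close> instead of \<open>F_cut\<close>,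
  both sides then converge by domination.\<close>

lemma weak_dir_norm_magnetic: "weak_dir (axis j 1) (\<lambda>x. of_real (norm (\<psi> x))) (\<lambda>x. of_real (g j x))"
  unfolding weak_dir_def
proof (intro conjI allI impI loc_int_of_sq_int sq_int_g sq_int_norm)
  fix \<phi> assume t: "test_function \<phi>"
  let ?d = "\<lambda>x. complex_of_real (dir_deriv (axis j 1) \<phi> x)" and ?\<phi> = "\<lambda>x. complex_of_real (\<phi> x)"
  note t' = test_function_dir_deriv[OF t, of "axis j 1"]
  note [measurable] = test_function_measurable[OF t] test_function_measurable[OF t']
  let ?g = "\<lambda>n x. Re (cnj (\<psi>_cut n x) * G_cut n j x) / norm (\<psi>_cut n x)"
  have e: "Re (cnj (\<psi>_cut n x) * F_cut n j x) = Re (cnj (\<psi>_cut n x) * G_cut n j x)" for n x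
    by (simp add: G_cut_eq algebra_simps)
  have l1: "(\<lambda>n. LINT x|lborel. of_real (norm (\<psi>_cut n x)) * ?d x) \<longlonglongrightarrow> (LINT x|lborel. of_real (norm (\<psi> x)) * ?d x)"
  proof (rule integral_dominated_convergence[where w="\<lambda>x. norm (\<psi> x * ?d x)"])
    show "integrable lborel (\<lambda>x. norm (\<psi> x * ?d x))"
      by (intro integrable_norm integrable_sq_int_mult \<psi> sq_int_test t')
    show "AE x in lborel. (\<lambda>n. of_real (norm (\<psi>_cut n x)) * ?d x) \<longlonglongrightarrow> of_real (norm (\<psi> x)) * ?d x"
      by (intro AE_I2 tendsto_intros \<psi>_cut_tendsto)
    show "AE x in lborel. norm (of_real (norm (\<psi>_cut n x)) * ?d x) \<le> norm (\<psi> x * ?d x)" for n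
      by (auto simp: norm_mult intro!: mult_right_mono \<psi>_cut_le)
    show "(\<lambda>x. of_real (norm (\<psi>_cut n x)) * ?d x) \<in> borel_measurable lborel" for n
      unfolding \<psi>_cut_def by measurable
  qed measurable
  have l2: "(\<lambda>n. LINT x|lborel. of_real (?g n x) * ?\<phi> x) \<longlonglongrightarrow> (LINT x|lborel. of_real (g j x) * ?\<phi> x)"
  proof (rule integral_dominated_convergence[where w="\<lambda>x. norm (majorant j x * ?\<phi> x)"])
    show "integrable lborel (\<lambda>x. norm (majorant j x * ?\<phi> x))"
      by (intro integrable_norm integrable_sq_int_mult sq_int_majorant sq_int_test t)
    \<comment> \<open>Where \<psi> vanishes, so does every truncation, and division by 0 makes all
      the terms and their limit 0.\<close>
    have "(\<lambda>n. ?g n x) \<longlonglongrightarrow> g j x" for x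
    proof (cases "\<psi> x = 0")
      case False
      then show ?thesis
        unfolding g_def by (intro tendsto_intros \<psi>_cut_tendsto G_cut_tendsto) simp
    qed (simp add: \<psi>_cut_def g_def)
    then show "AE x in lborel. (\<lambda>n. of_real (?g n x) * ?\<phi> x) \<longlonglongrightarrow> of_real (g j x) * ?\<phi> x"
      by (intro AE_I2 tendsto_mult tendsto_of_real tendsto_const)
    have "\<bar>?g n x\<bar> \<le> norm (majorant j x)" for n x
      using abs_Re_quotient_le[of "\<psi>_cut n x" "G_cut n j x"] G_cut_le_majorant[of n j x] by linarith
    then show "AE x in lborel. norm (of_real (?g n x) * ?\<phi> x) \<le> norm (majorant j x * ?\<phi> x)" for n
      by (intro AE_I2) (simp only: norm_mult norm_of_real, intro mult_right_mono abs_ge_zero)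
    show "(\<lambda>x. of_real (?g n x) * ?\<phi> x) \<in> borel_measurable lborel" for n
      unfolding \<psi>_cut_def G_cut_def by measurable
  qed measurable
  have "(LINT x|lborel. of_real (norm (\<psi>_cut n x)) * ?d x) = - (LINT x|lborel. of_real (?g n x) * ?\<phi> x)" for n
    using weak_dir_norm[OF weak_dir_cutoff sq_int_cutoffs(1,3) t, of n j] by (simp only: e)
  with l1 have "(\<lambda>n. - (LINT x|lborel. of_real (?g n x) * ?\<phi> x)) \<longlonglongrightarrow> (LINT x|lborel. of_real (norm (\<psi> x)) * ?d x)"
    by (simp only:)
  then show "(LINT x|lborel. of_real (norm (\<psi> x)) * ?d x) = - (LINT x|lborel. of_real (g j x) * ?\<phi> x)"
    by (rule LIMSEQ_unique[OF _ tendsto_minus[OF l2]])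
qed

lemma Loss_Thaller:
  assumes c: "0 \<le> c" "c \<le> 1"
  shows "c * B * sq_norm \<psi> + (1 - c\<^sup>2) * (\<Sum>j\<in>UNIV. sq_norm (\<lambda>x. of_real (g j x))) \<le> (\<Sum>j\<in>UNIV. sq_norm (G j))"
proof -
  have i: "integrable lborel (\<lambda>x. (g j x)\<^sup>2)" "integrable lborel (\<lambda>x. (norm (G j x))\<^sup>2)" for j
    using sq_int_g[of j] G[of j] by (simp_all add: sq_int_def)
  have ii: "integrable lborel (\<lambda>x. 2 * Im (cnj (G 1 x) * G 2 x))"
    by (intro integrable_mult_right integrable_Im integrable_sq_int_mult sq_int_cnj G)
  have "(1 - c\<^sup>2) * ((LINT x|lborel. (g 1 x)\<^sup>2) + (LINT x|lborel. (g 2 x)\<^sup>2)) + c * (LINT x|lborel. 2 * Im (cnj (G 1 x) * G 2 x)) =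
    (LINT x|lborel. (1 - c\<^sup>2) * ((g 1 x)\<^sup>2 + (g 2 x)\<^sup>2) + c * (2 * Im (cnj (G 1 x) * G 2 x)))"
    using i ii by (simp only: Bochner_Integration.integral_add Bochner_Integration.integrable_add integrable_mult_right
        integral_mult_right_zero)
  also have "\<dots> \<le> (LINT x|lborel. (norm (G 1 x))\<^sup>2 + (norm (G 2 x))\<^sup>2)"
  proof (rule integral_mono)
    show "(1 - c\<^sup>2) * ((g 1 x)\<^sup>2 + (g 2 x)\<^sup>2) + c * (2 * Im (cnj (G 1 x) * G 2 x)) \<le> (norm (G 1 x))\<^sup>2 + (norm (G 2 x))\<^sup>2" for x
      unfolding g_def by (rule magnetic_pointwise_bound[OF c])
  qed (intro Bochner_Integration.integrable_add integrable_mult_right i ii)+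
  also have "\<dots> = (LINT x|lborel. (norm (G 1 x))\<^sup>2) + (LINT x|lborel. (norm (G 2 x))\<^sup>2)"
    by (intro Bochner_Integration.integral_add i)
  finally show ?thesis
    unfolding magnetic_identity by (simp add: sum_2 sq_norm_def)
qed

end

section \<open>The interpolation inequality\<close>

text \<open>Jensen's inequality for the power \<open>p\<close>. Young's inequality gives the tangent
  line bound \<open>p * t powr (p - 1) * X \<le> X powr p + (p - 1) * t powr p\<close>; taking
  \<open>t\<close> to be the mean of \<open>X\<close> and integrating yields the claim.\<close>

lemma (in prob_space) expectation_powr_le:
  fixes X :: "'a \<Rightarrow> real"
  assumes p: "1 < p" and X: "integrable M X" "integrable M (\<lambda>x. X x powr p)" "\<And>x. 0 \<le> X x"
  shows "expectation X powr p \<le> expectation (\<lambda>x. X x powr p)"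
proof (cases "expectation X = 0")
  case False
  define t where "t = expectation X"
  have t: "0 < t" using False X(3) by (simp add: t_def integral_nonneg_AE order_less_le)
  define q where "q = p / (p - 1)"
  have q: "1 < q" "1 / p + 1 / q = 1" "(p - 1) * q = p" using p by (auto simp: q_def field_simps)
  have y: "p * t powr (p - 1) * X x \<le> X x powr p + (p - 1) * t powr p" for x
  proof -
    have "X x * t powr (p - 1) \<le> X x powr p / p + (t powr (p - 1)) powr q / q"
      by (rule Youngs_inequality) (use p q X in auto)
    then have "p * (X x * t powr (p - 1)) \<le> p * (X x powr p / p + t powr p / q)"
      using p by (simp add: powr_powr q mult_left_mono)
    also have "\<dots> = X x powr p + (p / q) * t powr p" using p by (simp add: field_simps)
    also have "p / q = p - 1" using p q by (simp add: field_simps)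
    finally show ?thesis by (simp add: mult_ac)
  qed
  have "p * t powr p = p * t powr (p - 1) * t" using t by (simp add: powr_diff)
  also have "\<dots> = expectation (\<lambda>x. p * t powr (p - 1) * X x)" using X by (simp add: t_def)
  also have "\<dots> \<le> expectation (\<lambda>x. X x powr p + (p - 1) * t powr p)"
    by (rule integral_mono[OF _ _ y]) (use X in auto)
  also have "\<dots> = expectation (\<lambda>x. X x powr p) + (p - 1) * t powr p"
    using X by (simp add: prob_space)
  finally show ?thesis by (simp add: t_def algebra_simps)
qed (use X p in \<open>simp add: integral_nonneg_AE\<close>)

section \<open>Averages over unit squares\<close>

definition unit_square :: "(real^2) measure" where
  "unit_square = density lborel (\<lambda>y. ennreal (indicator (cbox 0 One) y))"

lemma sets_unit_square[simp, measurable_cong]: "sets unit_square = sets borel"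
  and space_unit_square[simp]: "space unit_square = UNIV"
  by (simp_all add: unit_square_def)

lemma measurable_unit_square[simp]: "borel_measurable unit_square = borel_measurable borel"
  by (rule measurable_cong_sets) auto

interpretation unit_square: prob_space unit_square
proof
  have "ennreal (indicator (cbox 0 One) t) = indicator (cbox 0 One) t" for t :: "real^2" by (auto simp: indicator_def)
  then show "emeasure unit_square (space unit_square) = 1"
    by (simp add: unit_square_def emeasure_density)
qed

interpretation space_square: pair_sigma_finite "lborel :: (real^2) measure" unit_square ..

lemma AE_unit_square: "AE y in unit_square. y \<in> cbox 0 One"
  unfolding unit_square_def by (subst AE_density) (auto simp: indicator_def simp del: mem_box)

lemma integrable_unit_square:
  fixes f :: "real^2 \<Rightarrow> 'a::{banach, second_countable_topology}"
  shows "integrable lborel f \<Longrightarrow> integrable unit_square f"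
proof -
  assume f: "integrable lborel f"
  note [measurable] = borel_measurable_integrable[OF f]
  have "integrable lborel (\<lambda>y. indicator (cbox 0 One) y *\<^sub>R f y)"
    by (rule integrable_mult_indicator[OF _ f]) simp
  then show ?thesis
    unfolding unit_square_def using borel_measurable_integrable[OF f] by (subst integrable_density) auto
qed

lemma integral_unit_square_le:
  fixes f :: "real^2 \<Rightarrow> real"
  assumes f: "integrable lborel f" "\<And>x. 0 \<le> f x"
  shows "(LINT y|unit_square. f y) \<le> (LINT y|lborel. f y)"
proof -
  have "(LINT y|unit_square. f y) = (LINT y|lborel. indicator (cbox 0 One) y *\<^sub>R f y)"
    unfolding unit_square_def using borel_measurable_integrable[OF f(1)] by (subst integral_density) auto
  also have "\<dots> \<le> (LINT y|lborel. f y)"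
  proof (rule integral_mono)
    show "integrable lborel (\<lambda>y. indicator (cbox 0 One) y *\<^sub>R f y)"
      by (rule integrable_mult_indicator[OF _ f(1)]) simp
  qed (use f in \<open>auto simp: indicator_def\<close>)
  finally show ?thesis .
qed

lemma weak_dir_of_axes:
  assumes w: "\<And>j. weak_dir (axis j 1) \<psi> (F j)"
  shows "weak_dir v \<psi> (\<lambda>x. \<Sum>j\<in>UNIV. of_real (v $ j) * F j x)"
  unfolding weak_dir_def
proof (intro conjI allI impI)
  have L: "loc_int \<psi>" "loc_int (F j)" for j using w by (auto simp: weak_dir_def)
  show "loc_int \<psi>" by (rule L)
  show "loc_int (\<lambda>x. \<Sum>j\<in>UNIV. of_real (v $ j) * F j x)"
    unfolding sum_2 by (intro loc_int_add loc_int_cmult L)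
  fix \<phi> assume t: "test_function \<phi>"
  have e: "(LINT x|lborel. \<psi> x * of_real (partial j \<phi> x)) = - (LINT x|lborel. F j x * of_real (\<phi> x))" for j
    using weak_dir_test[OF w t, of j] by (simp add: dir_deriv_axis)
  note i = integrable_loc_int_test[OF L(1) test_function_partial[OF t]] integrable_loc_int_test[OF L(2) t]
  have "(LINT x|lborel. \<psi> x * of_real (dir_deriv v \<phi> x)) =
     (LINT x|lborel. of_real (v $ 1) * (\<psi> x * of_real (partial 1 \<phi> x)) + of_real (v $ 2) * (\<psi> x * of_real (partial 2 \<phi> x)))"
    by (simp add: dir_deriv_def sum_2 algebra_simps)
  also have "\<dots> = of_real (v $ 1) * (LINT x|lborel. \<psi> x * of_real (partial 1 \<phi> x)) + of_real (v $ 2) * (LINT x|lborel. \<psi> x * of_real (partial 2 \<phi> x))"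
    using i by simp
  also have "\<dots> = - (of_real (v $ 1) * (LINT x|lborel. F 1 x * of_real (\<phi> x)) + of_real (v $ 2) * (LINT x|lborel. F 2 x * of_real (\<phi> x)))"
    by (simp add: e)
  also have "of_real (v $ 1) * (LINT x|lborel. F 1 x * of_real (\<phi> x)) + of_real (v $ 2) * (LINT x|lborel. F 2 x * of_real (\<phi> x)) =
     (LINT x|lborel. of_real (v $ 1) * (F 1 x * of_real (\<phi> x)) + of_real (v $ 2) * (F 2 x * of_real (\<phi> x)))"
    using i by simp
  also have "\<dots> = (LINT x|lborel. (\<Sum>j\<in>UNIV. of_real (v $ j) * F j x) * of_real (\<phi> x))"
    by (simp add: sum_2 algebra_simps)
  finally show "(LINT x|lborel. \<psi> x * of_real (dir_deriv v \<phi> x)) = - (LINT x|lborel. (\<Sum>j\<in>UNIV. of_real (v $ j) * F j x) * of_real (\<phi> x))" .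
qed

text \<open>The components of \<open>y\<close> are at most 1 in absolute value, so the derivative in
  direction \<open>y\<close> is controlled by the two partial derivatives; the factor 2 comes from
  squaring a sum of two terms.\<close>

lemma translate_unit_square_le:
  assumes w: "\<And>j. weak_dir (axis j 1) u (F j)" and u: "sq_int u" and F: "\<And>j. sq_int (F j)"
    and y: "y \<in> cbox 0 One"
  shows "sq_norm (\<lambda>x. u (x + y) - u x) \<le> 2 * (\<Sum>j\<in>UNIV. sq_norm (F j))"
proof -
  have y1: "\<bar>y $ j\<bar> \<le> 1" for j
  proof -
    have "axis j 1 \<in> (Basis :: (real^2) set)" by (simp add: Basis_vec_def) blast
    then have "0 \<le> y \<bullet> axis j 1" "y \<bullet> axis j 1 \<le> 1" using y by (auto simp: mem_box)
    then show ?thesis by (simp add: inner_axis)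
  qed
  let ?W = "\<lambda>x. \<Sum>j\<in>UNIV. of_real (y $ j) * F j x"
  have s: "sq_int ?W" unfolding sum_2 by (intro sq_int_add sq_int_cmult F)
  have "sq_norm (\<lambda>x. u (x + y) - u x) \<le> sq_norm ?W"
    by (rule weak_dir_translate_le[OF weak_dir_of_axes[OF w] u s])
  also have "\<dots> \<le> (LINT x|lborel. 2 * (norm (F 1 x))\<^sup>2 + 2 * (norm (F 2 x))\<^sup>2)"
    unfolding sq_norm_def
  proof (rule integral_mono)
    fix x
    have le: "(norm (of_real (y $ j) * F j x))\<^sup>2 \<le> (norm (F j x))\<^sup>2" for j
      using y1[of j] by (intro power_mono) (auto simp: norm_mult intro: mult_left_le_one_le)
    show "(norm (?W x))\<^sup>2 \<le> 2 * (norm (F 1 x))\<^sup>2 + 2 * (norm (F 2 x))\<^sup>2"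
      using norm_add_square_le[of "of_real (y $ 1) * F 1 x" "of_real (y $ 2) * F 2 x"] le[of 1] le[of 2]
      unfolding sum_2 by linarith
  qed (use s F in \<open>auto simp: sq_int_def\<close>)
  also have "\<dots> = 2 * (\<Sum>j\<in>UNIV. sq_norm (F j))"
    using F by (simp add: sum_2 sq_norm_def sq_int_def)
  finally show ?thesis .
qed

text \<open>
  Averaging \<open>u\<close> over unit squares costs at most the gradient, while the averages are
  square integrable as soon as \<open>u \<in> L^p\<close> for some \<open>p \<le> 2\<close>.
\<close>
lemma sq_norm_le_gradient_Lp:
  assumes w: "\<And>j. weak_dir (axis j 1) u (F j)" and u: "sq_int u" and F: "\<And>j. sq_int (F j)"
    and p: "1 < p" "p \<le> 2" and up: "integrable lborel (\<lambda>x. norm (u x) powr p)"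
  shows "sq_norm u \<le> 4 * (\<Sum>j\<in>UNIV. sq_norm (F j)) + 2 * (LINT x|lborel. norm (u x) powr p) powr (2 / p)"
proof -
  note [measurable] = sq_int_measurable[OF u]
  define S where "S = (\<Sum>j\<in>UNIV. sq_norm (F j))"
  define P where "P = (LINT x|lborel. norm (u x) powr p)"
  have S: "0 \<le> S" by (simp add: S_def sum_nonneg sq_norm_nonneg)
  have P: "0 \<le> P" by (simp add: P_def)
  define m where "m x = (LINT y|unit_square. u (x + y))" for x
  define q where "q x = (LINT y|unit_square. norm (u (x + y)) powr p)" for x
  have tr: "integrable lborel (\<lambda>y. norm (u (x + y)) powr p)" for x
    using up integrable_translate_iff[of "\<lambda>y. norm (u y) powr p" x] by (simp add: add.commute)
  have iq: "integrable unit_square (\<lambda>y. norm (u (x + y)) powr p)" for x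
    by (rule integrable_unit_square[OF tr])
  have qP: "q x \<le> P" for x
    using integral_unit_square_le[OF tr, of x] integral_translate[of "\<lambda>y. norm (u y) powr p" x]
    by (simp add: q_def P_def add.commute)
  have q0: "0 \<le> q x" for x by (simp add: q_def)
  have i1: "integrable unit_square (\<lambda>y. norm (u (x + y)))" for x
  proof (rule Bochner_Integration.integrable_bound)
    show "integrable unit_square (\<lambda>y. 1 + norm (u (x + y)) powr p)"
      by (intro Bochner_Integration.integrable_add iq) simp
    have "t \<le> 1 + t powr p" if "0 \<le> t" for t :: real
      using that p powr_mono[of 1 p t] by (cases "t \<le> 1") (auto simp: add_increasing2 add_increasing)
    then show "AE y in unit_square. norm (norm (u (x + y))) \<le> norm (1 + norm (u (x + y)) powr p)"
      by (intro AE_I2) (simp add: abs_of_nonneg)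
    show "(\<lambda>y. norm (u (x + y))) \<in> borel_measurable unit_square" by simp
  qed
  \<comment> \<open>Jensen bounds \<open>norm (m x) powr p\<close> by the local mass
    \<open>q x\<close>. Of the resulting \<open>q x powr (2 / p)\<close>, one factor
    \<open>q x\<close> is kept because it is integrable in \<open>x\<close>, and the remaining
    power, nonnegative since \<open>p \<le> 2\<close>, is bounded through the total mass
    \<open>P\<close>.\<close>
  have m2: "(norm (m x))\<^sup>2 \<le> q x * P powr (2 / p - 1)" for x
  proof -
    have "norm (m x) powr p \<le> (LINT y|unit_square. norm (u (x + y))) powr p"
      unfolding m_def using p by (intro powr_mono2 integral_norm_bound) auto
    also have "\<dots> \<le> q x"
      unfolding q_def by (rule unit_square.expectation_powr_le[OF p(1) i1 iq]) simp
    finally have a: "norm (m x) powr p \<le> q x" .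
    have "(norm (m x))\<^sup>2 = (norm (m x) powr p) powr (2 / p)"
      using p by (simp add: powr_powr)
    also have "\<dots> \<le> q x powr (2 / p)" using p a by (intro powr_mono2) auto
    also have "\<dots> = q x * q x powr (2 / p - 1)"
      using q0[of x] by (cases "q x = 0") (auto simp: powr_diff)
    also have "\<dots> \<le> q x * P powr (2 / p - 1)"
      using p q0[of x] qP[of x] by (intro mult_left_mono powr_mono2) auto
    finally show ?thesis .
  qed
  have M[measurable]: "(\<lambda>(x, y). u (x + y)) \<in> borel_measurable (lborel \<Otimes>\<^sub>M unit_square)"
    by measurable
  have "(\<lambda>x. LINT y|unit_square. (case (x, y) of (x, y) \<Rightarrow> norm (u (x + y)) powr p)) \<in> borel_measurable lborel"
    by (rule unit_square.borel_measurable_lebesgue_integral) measurable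
  then have [measurable]: "q \<in> borel_measurable borel" by (simp add: q_def[abs_def])
  \<comment> \<open>By Tonelli and translation invariance the local masses integrate to
    \<open>P\<close>, since the squares have measure 1.\<close>
  have "(\<integral>\<^sup>+x. ennreal (q x) \<partial>lborel) = (\<integral>\<^sup>+x. (\<integral>\<^sup>+y. ennreal (norm (u (x + y)) powr p) \<partial>unit_square) \<partial>lborel)"
    unfolding q_def using iq by (intro nn_integral_cong) (simp add: nn_integral_eq_integral)
  also have "\<dots> = (\<integral>\<^sup>+y. (\<integral>\<^sup>+x. ennreal (norm (u (x + y)) powr p) \<partial>lborel) \<partial>unit_square)"
    by (rule space_square.Fubini'[symmetric]) measurable
  also have "\<dots> = (\<integral>\<^sup>+y. ennreal P \<partial>unit_square)"
  proof (rule nn_integral_cong)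
    fix y
    have "(\<integral>\<^sup>+x. ennreal (norm (u (x + y)) powr p) \<partial>lborel) = (\<integral>\<^sup>+x. ennreal (norm (u x) powr p) \<partial>lborel)"
      using nn_integral_translate[of "\<lambda>x. ennreal (norm (u x) powr p)" y] by simp
    also have "\<dots> = ennreal P" unfolding P_def using up by (intro nn_integral_eq_integral) auto
    finally show "(\<integral>\<^sup>+x. ennreal (norm (u (x + y)) powr p) \<partial>lborel) = ennreal P" .
  qed
  also have "\<dots> = ennreal P" by (simp add: unit_square.emeasure_space_1[simplified])
  finally have Q: "(\<integral>\<^sup>+x. ennreal (q x) \<partial>lborel) = ennreal P" .
  have "(\<integral>\<^sup>+x. (\<integral>\<^sup>+y. ennreal ((norm (u (x + y) - u x))\<^sup>2) \<partial>unit_square) \<partial>lborel) =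
      (\<integral>\<^sup>+y. (\<integral>\<^sup>+x. ennreal ((norm (u (x + y) - u x))\<^sup>2) \<partial>lborel) \<partial>unit_square)"
    by (rule space_square.Fubini'[symmetric]) measurable
  also have "\<dots> \<le> (\<integral>\<^sup>+y. ennreal (2 * S) \<partial>unit_square)"
  proof (rule nn_integral_mono_AE)
    have "(\<integral>\<^sup>+x. ennreal ((norm (u (x + y) - u x))\<^sup>2) \<partial>lborel) \<le> ennreal (2 * S)" if "y \<in> cbox 0 One" for y
      using translate_unit_square_le[OF w u F that] sq_norm_eq_nn_integral[OF sq_int_diff[OF sq_int_translate[OF u] u], of y]
      by (metis S_def ennreal_leI)
    then show "AE y in unit_square. (\<integral>\<^sup>+x. ennreal ((norm (u (x + y) - u x))\<^sup>2) \<partial>lborel) \<le> ennreal (2 * S)"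
      by (rule eventually_mono[OF AE_unit_square])
  qed
  also have "\<dots> = ennreal (2 * S)" by (simp add: unit_square.emeasure_space_1[simplified])
  finally have D: "(\<integral>\<^sup>+x. (\<integral>\<^sup>+y. ennreal ((norm (u (x + y) - u x))\<^sup>2) \<partial>unit_square) \<partial>lborel) \<le> ennreal (2 * S)" .
  have "ennreal (sq_norm u) = (\<integral>\<^sup>+x. ennreal ((norm (u x))\<^sup>2) \<partial>lborel)"
    by (rule sq_norm_eq_nn_integral[OF u])
  also have "\<dots> \<le> (\<integral>\<^sup>+x. 2 * (\<integral>\<^sup>+y. ennreal ((norm (u (x + y) - u x))\<^sup>2) \<partial>unit_square) + ennreal (2 * P powr (2 / p - 1)) * ennreal (q x) \<partial>lborel)"
  proof (rule nn_integral_mono)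
    fix x
    \<comment> \<open>\<open>u\<close> is split into its average over a square and the deviation
      from it. Jensen bounds the squared deviation by the mean squared increment, and
      \<open>m2\<close> handles the average.\<close>
    have "(norm (u x))\<^sup>2 \<le> 2 * (norm (m x - u x))\<^sup>2 + 2 * (norm (m x))\<^sup>2"
      using norm_add_square_le[of "- (m x - u x)" "m x"] by (simp add: norm_minus_commute)
    also have "\<dots> \<le> 2 * (norm (m x - u x))\<^sup>2 + (2 * P powr (2 / p - 1)) * q x"
      using m2[of x] by (simp add: mult_ac)
    finally have "ennreal ((norm (u x))\<^sup>2) \<le> ennreal (2 * (norm (m x - u x))\<^sup>2 + (2 * P powr (2 / p - 1)) * q x)"
      by (rule ennreal_leI)
    also have "\<dots> = 2 * ennreal ((norm (m x - u x))\<^sup>2) + ennreal (2 * P powr (2 / p - 1)) * ennreal (q x)"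
      using q0[of x] by (simp add: ennreal_plus ennreal_mult)
    also have "ennreal ((norm (m x - u x))\<^sup>2) \<le> (\<integral>\<^sup>+y. ennreal ((norm (u (x + y) - u x))\<^sup>2) \<partial>unit_square)"
      unfolding m_def by (rule unit_square.norm_integral_square_le) measurable
    finally show "ennreal ((norm (u x))\<^sup>2) \<le> 2 * (\<integral>\<^sup>+y. ennreal ((norm (u (x + y) - u x))\<^sup>2) \<partial>unit_square) + ennreal (2 * P powr (2 / p - 1)) * ennreal (q x)"
      by (simp add: mult_left_mono)
  qed
  also have "\<dots> = 2 * (\<integral>\<^sup>+x. (\<integral>\<^sup>+y. ennreal ((norm (u (x + y) - u x))\<^sup>2) \<partial>unit_square) \<partial>lborel) +
      ennreal (2 * P powr (2 / p - 1)) * (\<integral>\<^sup>+x. ennreal (q x) \<partial>lborel)"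
  proof -
    have [measurable]: "(\<lambda>x. \<integral>\<^sup>+y. ennreal ((norm (u (x + y) - u x))\<^sup>2) \<partial>unit_square) \<in> borel_measurable lborel"
      by measurable
    have [measurable]: "(\<lambda>x. ennreal (q x)) \<in> borel_measurable lborel"
      by measurable
    show ?thesis
      by (subst nn_integral_add) (measurable, subst (1 2) nn_integral_cmult, measurable)
  qed
  also have "\<dots> \<le> 2 * ennreal (2 * S) + ennreal (2 * P powr (2 / p - 1)) * ennreal P"
    unfolding Q by (intro add_right_mono mult_left_mono D) auto
  \<comment> \<open>The 4 collects a factor 2 from this splitting and a factor 2 from
    \<open>translate_unit_square_le\<close>.\<close>
  also have "\<dots> = ennreal (4 * S + 2 * (P powr (2 / p - 1) * P))"
    using S P by (simp add: ennreal_plus ennreal_mult mult.assoc)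
  finally have "sq_norm u \<le> 4 * S + 2 * (P powr (2 / p - 1) * P)"
    using S P by (subst (asm) ennreal_le_iff) auto
  also have "P powr (2 / p - 1) * P = P powr (2 / p)"
    using P by (cases "P = 0") (auto simp: powr_diff)
  finally show ?thesis by (simp add: S_def P_def)
qed

section \<open>Dilations and the scaled interpolation inequality\<close>

lemma loc_int_scale:
  assumes f: "loc_int f" and c: "c \<noteq> 0" shows "loc_int (\<lambda>x. f (c *\<^sub>R x))"
  unfolding loc_int_def
proof safe
  note [measurable] = loc_int_measurable[OF f]
  show "(\<lambda>x. f (c *\<^sub>R x)) \<in> borel_measurable borel" by measurable
  fix R
  have "integrable lborel (\<lambda>x. indicator (cball 0 (\<bar>c\<bar> * R)) x *\<^sub>R f x)"
    using f by (simp add: loc_int_def)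
  then have "integrable lborel (\<lambda>x. indicator (cball 0 (\<bar>c\<bar> * R)) (c *\<^sub>R x) *\<^sub>R f (c *\<^sub>R x))"
    using c by (intro integrable_scale_iff[THEN iffD2]) auto
  moreover have "indicator (cball 0 (\<bar>c\<bar> * R)) (c *\<^sub>R x) = indicat_real (cball 0 R) x" for x :: "real^2"
    using c by (auto simp: indicator_def)
  ultimately show "integrable lborel (\<lambda>x. indicator (cball 0 R) x *\<^sub>R f (c *\<^sub>R x))" by simp
qed

text \<open>Test with \<open>\<phi> (x / c)\<close> and change variables: the Jacobian
  \<open>c\<^sup>2\<close> occurs on both sides, and the chain rule for the test function provides
  the factor \<open>c\<close>.\<close>

lemma weak_dir_dilate:
  assumes w: "weak_dir (axis j 1) \<psi> F" and c: "0 < c"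
  shows "weak_dir (axis j 1) (\<lambda>x. \<psi> (c *\<^sub>R x)) (\<lambda>x. of_real c * F (c *\<^sub>R x))"
  unfolding weak_dir_def
proof (intro conjI allI impI)
  have L: "loc_int \<psi>" "loc_int F" using w by (auto simp: weak_dir_def)
  note [measurable] = L[THEN loc_int_measurable]
  show "loc_int (\<lambda>x. \<psi> (c *\<^sub>R x))" "loc_int (\<lambda>x. of_real c * F (c *\<^sub>R x))"
    using c by (intro loc_int_cmult loc_int_scale L; simp)+
  fix \<phi> assume t: "test_function \<phi>"
  then have s: "smooth \<phi>" by (simp add: test_function_iff)
  have t2: "test_function (\<lambda>x. \<phi> (inverse c *\<^sub>R x))"
    using test_function_affine[OF t, of "inverse c" 0] c by simp
  have d: "partial j (\<lambda>x. \<phi> (inverse c *\<^sub>R x)) = (\<lambda>x. inverse c * partial j \<phi> (inverse c *\<^sub>R x))"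
    using partial_affine(1)[OF smooth_differentiable[OF s], of j 0 "inverse c"] by simp
  note [measurable] = test_function_measurable[OF t] test_function_measurable[OF test_function_partial[OF t]]
  have "c\<^sup>2 *\<^sub>R (LINT x|lborel. \<psi> (c *\<^sub>R x) * of_real (partial j \<phi> x)) =
      (LINT x|lborel. \<psi> x * of_real (partial j \<phi> (inverse c *\<^sub>R x)))"
    using c by (subst integral_scale[of c "\<lambda>x. \<psi> x * of_real (partial j \<phi> (inverse c *\<^sub>R x))"]) simp_all
  also have "\<dots> = (LINT x|lborel. of_real c * (\<psi> x * of_real (dir_deriv (axis j 1) (\<lambda>x. \<phi> (inverse c *\<^sub>R x)) x)))"
    unfolding dir_deriv_axis d using c by (intro Bochner_Integration.integral_cong refl) simp
  also have "\<dots> = - (of_real c * (LINT x|lborel. F x * of_real (\<phi> (inverse c *\<^sub>R x))))"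
    using weak_dir_test[OF w t2] by simp
  also have "(LINT x|lborel. F x * of_real (\<phi> (inverse c *\<^sub>R x))) = c\<^sup>2 *\<^sub>R (LINT x|lborel. F (c *\<^sub>R x) * of_real (\<phi> x))"
    using c by (subst integral_scale[of c "\<lambda>x. F x * of_real (\<phi> (inverse c *\<^sub>R x))"]) simp_all
  also have "- (of_real c * (c\<^sup>2 *\<^sub>R (LINT x|lborel. F (c *\<^sub>R x) * of_real (\<phi> x)))) =
     c\<^sup>2 *\<^sub>R (- (LINT x|lborel. of_real c * F (c *\<^sub>R x) * of_real (\<phi> x)))"
    by (simp add: mult.assoc)
  finally show "(LINT x|lborel. \<psi> (c *\<^sub>R x) * of_real (dir_deriv (axis j 1) \<phi> x)) = - (LINT x|lborel. of_real c * F (c *\<^sub>R x) * of_real (\<phi> x))"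
    using c by (subst (asm) scaleR_cancel_left) (simp add: dir_deriv_axis)
qed

lemma sq_int_dilate:
  assumes f: "sq_int f" and c: "c \<noteq> 0"
  shows "sq_int (\<lambda>x. f (c *\<^sub>R x))" "sq_norm f = c\<^sup>2 * sq_norm (\<lambda>x. f (c *\<^sub>R x))"
proof -
  note [measurable] = sq_int_measurable[OF f]
  show "sq_int (\<lambda>x. f (c *\<^sub>R x))"
    using f c integrable_scale_iff[of c "\<lambda>x. (norm (f x))\<^sup>2"] by (simp add: sq_int_def)
  show "sq_norm f = c\<^sup>2 * sq_norm (\<lambda>x. f (c *\<^sub>R x))"
    unfolding sq_norm_def using integral_scale[OF c, of "\<lambda>x. (norm (f x))\<^sup>2"] by simp
qed

text \<open>A lower bound for the quotient in \<open>C_opt\<close>, multiplied out so that division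
  by a vanishing norm does not occur, and phrased with Borel functions and explicit weak
  derivatives.\<close>

definition interpolates :: "real \<Rightarrow> real \<Rightarrow> bool" where
  "interpolates p C \<longleftrightarrow> (\<forall>u F. (\<forall>j. weak_dir (axis j 1) u (F j)) \<longrightarrow> sq_int u \<longrightarrow> (\<forall>j. sq_int (F j)) \<longrightarrow>
     integrable lborel (\<lambda>x. norm (u x) powr p) \<longrightarrow>
     C * sq_norm u \<le> (\<Sum>j\<in>UNIV. sq_norm (F j)) + (LINT x|lborel. norm (u x) powr p) powr (2 / p))"

text \<open>In dimension two, passing to \<open>u (c *\<^sub>R x)\<close> preserves the square norm
  of the gradient, divides \<open>sq_norm u\<close> by \<open>c\<^sup>2\<close>, and multiplies the
  squared \<open>L^p\<close> norm by \<open>c powr (- 4 / p)\<close>. Setting the last factor equal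
  to \<open>l\<close> gives \<open>c = l powr (- p / 4)\<close> and turns \<open>C\<close> into
  \<open>C * l powr (p / 2)\<close>.\<close>

lemma interpolates_scaled:
  assumes C: "interpolates p C" and p: "1 < p" and l: "0 < l"
    and w: "\<And>j. weak_dir (axis j 1) u (F j)" and u: "sq_int u" and F: "\<And>j. sq_int (F j)"
    and up: "integrable lborel (\<lambda>x. norm (u x) powr p)"
  shows "C * l powr (p / 2) * sq_norm u \<le> (\<Sum>j\<in>UNIV. sq_norm (F j)) + l * (LINT x|lborel. norm (u x) powr p) powr (2 / p)"
proof -
  define c where "c = l powr (- p / 4)"
  have c: "0 < c" using l by (simp add: c_def)
  have c2: "c\<^sup>2 = l powr (- p / 2)" 
    using l by (simp add: c_def power2_eq_square flip: powr_add)
  define P where "P = (LINT x|lborel. norm (u x) powr p)"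
  note [measurable] = sq_int_measurable[OF u]
  have u': "sq_int (\<lambda>x. u (c *\<^sub>R x))" "sq_norm u = c\<^sup>2 * sq_norm (\<lambda>x. u (c *\<^sub>R x))"
    using sq_int_dilate[OF u, of c] c by auto
  have F': "sq_int (\<lambda>x. of_real c * F j (c *\<^sub>R x))" "sq_norm (\<lambda>x. of_real c * F j (c *\<^sub>R x)) = sq_norm (F j)" for j
    using sq_int_dilate[OF F, of c j] c by (auto intro: sq_int_cmult simp: sq_norm_cmult)
  have up': "integrable lborel (\<lambda>x. norm (u (c *\<^sub>R x)) powr p)"
    using c up integrable_scale_iff[of c "\<lambda>x. norm (u x) powr p"] by simp
  have P': "(LINT x|lborel. norm (u (c *\<^sub>R x)) powr p) = P / c\<^sup>2"
    using c integral_scale[of c "\<lambda>x. norm (u x) powr p"] by (simp add: P_def)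
  have "C * sq_norm (\<lambda>x. u (c *\<^sub>R x)) \<le> (\<Sum>j\<in>UNIV. sq_norm (\<lambda>x. of_real c * F j (c *\<^sub>R x))) + (LINT x|lborel. norm (u (c *\<^sub>R x)) powr p) powr (2 / p)"
    using C[unfolded interpolates_def, rule_format, OF weak_dir_dilate[OF w c] u'(1) F'(1) up'] by simp
  also have "\<dots> = (\<Sum>j\<in>UNIV. sq_norm (F j)) + (P / c\<^sup>2) powr (2 / p)"
    by (simp only: F' P')
  also have "(P / c\<^sup>2) powr (2 / p) = l * P powr (2 / p)"
  proof -
    have "- p / 2 = - (p / 2)" by simp
    then have "P / c\<^sup>2 = l powr (p / 2) * P"
      unfolding c2 by (simp only: powr_minus divide_inverse inverse_inverse_eq mult.commute)
    then have "(P / c\<^sup>2) powr (2 / p) = (l powr (p / 2) * P) powr (2 / p)" by (simp only:)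
    also have "\<dots> = (l powr (p / 2)) powr (2 / p) * P powr (2 / p)"
      by (rule powr_mult)
    also have "(l powr (p / 2)) powr (2 / p) = l" using l p by (simp add: powr_powr)
    finally show ?thesis .
  qed
  also have "sq_norm (\<lambda>x. u (c *\<^sub>R x)) = l powr (p / 2) * sq_norm u"
  proof -
    have "l powr (p / 2) * c\<^sup>2 = 1" using l by (simp add: c2 flip: powr_add)
    then show ?thesis by (simp add: u'(2) mult.assoc[symmetric])
  qed
  finally show ?thesis unfolding P_def mult.assoc .
qed

section \<open>Borel representatives of magnetic gradients\<close>

lemma borel_representative:
  fixes f :: "real^2 \<Rightarrow> complex"
  assumes "f \<in> borel_measurable lebesgue"
  obtains g where "g \<in> borel_measurable borel" "AE x in lborel. f x = g x"
proof -
  have "(\<lambda>x. Re (f x)) \<in> borel_measurable lebesgue" "(\<lambda>x. Im (f x)) \<in> borel_measurable lebesgue"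
    using assms by auto
  from this[THEN completion_ex_borel_measurable_real] obtain a b
    where ab: "a \<in> borel_measurable borel" "b \<in> borel_measurable borel"
      and ae: "AE x in lborel. Re (f x) = a x" "AE x in lborel. Im (f x) = b x" by auto
  show ?thesis
  proof
    show "(\<lambda>x. Complex (a x) (b x)) \<in> borel_measurable borel"
      using ab by (simp add: borel_measurable_complex_iff)
    show "AE x in lborel. f x = Complex (a x) (b x)"
      using ae by eventually_elim (simp add: complex_eq_iff)
  qed
qed

lemma locally_integrable_measurable:
  fixes f :: "real^2 \<Rightarrow> 'b::euclidean_space"
  assumes "locally_integrable f" shows "f \<in> borel_measurable lebesgue"
proof (rule borel_measurable_LIMSEQ_metric)
  show "(\<lambda>x. indicator (cball 0 (real n)) x *\<^sub>R f x) \<in> borel_measurable lebesgue" for n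
    using assms by (intro borel_measurable_integrable) (simp add: locally_integrable_def set_integrable_def)
  fix x :: "real^2"
  obtain n where "norm x \<le> real n" using real_arch_simple by blast
  then have "\<forall>\<^sub>F n in sequentially. indicator (cball 0 (real n)) x *\<^sub>R f x = f x"
    unfolding eventually_sequentially by (intro exI[of _ n]) auto
  then show "(\<lambda>n. indicator (cball 0 (real n)) x *\<^sub>R f x) \<longlonglongrightarrow> f x"
    by (rule tendsto_eventually)
qed

lemma lebesgue_representative:
  fixes f g :: "real^2 \<Rightarrow> 'b::{banach, second_countable_topology}"
  assumes f: "f \<in> borel_measurable lebesgue" and g: "g \<in> borel_measurable borel" and ae: "AE x in lborel. f x = g x"
  shows "(LINT x|lebesgue. f x) = (LINT x|lborel. g x)" "integrable lebesgue f \<longleftrightarrow> integrable lborel g"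
proof -
  have ae': "AE x in lebesgue. f x = g x" using ae by (rule AE_completion)
  have g': "g \<in> borel_measurable lebesgue" using g by (intro measurable_completion) simp
  have "(LINT x|lebesgue. f x) = (LINT x|lebesgue. g x)" by (rule integral_cong_AE[OF f g' ae'])
  also have "\<dots> = (LINT x|lborel. g x)" by (rule integral_completion) (use g in simp)
  finally show "(LINT x|lebesgue. f x) = (LINT x|lborel. g x)" .
  have "integrable lebesgue f \<longleftrightarrow> integrable lebesgue g" by (rule integrable_cong_AE[OF f g' ae'])
  also have "\<dots> \<longleftrightarrow> integrable lborel g" by (rule integrable_completion) (use g in simp)
  finally show "integrable lebesgue f \<longleftrightarrow> integrable lborel g" .
qed

lemma locally_integrable_iff_loc_int:
  assumes f: "f \<in> borel_measurable lebesgue" and g: "g \<in> borel_measurable borel" and ae: "AE x in lborel. f x = g x"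
  shows "locally_integrable f \<longleftrightarrow> loc_int g"
proof -
  have e: "f absolutely_integrable_on K \<longleftrightarrow> integrable lborel (\<lambda>x. indicator K x *\<^sub>R g x)" if K: "compact K" for K
    unfolding set_integrable_def
  proof (rule lebesgue_representative(2))
    have [measurable]: "K \<in> sets borel" using K by (simp add: compact_imp_closed borel_closed)
    note [measurable] = g
    show "(\<lambda>x. indicator K x *\<^sub>R g x) \<in> borel_measurable borel" by measurable
    show "(\<lambda>x. indicator K x *\<^sub>R f x) \<in> borel_measurable lebesgue"
      using f \<open>K \<in> sets borel\<close> by (intro borel_measurable_scaleR borel_measurable_indicator) auto
    show "AE x in lborel. indicator K x *\<^sub>R f x = indicator K x *\<^sub>R g x" using ae by eventually_elim simp
  qed
  show ?thesis
  proof
    assume "locally_integrable f"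
    then show "loc_int g" using g by (auto simp: locally_integrable_def loc_int_def e[symmetric])
  next
    assume l: "loc_int g"
    show "locally_integrable f"
      unfolding locally_integrable_def
    proof (intro allI impI)
      fix K :: "(real^2) set" assume K: "compact K"
      then have [measurable]: "K \<in> sets borel" by (simp add: compact_imp_closed borel_closed)
      note [measurable] = g
      obtain R where R: "\<And>x. x \<in> K \<Longrightarrow> norm x \<le> R" using compact_imp_bounded[OF K] by (auto simp: bounded_iff)
      have "integrable lborel (\<lambda>x. indicator (cball 0 R) x *\<^sub>R g x)" using l by (simp add: loc_int_def)
      then have "integrable lborel (\<lambda>x. indicator K x *\<^sub>R g x)"
        by (rule Bochner_Integration.integrable_bound) (use R in \<open>auto simp: indicator_def\<close>)
      then show "f absolutely_integrable_on K" using e[OF K] by simp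
    qed
  qed
qed

section \<open>Gradients and their components\<close>

lemma vec_lambda_measurable:
  fixes g :: "2 \<Rightarrow> 'a \<Rightarrow> complex"
  assumes "\<And>j. g j \<in> borel_measurable M"
  shows "(\<lambda>x. \<chi> j. g j x) \<in> borel_measurable M"
proof -
  have "continuous_on UNIV (\<lambda>p :: complex \<times> complex. if j = 1 then fst p else snd p)" for j :: 2
    by (cases "j = 1") (auto intro!: continuous_intros)
  then have c: "continuous_on UNIV (\<lambda>p :: complex \<times> complex. \<chi> j :: 2. if j = 1 then fst p else snd p)"
    by (rule continuous_on_vec_lambda)
  have "(\<lambda>x. (\<lambda>p :: complex \<times> complex. \<chi> j :: 2. if j = 1 then fst p else snd p) (g 1 x, g 2 x)) \<in> borel_measurable M"
    by (rule borel_measurable_continuous_on[OF c]) (intro borel_measurable_Pair assms)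
  also have "(\<lambda>x. (\<lambda>p :: complex \<times> complex. \<chi> j :: 2. if j = 1 then fst p else snd p) (g 1 x, g 2 x)) = (\<lambda>x. \<chi> j. g j x)"
    by (auto simp: vec_eq_iff forall_2)
  finally show ?thesis .
qed

lemma norm_vec2: "norm (z :: complex^2) = sqrt ((norm (z $ 1))\<^sup>2 + (norm (z $ 2))\<^sup>2)"
  by (simp add: norm_vec_def L2_set_def sum_2)

lemma locally_integrable_vec:
  fixes g :: "2 \<Rightarrow> real^2 \<Rightarrow> complex"
  assumes "\<And>j. locally_integrable (g j)" shows "locally_integrable (\<lambda>x. \<chi> j. g j x)"
  unfolding locally_integrable_def set_integrable_def
proof (intro allI impI)
  fix K :: "(real^2) set" assume K: "compact K"
  then have Ks: "K \<in> sets lebesgue" by (simp add: compact_imp_closed borel_closed)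
  have i: "integrable lebesgue (\<lambda>x. indicator K x *\<^sub>R g j x)" for j
    using assms K by (simp add: locally_integrable_def set_integrable_def)
  show "integrable lebesgue (\<lambda>x. indicator K x *\<^sub>R (\<chi> j. g j x))"
  proof (rule Bochner_Integration.integrable_bound)
    show "integrable lebesgue (\<lambda>x. norm (indicator K x *\<^sub>R g 1 x) + norm (indicator K x *\<^sub>R g 2 x))"
      by (intro Bochner_Integration.integrable_add integrable_norm i)
    show "(\<lambda>x. indicator K x *\<^sub>R (\<chi> j. g j x)) \<in> borel_measurable lebesgue"
      using Ks by (intro borel_measurable_scaleR borel_measurable_indicator vec_lambda_measurable
          locally_integrable_measurable assms)
    have "norm (\<chi> j. g j x) \<le> norm (g 1 x) + norm (g 2 x)" for x
      using sqrt_sum_squares_le_sum[of "norm (g 1 x)" "norm (g 2 x)"] by (simp add: norm_vec2)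
    then show "AE x in lebesgue. norm (indicator K x *\<^sub>R (\<chi> j. g j x)) \<le> norm (norm (indicator K x *\<^sub>R g 1 x) + norm (indicator K x *\<^sub>R g 2 x))"
      by (intro AE_I2) (auto simp: indicator_def)
  qed
qed

lemma locally_integrable_nth:
  fixes G :: "real^2 \<Rightarrow> complex^2"
  assumes "locally_integrable G" shows "locally_integrable (\<lambda>x. G x $ j)"
  unfolding locally_integrable_def set_integrable_def
proof (intro allI impI)
  fix K :: "(real^2) set" assume "compact K"
  then have "integrable lebesgue (\<lambda>x. indicator K x *\<^sub>R G x)"
    using assms by (simp add: locally_integrable_def set_integrable_def)
  from integrable_bounded_linear[OF bounded_linear_vec_nth this, of j]
  show "integrable lebesgue (\<lambda>x. indicator K x *\<^sub>R G x $ j)" by simp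
qed

text \<open>The interface between the Lebesgue-measurable functions of the definitions and the Borel
  calculus: \<open>f\<close> is a Borel representative of \<psi>, and the magnetic gradient is
  recovered from its plain weak derivatives as \<open>mag_field A f F\<close>.\<close>

definition magnetic_rep ::
    "(real^2 \<Rightarrow> real^2) \<Rightarrow> (real^2 \<Rightarrow> complex) \<Rightarrow> (real^2 \<Rightarrow> complex) \<Rightarrow> (2 \<Rightarrow> real^2 \<Rightarrow> complex) \<Rightarrow> bool" where
  "magnetic_rep A \<psi> f F \<longleftrightarrow> (AE x in lborel. \<psi> x = f x) \<and> (\<forall>j. weak_dir (axis j 1) f (F j))"

definition mag_field :: "(real^2 \<Rightarrow> real^2) \<Rightarrow> (real^2 \<Rightarrow> complex) \<Rightarrow> (2 \<Rightarrow> real^2 \<Rightarrow> complex) \<Rightarrow> 2 \<Rightarrow> real^2 \<Rightarrow> complex" where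
  "mag_field A f F j x = F j x + \<i> * of_real (A x $ j) * f x"

context
  fixes A :: "real^2 \<Rightarrow> real^2"
  assumes A: "continuous_on UNIV A"
begin

lemma A_nth: "continuous_on UNIV (\<lambda>x. A x $ j)"
  using A by (intro continuous_intros)

lemma loc_int_potential: "loc_int f \<Longrightarrow> loc_int (\<lambda>x. \<i> * of_real (A x $ j) * f x)"
  using loc_int_mult_continuous[of f "\<lambda>x. \<i> * of_real (A x $ j)"] A_nth[of j]
  by (simp add: mult.commute continuous_intros)

lemma loc_int_mag_field: "loc_int f \<Longrightarrow> loc_int (F j) \<Longrightarrow> loc_int (mag_field A f F j)"
  unfolding mag_field_def[abs_def] by (intro loc_int_add loc_int_potential)

text \<open>For continuous \<open>A\<close> the potential term is locally integrable; it occurs on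
  both sides of the distributional identity and cancels, leaving the identity for the plain weak
  derivative.\<close>

lemma magnetic_weak_iff:
  assumes f: "loc_int f" and F: "loc_int (F j)" and t: "test_function \<phi>"
  shows "(LINT x|lborel. mag_field A f F j x * of_real (\<phi> x)) =
      (LINT x|lborel. - f x * of_real (partial j \<phi> x) + \<i> * of_real (A x $ j) * f x * of_real (\<phi> x))
    \<longleftrightarrow> (LINT x|lborel. f x * of_real (dir_deriv (axis j 1) \<phi> x)) = - (LINT x|lborel. F j x * of_real (\<phi> x))"
proof -
  note i = integrable_loc_int_test[OF F t] integrable_loc_int_test[OF loc_int_potential[OF f] t, of j]
    integrable_loc_int_test[OF f test_function_partial[OF t], of j]
  have 1: "(LINT x|lborel. mag_field A f F j x * of_real (\<phi> x)) =
    (LINT x|lborel. F j x * of_real (\<phi> x)) + (LINT x|lborel. \<i> * of_real (A x $ j) * f x * of_real (\<phi> x))"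
    unfolding mag_field_def distrib_right by (rule Bochner_Integration.integral_add[OF i(1,2)])
  have 2: "(LINT x|lborel. - f x * of_real (partial j \<phi> x) + \<i> * of_real (A x $ j) * f x * of_real (\<phi> x)) =
     - (LINT x|lborel. f x * of_real (partial j \<phi> x)) + (LINT x|lborel. \<i> * of_real (A x $ j) * f x * of_real (\<phi> x))"
    using Bochner_Integration.integral_add[OF Bochner_Integration.integrable_minus[OF i(3)] i(2)] by simp
  show ?thesis unfolding 1 2 dir_deriv_axis by (simp add: eq_commute[of "LINT x|lborel. F j x * of_real (\<phi> x)"] neg_eq_iff_add_eq_0 eq_neg_iff_add_eq_0 add.commute)
qed

lemma lebesgue_weak_sides:
  assumes \<psi>: "\<psi> \<in> borel_measurable lebesgue" and f: "loc_int f" "AE x in lborel. \<psi> x = f x"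
    and G: "G \<in> borel_measurable lebesgue" and g: "loc_int g" "AE x in lborel. G x = g x" and t: "test_function \<phi>"
  shows "(LINT x|lebesgue. G x * of_real (\<phi> x)) = (LINT x|lborel. g x * of_real (\<phi> x))"
    and "(LINT x|lebesgue. - \<psi> x * of_real (partial j \<phi> x) + \<i> * of_real (A x $ j) * \<psi> x * of_real (\<phi> x)) =
      (LINT x|lborel. - f x * of_real (partial j \<phi> x) + \<i> * of_real (A x $ j) * f x * of_real (\<phi> x))"
proof -
  have [measurable]: "\<phi> \<in> borel_measurable borel" "partial j \<phi> \<in> borel_measurable borel"
    "(\<lambda>x. A x $ j) \<in> borel_measurable borel" "f \<in> borel_measurable borel" "g \<in> borel_measurable borel"
    using test_function_measurable[OF t] test_function_measurable[OF test_function_partial[OF t]]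
      borel_measurable_continuous_onI[OF A_nth] f g by (auto dest: loc_int_measurable)
  have [measurable]: "\<phi> \<in> borel_measurable lebesgue" "partial j \<phi> \<in> borel_measurable lebesgue"
    "(\<lambda>x. A x $ j) \<in> borel_measurable lebesgue"
    by (auto intro: measurable_completion)
  note [measurable] = \<psi> G
  show "(LINT x|lebesgue. G x * of_real (\<phi> x)) = (LINT x|lborel. g x * of_real (\<phi> x))"
  proof (rule lebesgue_representative(1))
    show "AE x in lborel. G x * of_real (\<phi> x) = g x * of_real (\<phi> x)" using g(2) by eventually_elim simp
  qed measurable
  show "(LINT x|lebesgue. - \<psi> x * of_real (partial j \<phi> x) + \<i> * of_real (A x $ j) * \<psi> x * of_real (\<phi> x)) =
      (LINT x|lborel. - f x * of_real (partial j \<phi> x) + \<i> * of_real (A x $ j) * f x * of_real (\<phi> x))"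
  proof (rule lebesgue_representative(1))
    show "AE x in lborel. - \<psi> x * of_real (partial j \<phi> x) + \<i> * of_real (A x $ j) * \<psi> x * of_real (\<phi> x) =
      - f x * of_real (partial j \<phi> x) + \<i> * of_real (A x $ j) * f x * of_real (\<phi> x)"
      using f(2) by eventually_elim simp
  qed measurable
qed

lemma has_mag_gradientI:
  assumes \<psi>: "\<psi> \<in> borel_measurable lebesgue" and r: "magnetic_rep A \<psi> f F"
  shows "has_mag_gradient A \<psi> (\<lambda>x. \<chi> j. mag_field A f F j x)"
proof -
  have ae: "AE x in lborel. \<psi> x = f x" and w: "weak_dir (axis j 1) f (F j)" for j using r by (auto simp: magnetic_rep_def)
  have L: "loc_int f" "loc_int (F j)" "loc_int (mag_field A f F j)" for j
    using w by (auto simp: weak_dir_def intro: loc_int_mag_field)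
  have m: "mag_field A f F j \<in> borel_measurable lebesgue" for j
    using loc_int_measurable[OF L(3)] by (intro measurable_completion) simp
  show ?thesis
    unfolding has_mag_gradient_def
  proof (intro conjI allI impI)
    show "locally_integrable \<psi>"
      using locally_integrable_iff_loc_int[OF \<psi> loc_int_measurable[OF L(1)] ae] L by simp
    show "locally_integrable (\<lambda>x. \<chi> j. mag_field A f F j x)"
      using locally_integrable_iff_loc_int[OF m loc_int_measurable[OF L(3)] AE_I2[OF refl]] L
      by (intro locally_integrable_vec) simp
    fix \<phi> j assume t: "test_function \<phi>"
    show "(LINT x|lebesgue. (\<chi> j. mag_field A f F j x) $ j * of_real (\<phi> x)) =
       (LINT x|lebesgue. - \<psi> x * of_real (partial j \<phi> x) + \<i> * of_real (A x $ j) * \<psi> x * of_real (\<phi> x))"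
      using lebesgue_weak_sides(1)[OF \<psi> L(1) ae m[of j] L(3)[of j] AE_I2[OF refl] t]
        lebesgue_weak_sides(2)[OF \<psi> L(1) ae m[of j] L(3)[of j] AE_I2[OF refl] t, where j=j] magnetic_weak_iff[where F=F and j=j, OF L(1,2) t] weak_dir_test[OF w t, of j]
      by simp
  qed
qed

lemma has_mag_gradientE:
  assumes h: "has_mag_gradient A \<psi> G"
  obtains f F where "magnetic_rep A \<psi> f F" "\<And>j. AE x in lborel. G x $ j = mag_field A f F j x"
proof -
  have l: "locally_integrable \<psi>" "locally_integrable (\<lambda>x. G x $ j)" for j
    using h locally_integrable_nth by (auto simp: has_mag_gradient_def)
  note m = l[THEN locally_integrable_measurable]
  obtain f where f: "f \<in> borel_measurable borel" "AE x in lborel. \<psi> x = f x"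
    using borel_representative[OF m(1)] by blast
  have "\<exists>g. g \<in> borel_measurable borel \<and> (AE x in lborel. G x $ j = g x)" for j
    using borel_representative[OF m(2)] by metis
  then obtain g where g: "\<And>j. g j \<in> borel_measurable borel" "\<And>j. AE x in lborel. G x $ j = g j x" by metis
  \<comment> \<open>Subtracting the potential term from a Borel representative of the magnetic
    gradient leaves the candidate for the plain weak derivative.\<close>
  define F where "F j x = g j x - \<i> * of_real (A x $ j) * f x" for j x
  have lf: "loc_int f" using locally_integrable_iff_loc_int[OF m(1) f] l by simp
  have lg: "loc_int (g j)" for j using locally_integrable_iff_loc_int[OF m(2) g] l by simp
  have lF: "loc_int (F j)" for j unfolding F_def[abs_def] by (intro loc_int_diff lg loc_int_potential lf)
  have e: "mag_field A f F j = g j" for j by (auto simp: mag_field_def F_def)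
  show ?thesis
  proof
    show "AE x in lborel. G x $ j = mag_field A f F j x" for j unfolding e by (rule g)
    have "weak_dir (axis j 1) f (F j)" for j
      unfolding weak_dir_def
    proof (intro conjI lf lF allI impI)
      fix \<phi> assume t: "test_function \<phi>"
      have "(LINT x|lebesgue. G x $ j * of_real (\<phi> x)) =
       (LINT x|lebesgue. - \<psi> x * of_real (partial j \<phi> x) + \<i> * of_real (A x $ j) * \<psi> x * of_real (\<phi> x))"
        using h t by (simp add: has_mag_gradient_def)
      then show "(LINT x|lborel. f x * of_real (dir_deriv (axis j 1) \<phi> x)) = - (LINT x|lborel. F j x * of_real (\<phi> x))"
        using lebesgue_weak_sides(1)[OF m(1) lf f(2) m(2)[of j] lg[of j] g(2)[of j] t]
          lebesgue_weak_sides(2)[OF m(1) lf f(2) m(2)[of j] lg[of j] g(2)[of j] t, where j=j] magnetic_weak_iff[where F=F and j=j, OF lf lF t]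
        by (simp add: e)
    qed
    then show "magnetic_rep A \<psi> f F" using f by (simp add: magnetic_rep_def)
  qed
qed

text \<open>Weak derivatives of almost equal functions have the same pairings with test functions,
  so \<open>fundamental\<close> identifies them. This makes the norm of the gradient selected by
  \<open>SOME\<close> computable from any representative.\<close>

lemma magnetic_rep_unique:
  assumes r: "magnetic_rep A \<psi> f F" "magnetic_rep A \<psi> f' F'"
  shows "AE x in lborel. mag_field A f F j x = mag_field A f' F' j x"
proof -
  have ae: "AE x in lborel. \<psi> x = f x" "AE x in lborel. \<psi> x = f' x"
    and w: "weak_dir (axis j 1) f (F j)" "weak_dir (axis j 1) f' (F' j)" using r by (auto simp: magnetic_rep_def)
  have ff: "AE x in lborel. f x = f' x" using ae by eventually_elim simp
  have L: "loc_int f" "loc_int f'" "loc_int (F j)" "loc_int (F' j)" using w by (auto simp: weak_dir_def)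
  have "AE x in lborel. F j x - F' j x = 0"
  proof (rule fundamental)
    show "loc_int (\<lambda>x. F j x - F' j x)" by (intro loc_int_diff L)
    fix \<phi> assume t: "test_function \<phi>"
    note [measurable] = L[THEN loc_int_measurable] test_function_measurable[OF test_function_dir_deriv[OF t]]
    have "(LINT x|lborel. f x * of_real (dir_deriv (axis j 1) \<phi> x)) = (LINT x|lborel. f' x * of_real (dir_deriv (axis j 1) \<phi> x))"
      by (rule integral_cong_AE) (measurable, use ff in eventually_elim, simp)
    then show "(LINT x|lborel. (F j x - F' j x) * of_real (\<phi> x)) = 0"
      using integrable_loc_int_test[OF L(3) t] integrable_loc_int_test[OF L(4) t]
      by (simp add: left_diff_distrib weak_dir_test[OF w(1) t] weak_dir_test[OF w(2) t])
  qed
  with ff show ?thesis by eventually_elim (simp add: mag_field_def)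
qed

end

text \<open>Only \<open>norm (f x)\<close> enters, so one statement serves scalar functions and
  vector-valued gradients alike. The square of the norm shows up as the exponent
  \<open>2 / q\<close>.\<close>

lemma Lnorm_representative:
  fixes f :: "real^2 \<Rightarrow> 'b::euclidean_space"
  assumes f: "f \<in> borel_measurable lebesgue" and g: "g \<in> borel_measurable borel" and ae: "AE x in lborel. norm (f x) = g x"
  shows "f \<in> Lspace q \<longleftrightarrow> integrable lborel (\<lambda>x. g x powr q)"
    and "(Lnorm q f)\<^sup>2 = (if integrable lborel (\<lambda>x. g x powr q) then ereal ((LINT x|lborel. g x powr q) powr (2 / q)) else \<infinity>)"
proof -
  have f': "(\<lambda>x. norm (f x) powr q) \<in> borel_measurable lebesgue" using f by measurable
  have g': "(\<lambda>x. g x powr q) \<in> borel_measurable borel" using g by measurable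
  have ae': "AE x in lborel. norm (f x) powr q = g x powr q" using ae by eventually_elim simp
  note e = lebesgue_representative[OF f' g' ae']
  show *: "f \<in> Lspace q \<longleftrightarrow> integrable lborel (\<lambda>x. g x powr q)"
    using f e by (simp add: Lspace_def)
  show "(Lnorm q f)\<^sup>2 = (if integrable lborel (\<lambda>x. g x powr q) then ereal ((LINT x|lborel. g x powr q) powr (2 / q)) else \<infinity>)"
    using * e(1) by (auto simp: Lnorm_def power2_eq_square simp flip: powr_add)
qed

lemma powr_2_nonneg: "0 \<le> x \<Longrightarrow> x powr 2 = (x::real)\<^sup>2"
  by (cases "x = 0") auto

section \<open>The lower bound\<close>

definition H1_rep ::
    "(real^2 \<Rightarrow> real^2) \<Rightarrow> (real^2 \<Rightarrow> complex) \<Rightarrow> (real^2 \<Rightarrow> complex) \<Rightarrow> (2 \<Rightarrow> real^2 \<Rightarrow> complex) \<Rightarrow> bool" where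
  "H1_rep A \<psi> f F \<longleftrightarrow> \<psi> \<in> borel_measurable lebesgue \<and> magnetic_rep A \<psi> f F \<and> sq_int f \<and>
     (\<forall>j. sq_int (mag_field A f F j))"

definition Lp_int :: "real \<Rightarrow> (real^2 \<Rightarrow> complex) \<Rightarrow> real" where
  "Lp_int p f = (LINT x|lborel. norm (f x) powr p)"

lemma norm_mag_gradient:
  assumes A: "continuous_on UNIV A" and r: "magnetic_rep A \<psi> f F" and h: "has_mag_gradient A \<psi> G"
  shows "AE x in lborel. norm (G x) = sqrt ((norm (mag_field A f F 1 x))\<^sup>2 + (norm (mag_field A f F 2 x))\<^sup>2)"
proof -
  obtain f' F' where r': "magnetic_rep A \<psi> f' F'" and g: "\<And>j. AE x in lborel. G x $ j = mag_field A f' F' j x"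
    using has_mag_gradientE[OF A h] by metis
  show ?thesis
    using g[of 1] g[of 2] magnetic_rep_unique[OF A r r', of 1] magnetic_rep_unique[OF A r r', of 2]
    by eventually_elim (simp add: norm_vec2)
qed

lemma sqrt_sum_squares_powr_2: "sqrt (a\<^sup>2 + b\<^sup>2) powr 2 = a\<^sup>2 + b\<^sup>2"
  by (simp add: powr_2_nonneg)

lemma H1_rep_gradient:
  assumes A: "continuous_on UNIV A" and r: "H1_rep A \<psi> f F" and h: "has_mag_gradient A \<psi> G"
  shows "G \<in> Lspace 2" "(Lnorm 2 G)\<^sup>2 = ereal (\<Sum>j\<in>UNIV. sq_norm (mag_field A f F j))"
proof -
  have m: "magnetic_rep A \<psi> f F" and s: "sq_int (mag_field A f F j)" for j
    using r by (auto simp: H1_rep_def)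
  note [measurable] = sq_int_measurable[OF s]
  have G: "G \<in> borel_measurable lebesgue"
    using h by (auto simp: has_mag_gradient_def intro: locally_integrable_measurable)
  let ?g = "\<lambda>x. sqrt ((norm (mag_field A f F 1 x))\<^sup>2 + (norm (mag_field A f F 2 x))\<^sup>2)"
  have g: "?g \<in> borel_measurable borel" by measurable
  have i: "integrable lborel (\<lambda>x. (norm (mag_field A f F j x))\<^sup>2)" for j
    using s by (simp add: sq_int_def)
  note L = Lnorm_representative[OF G g norm_mag_gradient[OF A m h], of 2, unfolded sqrt_sum_squares_powr_2]
  show "G \<in> Lspace 2" using L(1) i by simp
  have "0 \<le> (\<Sum>j\<in>UNIV. sq_norm (mag_field A f F j))" by (simp add: sum_nonneg sq_norm_nonneg)
  then show "(Lnorm 2 G)\<^sup>2 = ereal (\<Sum>j\<in>UNIV. sq_norm (mag_field A f F j))"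
    using L(2) i by (simp add: sum_2 sq_norm_def)
qed

text \<open>Turns the extended-real terms of the definitions into integrals over Borel functions.
  Only the \<open>L^p\<close> norm can be infinite, because membership in \<open>L^p\<close> is not
  part of \<open>H1_mag\<close>.\<close>

lemma H1_rep_norms:
  assumes A: "continuous_on UNIV A" and r: "H1_rep A \<psi> f F"
  shows "\<psi> \<in> H1_mag A"
    and "(Lnorm 2 \<psi>)\<^sup>2 = ereal (sq_norm f)"
    and "(Lnorm 2 (mag_gradient A \<psi>))\<^sup>2 = ereal (\<Sum>j\<in>UNIV. sq_norm (mag_field A f F j))"
    and "(Lnorm p \<psi>)\<^sup>2 = (if integrable lborel (\<lambda>x. norm (f x) powr p) then ereal (Lp_int p f powr (2 / p)) else \<infinity>)"
proof -
  have \<psi>: "\<psi> \<in> borel_measurable lebesgue" and m: "magnetic_rep A \<psi> f F" and f: "sq_int f"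
    using r by (auto simp: H1_rep_def)
  have nf: "(\<lambda>x. norm (f x)) \<in> borel_measurable borel" using sq_int_measurable[OF f] by simp
  have ae: "AE x in lborel. norm (\<psi> x) = norm (f x)"
    using m by (auto simp: magnetic_rep_def elim: eventually_mono)
  note L = Lnorm_representative[OF \<psi> nf ae]
  have if2: "integrable lborel (\<lambda>x. norm (f x) powr 2)" using f by (simp add: sq_int_def powr_2_nonneg)
  show "(Lnorm 2 \<psi>)\<^sup>2 = ereal (sq_norm f)"
    unfolding L(2) using if2 sq_norm_nonneg[of f] by (simp add: sq_norm_def powr_2_nonneg)
  show "(Lnorm p \<psi>)\<^sup>2 = (if integrable lborel (\<lambda>x. norm (f x) powr p) then ereal (Lp_int p f powr (2 / p)) else \<infinity>)"
    unfolding L(2) Lp_int_def ..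
  have h: "has_mag_gradient A \<psi> (\<lambda>x. \<chi> j. mag_field A f F j x)"
    by (rule has_mag_gradientI[OF A \<psi> m])
  then show "\<psi> \<in> H1_mag A"
    using L(1) if2 H1_rep_gradient(1)[OF A r h] by (auto simp: H1_mag_def)
  \<comment> \<open>A magnetic gradient has just been exhibited, so the choice made by
    \<open>SOME\<close> is one too.\<close>
  from h have "has_mag_gradient A \<psi> (mag_gradient A \<psi>)"
    unfolding mag_gradient_def by (rule someI[where P="has_mag_gradient A \<psi>"])
  then show "(Lnorm 2 (mag_gradient A \<psi>))\<^sup>2 = ereal (\<Sum>j\<in>UNIV. sq_norm (mag_field A f F j))"
    by (rule H1_rep_gradient(2)[OF A r])
qed

lemma H1_magE:
  assumes A: "continuous_on UNIV A" and \<psi>: "\<psi> \<in> H1_mag A"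
  obtains f F where "H1_rep A \<psi> f F"
proof -
  obtain G where G: "has_mag_gradient A \<psi> G" "G \<in> Lspace 2" and L: "\<psi> \<in> Lspace 2"
    using \<psi> by (auto simp: H1_mag_def)
  obtain f F where r: "magnetic_rep A \<psi> f F" using has_mag_gradientE[OF A G(1)] by metis
  then have ae: "AE x in lborel. \<psi> x = f x" and w: "weak_dir (axis j 1) f (F j)" for j
    by (auto simp: magnetic_rep_def)
  have l: "loc_int f" "loc_int (mag_field A f F j)" for j
    using w by (auto simp: weak_dir_def intro: loc_int_mag_field[OF A])
  note [measurable] = l[THEN loc_int_measurable]
  have m: "\<psi> \<in> borel_measurable lebesgue" "G \<in> borel_measurable lebesgue" using L G by (auto simp: Lspace_def)
  have nf: "AE x in lborel. norm (\<psi> x) = norm (f x)" using ae by eventually_elim simp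
  have "integrable lborel (\<lambda>x. norm (f x) powr 2)"
    using Lnorm_representative(1)[OF m(1) _ nf, of 2] L by simp
  then have f: "sq_int f" by (simp add: sq_int_def powr_2_nonneg)
  have i: "integrable lborel (\<lambda>x. (norm (mag_field A f F 1 x))\<^sup>2 + (norm (mag_field A f F 2 x))\<^sup>2)"
    using Lnorm_representative(1)[OF m(2) _ norm_mag_gradient[OF A r G(1)], of 2] G(2)
    by (simp add: sqrt_sum_squares_powr_2)
  have "sq_int (mag_field A f F j)" for j
    unfolding sq_int_def
  proof
    show "integrable lborel (\<lambda>x. (norm (mag_field A f F j x))\<^sup>2)"
      by (rule Bochner_Integration.integrable_bound[OF i]) (use exhaust_2[of j] in auto)
  qed measurable
  then show ?thesis using that[of f F] m r f by (simp add: H1_rep_def)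
qed

lemma H1_rep_refl:
  assumes "\<And>j. weak_dir (axis j 1) f (F j)" "sq_int f" "\<And>j. sq_int (mag_field A f F j)"
  shows "H1_rep A f f F"
  unfolding H1_rep_def magnetic_rep_def
  using assms by (auto intro!: measurable_completion dest: sq_int_measurable)

lemma sq_norm_eq_0_imp_AE: "sq_int f \<Longrightarrow> sq_norm f = 0 \<Longrightarrow> AE x in lborel. f x = 0"
  using integral_nonneg_eq_0_iff_AE[of lborel "\<lambda>x. (norm (f x))\<^sup>2"] by (simp add: sq_int_def sq_norm_def)

lemma AE_eq_0_imp_sq_norm: "AE x in lborel. f x = 0 \<Longrightarrow> sq_norm f = 0"
  unfolding sq_norm_def by (rule integral_eq_zero_AE) (auto elim: eventually_mono)

text \<open>A bump function is a competitor with all norms finite and a positive square norm. It is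
  needed twice: to keep the infimum in \<open>C_opt\<close> finite and to bound the admissible
  values for \<open>nu_mag\<close> from above.\<close>

lemma H1_rep_witness:
  assumes A: "\<And>j. smooth (\<lambda>x. A x $ j)" and p: "1 \<le> p"
  obtains f F where "H1_rep A f f F" "0 < sq_norm f" "integrable lborel (\<lambda>x. norm (f x) powr p)"
proof -
  define a b :: "real^2" where "a = (\<chi> i. - 1)" and "b = (\<chi> i. 1)"
  define \<phi> where "\<phi> = box_bump 1 a b"
  have t: "test_function \<phi>" by (simp add: \<phi>_def test_function_box_bump)
  then have s: "smooth \<phi>" by (simp add: test_function_iff)
  define f where "f x = complex_of_real (\<phi> x)" for x
  define F where "F j x = complex_of_real (partial j \<phi> x)" for j x
  have w: "weak_dir (axis j 1) f (F j)" for j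
    using weak_dir_smooth[OF s, of "axis j 1"] by (simp add: f_def[abs_def] F_def[abs_def] dir_deriv_axis)
  have f: "sq_int f" unfolding f_def[abs_def] by (rule sq_int_test[OF t])
  have "sq_int (mag_field A f F j)" for j
  proof -
    have "sq_int (\<lambda>x. complex_of_real (partial j \<phi> x) + \<i> * complex_of_real (A x $ j * \<phi> x))"
      by (intro sq_int_add sq_int_cmult sq_int_test test_function_partial test_function_mult t A)
    then show ?thesis by (simp add: mag_field_def[abs_def] f_def F_def mult.assoc)
  qed
  with w f have r: "H1_rep A f f F" by (rule H1_rep_refl)
  have "sq_norm f \<noteq> 0"
  proof
    assume "sq_norm f = 0"
    from sq_norm_eq_0_imp_AE[OF f this] have "AE x in lborel. x \<notin> box a b"
      by eventually_elim (simp add: f_def \<phi>_def box_bump_pos_iff)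
    then have "AE x in lebesgue. x \<in> - box a b" by (auto intro: AE_completion)
    \<comment> \<open>A closed set of full measure is the whole plane, but this one misses the
      origin.\<close>
    then have "0 \<in> - box a b" by (intro mem_closed_if_AE_lebesgue closed_Compl open_box)
    then show False by (simp add: mem_box_vec2 a_def b_def)
  qed
  then have n: "0 < sq_norm f" using sq_norm_nonneg[of f] by linarith
  have "integrable lborel (\<lambda>x. norm (f x) powr p)"
  proof (rule Bochner_Integration.integrable_bound)
    note [measurable] = sq_int_measurable[OF f]
    show "integrable lborel f"
      using integrable_loc_int_test[OF loc_int_const[of 1] t] by (simp add: f_def[abs_def])
    show "(\<lambda>x. norm (f x) powr p) \<in> borel_measurable lborel" by measurable
    have "norm (norm (f x) powr p) \<le> norm (f x)" for x
      using box_bump_range[of 1 a b x] p powr_mono'[of 1 p "\<phi> x"]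
      by (auto simp: f_def \<phi>_def)
    then show "AE x in lborel. norm (norm (f x) powr p) \<le> norm (f x)" by simp
  qed
  with r n show ?thesis by (rule that)
qed

lemma mag_field_0: "mag_field (\<lambda>x. 0) f F = F"
  by (intro ext) (simp add: mag_field_def)

text \<open>\<open>real_of_ereal\<close> would return 0 on an infinite infimum. The bump function
  bounds the infimum from above and \<open>sq_norm_le_gradient_Lp\<close> bounds it from below by
  1/4, so it is a positive real number and really a lower bound for all quotients.\<close>

lemma C_opt_interpolates:
  assumes p: "1 < p" "p < 2"
  shows "0 < C_opt p" "interpolates p (C_opt p)"
proof -
  define K where "K = {u \<in> H1. \<not> (AE x in lebesgue. u x = 0)}"
  define Q where "Q u = ((Lnorm 2 (gradient u))\<^sup>2 + (Lnorm p u)\<^sup>2) / (Lnorm 2 u)\<^sup>2" for u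
  have A: "continuous_on UNIV (\<lambda>x. 0 :: real^2)" by simp
  note norms = H1_rep_norms[OF A, unfolded mag_field_0]
  have C: "C_opt p = real_of_ereal (INF u\<in>K. Q u)" by (simp add: C_opt_def K_def Q_def)
  have Q: "Q u = (if integrable lborel (\<lambda>x. norm (f x) powr p)
      then ereal (((\<Sum>j\<in>UNIV. sq_norm (F j)) + Lp_int p f powr (2 / p)) / sq_norm f) else \<infinity>)"
    if "H1_rep (\<lambda>x. 0) u f F" "0 < sq_norm f" for u f F
    using that(2) by (simp add: Q_def norms(2,3)[OF that(1)] norms(4)[OF that(1), of p])
  have mem: "u \<in> K \<longleftrightarrow> 0 < sq_norm f" if r: "H1_rep (\<lambda>x. 0) u f F" for u f F
  proof -
    have ae: "AE x in lborel. u x = f x" and f: "sq_int f" using r by (auto simp: H1_rep_def magnetic_rep_def)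
    have "(AE x in lebesgue. u x = 0) \<longleftrightarrow> (AE x in lborel. u x = 0)"
      by (simp add: AE_completion_iff)
    also have "\<dots> \<longleftrightarrow> (AE x in lborel. f x = 0)"
      using ae by (intro iffI; elim AE_mp) (auto elim: eventually_mono)
    also have "\<dots> \<longleftrightarrow> sq_norm f = 0"
      using sq_norm_eq_0_imp_AE[OF f] AE_eq_0_imp_sq_norm by blast
    finally show ?thesis using norms(1)[OF r] sq_norm_nonneg[of f] by (auto simp: K_def)
  qed
  \<comment> \<open>The value 1/4 comes from \<open>4 * S + 2 * P \<le> 4 * (S + P)\<close>, with
    \<open>S\<close> and \<open>P\<close> the gradient and \<open>L^p\<close> terms. A function
    outside \<open>L^p\<close> has an infinite quotient.\<close>
  have lower: "ereal (1 / 4) \<le> Q u" if u: "u \<in> K" for u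
  proof -
    obtain f F where r: "H1_rep (\<lambda>x. 0) u f F" using H1_magE[OF A] u by (auto simp: K_def)
    then have n: "0 < sq_norm f" using mem u by blast
    have "1 / 4 \<le> ((\<Sum>j\<in>UNIV. sq_norm (F j)) + Lp_int p f powr (2 / p)) / sq_norm f"
      if i: "integrable lborel (\<lambda>x. norm (f x) powr p)"
    proof -
      have le: "sq_norm f \<le> 4 * (\<Sum>j\<in>UNIV. sq_norm (F j)) + 2 * Lp_int p f powr (2 / p)"
        unfolding Lp_int_def
        by (rule sq_norm_le_gradient_Lp) (use r p i in \<open>auto simp: H1_rep_def magnetic_rep_def mag_field_0\<close>)
      have "s \<le> 4 * (S + P)" if "s \<le> 4 * S + 2 * P" "0 \<le> P" for s S P :: real
        using that by (simp add: distrib_left)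
      from this[OF le powr_ge_zero]
      have "sq_norm f \<le> 4 * ((\<Sum>j\<in>UNIV. sq_norm (F j)) + Lp_int p f powr (2 / p))" .
      then show ?thesis using n by (simp add: pos_le_divide_eq)
    qed
    then show ?thesis using Q[OF r n] by auto
  qed
  obtain f0 F0 where w: "H1_rep (\<lambda>x. 0) f0 f0 F0" "0 < sq_norm f0" "integrable lborel (\<lambda>x. norm (f0 x) powr p)"
    using H1_rep_witness[of "\<lambda>x. 0" p] p smooth_const[of 0] by auto
  have "(INF u\<in>K. Q u) \<le> Q f0" using mem w by (intro INF_lower) blast
  moreover have "ereal (1 / 4) \<le> (INF u\<in>K. Q u)" by (intro INF_greatest lower)
  ultimately obtain c where c: "(INF u\<in>K. Q u) = ereal c" "1 / 4 \<le> c"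
    using Q[OF w(1,2)] w(3) by (cases "INF u\<in>K. Q u") auto
  then show "0 < C_opt p" by (simp add: C)
  show "interpolates p (C_opt p)"
    unfolding interpolates_def
  proof (intro allI impI)
    fix u F assume h: "\<forall>j. weak_dir (axis j 1) u (F j)" "sq_int u" "\<forall>j. sq_int (F j)"
      and i: "integrable lborel (\<lambda>x. norm (u x) powr p)"
    have r: "H1_rep (\<lambda>x. 0) u u F" using h by (intro H1_rep_refl) (auto simp: mag_field_0)
    show "C_opt p * sq_norm u \<le> (\<Sum>j\<in>UNIV. sq_norm (F j)) + (LINT x|lborel. norm (u x) powr p) powr (2 / p)"
    proof (cases "sq_norm u = 0")
      case False
      then have n: "0 < sq_norm u" using sq_norm_nonneg[of u] by linarith
      then have "(INF u\<in>K. Q u) \<le> Q u" using mem[OF r] by (intro INF_lower) blast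
      then have "c \<le> ((\<Sum>j\<in>UNIV. sq_norm (F j)) + Lp_int p u powr (2 / p)) / sq_norm u"
        unfolding c(1) Q[OF r n] using i by simp
      then show ?thesis using n by (simp add: C c(1) Lp_int_def field_simps)
    qed (simp add: sum_nonneg sq_norm_nonneg)
  qed
qed

text \<open>Clearing the denominator replaces a quotient that is singular at 1 by \<open>h\<close>,
  which is continuous on the closed interval, equals \<open>- K\<close> at 0 and 1 at 1, and is
  strictly increasing in between.\<close>

lemma ex1_c_star:
  fixes K p :: real
  assumes K: "0 < K" and p: "0 < p"
  shows "\<exists>!c. 0 < c \<and> c < 1 \<and> c / (1 - c\<^sup>2) powr (p / 2) = K"
proof -
  define h where "h c = c - K * (1 - c\<^sup>2) powr (p / 2)" for c
  have sq: "c\<^sup>2 < 1" if "0 < c" "c < 1" for c :: real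
    using that by (simp add: power2_eq_square mult_strict_mono'[of c 1 c 1, simplified])
  have iff: "c / (1 - c\<^sup>2) powr (p / 2) = K \<longleftrightarrow> h c = 0" if "0 < c" "c < 1" for c
    using sq[OF that] by (simp add: h_def divide_eq_eq)
  have cont: "continuous_on {0..1} h"
  proof -
    have "0 \<le> 1 - c\<^sup>2" if "c \<in> {0..1}" for c :: real using that by (simp add: power_le_one)
    then show ?thesis
      unfolding h_def using p by (intro continuous_intros continuous_on_powr') auto
  qed
  have "h 0 \<le> 0" "0 \<le> h 1" using K p by (simp_all add: h_def)
  then obtain c where c: "0 \<le> c" "c \<le> 1" "h c = 0"
    using IVT'[OF _ _ _ cont, of 0] by auto
  have "c \<noteq> 0" "c \<noteq> 1" using c(3) K p by (auto simp: h_def)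
  with c have ex: "0 < c" "c < 1" "h c = 0" by auto
  have mono: "h a < h b" if "0 < a" "a < b" "b < 1" for a b
  proof -
    have "a\<^sup>2 < b\<^sup>2" "b\<^sup>2 < 1" using that sq[of b] by (auto intro: power_strict_mono)
    then have "(1 - b\<^sup>2) powr (p / 2) \<le> (1 - a\<^sup>2) powr (p / 2)" using p by (intro powr_mono2) auto
    then have "K * (1 - b\<^sup>2) powr (p / 2) \<le> K * (1 - a\<^sup>2) powr (p / 2)" using K by (simp add: mult_left_mono)
    then show ?thesis using that by (simp add: h_def)
  qed
  show ?thesis
  proof (rule ex1I[of _ c])
    show "0 < c \<and> c < 1 \<and> c / (1 - c\<^sup>2) powr (p / 2) = K" using ex iff by blast
    fix d assume d: "0 < d \<and> d < 1 \<and> d / (1 - d\<^sup>2) powr (p / 2) = K"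
    then have "h d = 0" using iff by blast
    with d ex show "d = c" using mono[of c d] mono[of d c] by (cases c d rule: linorder_cases) auto
  qed
qed

lemma continuous_mag_potential: "continuous_on UNIV (mag_potential B)"
proof -
  have "continuous_on UNIV (\<lambda>x. \<chi> j. mag_potential B x $ j)"
    by (intro continuous_on_vec_lambda smooth_continuous smooth_mag_potential)
  then show ?thesis by simp
qed

text \<open>The interpolation inequality is applied to the modulus of \<open>f\<close> with
  parameter \<open>\<beta> / d\<close>, where \<open>d = 1 - c\<^sup>2\<close>. Multiplied by
  \<open>d\<close>, its gradient term is the one in the Loss-Thaller inequality, its
  \<open>L^p\<close> term has coefficient \<open>\<beta>\<close>, and its left-hand side carries
  \<open>d * (\<beta> / d) powr (p / 2)\<close>, which is
  \<open>\<beta> powr (p / 2) * d powr (1 - p / 2)\<close>.\<close>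

lemma magnetic_lower_bound:
  assumes r: "H1_rep (mag_potential B) \<psi> f F" and i: "integrable lborel (\<lambda>x. norm (f x) powr p)"
    and C: "interpolates p C" and p: "1 < p" and \<beta>: "0 < \<beta>" and c: "0 < c" "c < 1"
  shows "(c * B + C * \<beta> powr (p / 2) * (1 - c\<^sup>2) powr (1 - p / 2)) * sq_norm f
    \<le> (\<Sum>j\<in>UNIV. sq_norm (mag_field (mag_potential B) f F j)) + \<beta> * Lp_int p f powr (2 / p)"
proof -
  interpret magnetic B f F "mag_field (mag_potential B) f F"
    using r by unfold_locales (auto simp: H1_rep_def magnetic_rep_def mag_field_def)
  define d where "d = 1 - c\<^sup>2"
  have d: "0 < d" using c by (simp add: d_def power2_eq_square mult_strict_mono'[of c 1 c 1, simplified])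
  have "C * (\<beta> / d) powr (p / 2) * sq_norm (\<lambda>x. of_real (norm (f x))) \<le>
      (\<Sum>j\<in>UNIV. sq_norm (\<lambda>x. of_real (g j x))) + (\<beta> / d) * (LINT x|lborel. norm (complex_of_real (norm (f x))) powr p) powr (2 / p)"
    by (rule interpolates_scaled[OF C p _ weak_dir_norm_magnetic sq_int_norm sq_int_g]) (use \<beta> d i in auto)
  also have "sq_norm (\<lambda>x. of_real (norm (f x))) = sq_norm f" by (simp add: sq_norm_def)
  also have "(LINT x|lborel. norm (complex_of_real (norm (f x))) powr p) = Lp_int p f" by (simp add: Lp_int_def)
  finally have "d * (C * (\<beta> / d) powr (p / 2) * sq_norm f) \<le>
      d * ((\<Sum>j\<in>UNIV. sq_norm (\<lambda>x. of_real (g j x))) + (\<beta> / d) * Lp_int p f powr (2 / p))"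
    using d by (intro mult_left_mono) auto
  moreover have "d * (C * (\<beta> / d) powr (p / 2) * sq_norm f) = C * \<beta> powr (p / 2) * d powr (1 - p / 2) * sq_norm f"
    using d \<beta> by (simp add: powr_divide powr_diff)
  moreover have "d * ((\<Sum>j\<in>UNIV. sq_norm (\<lambda>x. of_real (g j x))) + (\<beta> / d) * Lp_int p f powr (2 / p)) =
      d * (\<Sum>j\<in>UNIV. sq_norm (\<lambda>x. of_real (g j x))) + \<beta> * Lp_int p f powr (2 / p)"
    using d by (simp add: distrib_left)
  moreover have "c * B * sq_norm f + d * (\<Sum>j\<in>UNIV. sq_norm (\<lambda>x. of_real (g j x))) \<le> (\<Sum>j\<in>UNIV. sq_norm (mag_field (mag_potential B) f F j))"
    using Loss_Thaller[of c] c by (simp add: d_def)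
  ultimately show ?thesis by (simp add: d_def[symmetric] distrib_right)
qed

theorem proposition4p3:
  fixes B p \<beta> :: real
  assumes "B > 0" and "1 < p" and "p < 2" and "\<beta> > 0"
  shows "(\<exists>!c. is_c_star B p \<beta> c) \<and> nu_mag B p \<beta> \<ge> nu_LT B p \<beta>"
proof
  note C = C_opt_interpolates[OF assms(2,3)]
  have "0 < B / ((2 - p) * C_opt p * \<beta> powr (p / 2))" using assms C(1) by simp
  from ex1_c_star[OF this, of p] show ex: "\<exists>!c. is_c_star B p \<beta> c"
    using assms by (simp add: is_c_star_def)
  define c where "c = c_star B p \<beta>"
  have "is_c_star B p \<beta> c" unfolding c_def c_star_def by (rule theI'[OF ex])
  then have c: "0 < c" "c < 1" by (auto simp: is_c_star_def)
  let ?A = "mag_potential B"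
  define S where "S \<nu> \<longleftrightarrow> (\<forall>\<psi>\<in>H1_mag ?A. (Lnorm 2 (mag_gradient ?A \<psi>))\<^sup>2 + ereal \<beta> * (Lnorm p \<psi>)\<^sup>2 \<ge> ereal \<nu> * (Lnorm 2 \<psi>)\<^sup>2)" for \<nu>
  have nu: "nu_mag B p \<beta> = Greatest S" by (simp add: nu_mag_def S_def[abs_def])
  note norms = H1_rep_norms[OF continuous_mag_potential]
  \<comment> \<open>If \<psi> is not in \<open>L^p\<close>, the left-hand side of its inequality is
    infinite because \<open>\<beta> > 0\<close>, so only functions in \<open>L^p\<close> impose a
    condition, and for them all terms are real.\<close>
  have S: "S \<nu> \<longleftrightarrow> (\<forall>\<psi> f F. H1_rep ?A \<psi> f F \<longrightarrow> integrable lborel (\<lambda>x. norm (f x) powr p) \<longrightarrow>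
      \<nu> * sq_norm f \<le> (\<Sum>j\<in>UNIV. sq_norm (mag_field ?A f F j)) + \<beta> * Lp_int p f powr (2 / p))" for \<nu>
  proof -
    have "(Lnorm 2 (mag_gradient ?A \<psi>))\<^sup>2 + ereal \<beta> * (Lnorm p \<psi>)\<^sup>2 \<ge> ereal \<nu> * (Lnorm 2 \<psi>)\<^sup>2 \<longleftrightarrow>
      (integrable lborel (\<lambda>x. norm (f x) powr p) \<longrightarrow>
      \<nu> * sq_norm f \<le> (\<Sum>j\<in>UNIV. sq_norm (mag_field ?A f F j)) + \<beta> * Lp_int p f powr (2 / p))"
      if "H1_rep ?A \<psi> f F" for \<psi> f F
      using assms by (simp add: norms(2,3)[OF that] norms(4)[OF that, of p])
    then show ?thesis
      unfolding S_def using norms(1) H1_magE[OF continuous_mag_potential] by metis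
  qed
  have LT: "S (nu_LT B p \<beta>)"
    unfolding S nu_LT_def c_def[symmetric]
    using magnetic_lower_bound[OF _ _ C(2) assms(2,4) c] by blast
  obtain f0 F0 where w: "H1_rep ?A f0 f0 F0" "0 < sq_norm f0" "integrable lborel (\<lambda>x. norm (f0 x) powr p)"
    using H1_rep_witness[OF smooth_mag_potential] assms by (metis less_imp_le)
  \<comment> \<open>Any single nonzero function with finite norms caps the admissible values by its
    quotient.\<close>
  have bdd: "bdd_above {\<nu>. S \<nu>}"
  proof (rule bdd_aboveI)
    fix \<nu> assume "\<nu> \<in> {\<nu>. S \<nu>}"
    then have "\<nu> * sq_norm f0 \<le> (\<Sum>j\<in>UNIV. sq_norm (mag_field ?A f0 F0 j)) + \<beta> * Lp_int p f0 powr (2 / p)"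
      using S w by blast
    then show "\<nu> \<le> ((\<Sum>j\<in>UNIV. sq_norm (mag_field ?A f0 F0 j)) + \<beta> * Lp_int p f0 powr (2 / p)) / sq_norm f0"
      using w(2) by (simp add: pos_le_divide_eq)
  qed
  define s where "s = Sup {\<nu>. S \<nu>}"
  have upper: "\<nu> \<le> s" if "S \<nu>" for \<nu> unfolding s_def using that bdd by (intro cSup_upper) auto
  \<comment> \<open>Each function restricts \<nu> to a closed half-line, so the supremum is
    admissible as well and \<open>GREATEST\<close> denotes an attained maximum.\<close>
  have "S s"
    unfolding S
  proof (intro allI impI)
    fix \<psi> f F assume h: "H1_rep ?A \<psi> f F" "integrable lborel (\<lambda>x. norm (f x) powr p)"
    let ?T = "(\<Sum>j\<in>UNIV. sq_norm (mag_field ?A f F j)) + \<beta> * Lp_int p f powr (2 / p)"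
    have le: "\<nu> * sq_norm f \<le> ?T" if "S \<nu>" for \<nu> using that h S by blast
    show "s * sq_norm f \<le> ?T"
    proof (cases "sq_norm f = 0")
      case False
      then have n: "0 < sq_norm f" using sq_norm_nonneg[of f] by linarith
      have "s \<le> ?T / sq_norm f"
        unfolding s_def using LT le n by (intro cSup_least) (auto simp: pos_le_divide_eq)
      then show ?thesis using n by (simp add: pos_le_divide_eq)
    qed (use le[OF LT] in simp)
  qed
  then have "Greatest S = s" using upper by (rule Greatest_equality)
  then show "nu_mag B p \<beta> \<ge> nu_LT B p \<beta>" using upper[OF LT] by (simp add: nu)
qed

end
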